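(* Suppose $L_i$ is the identity matrix for all $i\in I$. Then there is strong uniqueness for the linear system in the class of $L^\infty(\Omega\times[0,\infty);H)$ solutions. That is: if $X^{(1)}$ and $X^{(2)}$ are two energy controlled solutions of the linear system with the same initial condition $x\in H$, defined on the same filtered probability space $(\Omega,\mathcal F_\infty,(\mathcal F_t)_{t\ge0},Q)$ with the same family of Brownian motions $Y$, then $Q$-a.s. $X^{(1)}(t)=X^{(2)}(t)$ for all $t\ge0$.
   Context: Setting. Fix an integer $d\ge1$, reals $\lambda>1$ and $\sigma$, a finite set $I$ and a permutation $\tau$ of $I$ without fixed points with $\tau=\tau^{-1}$; write $\tilde\imath=\tau(i)$. For each $i\in I$ let $k_i\in\mathbb R$, $r_i\in\mathbb Z\setminus\{0\}$, $h_i\in\mathbb Z$ and a bilinear map $B_i:\mathbb R^d\times\mathbb R^d\to\mathbb R^d$ be given, such that for all $i\in I$ and $u,v,w\in\mathbb R^d$: $k_{\tilde\imath}=-k_i\lambda^{-r_i}$; $\langle u,B_{\tilde\imath}(v,w)\rangle=\langle v,B_i(u,w)\rangle$; $r_{\tilde\imath}=-r_i$; $h_{\tilde\imath}=h_i-r_i$; and $\max_{i\in I}h_i\ge0$. For $n\ge1$ let $I_n=\{i\in I:n+r_i\ge1,\ n+h_i\ge1\}$, and $k_{i,n}=\lambda^nk_i$ if $i\in I_n$, $k_{i,n}=0$ otherwise. With $B_i^{\alpha,\beta,\gamma}$ the coefficients of $B_i$ (so $B_i(v,w)^\alpha=\sum_{\beta,\gamma}B_i^{\alpha,\beta,\gamma}v^\beta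 w^\gamma$), $L_i$ is the $d\times d$ matrix $L_i^{\alpha,\beta}=\sum_{\gamma,\delta}B_i^{\alpha,\gamma,\delta}B_i^{\beta,\gamma,\delta}$. $H=\ell^2(\mathbb R^d)$ is the space of square-summable sequences $(x_n)_{n\ge1}$ in $\mathbb R^d$, with norm $\|\cdot\|$. Convention: $X_n\equiv0$ for $n\le0$. Fix $I^*\subset I$ with $I$ the disjoint union of $I^*$ and $\tau(I^* )$. A family $Y=(Y_{i,n})_{i\in I,n\in\mathbb Z}$ of $d$-dimensional Brownian motions is symmetric with respect to $\tau$ if $(Y_{i,n})_{i\in I^*,n\in\mathbb Z}$ are independent and $Y_{\tau(i),n}=Y_{i,n}$ a.s. for all $i,n$. A weak solution of the linear system with initial condition $x\in H$ consists of a complete filtered probability space $(\Omega,\mathcal F_\infty,(\mathcal F_t)_{t\ge0},Q)$, a family $Y$ of $d$-dimensional $(\mathcal F_t)$-Brownian motions symmetric with respect to $\tau$, and an $H$-valued process $X=(X_n)_{n\ge1}$ with continuous adapted components such that for all $n\ge1$, $t\ge0$, $$X_n(t)=x_n+\sum_{i\in I}\Bigl\{\int_0^t\sigma k_{i,n}B_i(X_{n+r_i}(s),dY_{i,n+h_i}(s))-\int_0^t\frac{\sigma^2}2k_{i,n}^2L_iX_n(s)ds\Bigr\}.$$ It is an energy controlled solution if $X\in L^\infty(\Omega\times[0,\infty);H)$. *)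

theory Defs
  imports "HOL-Probability.Probability"
begin

text \<open>
  Time is indexed by \<^typ>\<open>real\<close>, and only the values of filtrations and processes at nonnegative
  times matter; \<open>max 0 t\<close> below turns a family on the half-line into one on \<^typ>\<open>real\<close>.
  The measure space \<open>M\<close> carries the total \<open>\<sigma>\<close>-algebra \<open>\<F>\<^sub>\<infinity>\<close> and the probability \<open>Q\<close>.
  Right-continuity of the filtration is not required.
\<close>

definition complete_filtered_prob_space :: "'a measure \<Rightarrow> (real \<Rightarrow> 'a measure) \<Rightarrow> bool" where
  "complete_filtered_prob_space M F \<longleftrightarrow>
     prob_space M \<and> complete_measure M \<and>
     filtration (space M) (\<lambda>t. F (max 0 t)) \<and>
     (\<forall>t\<ge>0. subalgebra M (F t) \<and> null_sets M \<subseteq> sets (F t))"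

definition brownian_motion ::
  "'a measure \<Rightarrow> (real \<Rightarrow> 'a measure) \<Rightarrow> (real \<Rightarrow> 'a \<Rightarrow> real ^ 'd) \<Rightarrow> bool" where
  "brownian_motion M F W \<longleftrightarrow>
     (\<forall>t\<ge>0. W t \<in> borel_measurable (F t)) \<and>
     (AE \<omega> in M. W 0 \<omega> = 0) \<and>
     (AE \<omega> in M. continuous_on {0..} (\<lambda>t. W t \<omega>)) \<and>
     (\<forall>s t. 0 \<le> s \<and> s < t \<longrightarrow>
        prob_space.indep_set M (sets (F s))
          (sets (vimage_algebra (space M) (\<lambda>\<omega>. W t \<omega> - W s \<omega>) borel)) \<and>
        prob_space.indep_vars M (\<lambda>_. borel) (\<lambda>a \<omega>. (W t \<omega> - W s \<omega>) $ a) UNIV \<and>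
        (\<forall>a. distributed M lborel (\<lambda>\<omega>. (W t \<omega> - W s \<omega>) $ a)
               (\<lambda>y. ennreal (normal_density 0 (sqrt (t - s)) y))))"

text \<open>
  The members of the family are independent as processes, that is, as random elements of the
  product space of functions on the half-line.
\<close>

definition symmetric_family ::
  "'a measure \<Rightarrow> 'i set \<Rightarrow> ('i \<Rightarrow> 'i) \<Rightarrow> 'i set \<Rightarrow> ('i \<Rightarrow> int \<Rightarrow> real \<Rightarrow> 'a \<Rightarrow> real ^ 'd) \<Rightarrow> bool" where
  "symmetric_family M I \<tau> Istar Y \<longleftrightarrow>
     prob_space.indep_vars M (\<lambda>_. PiM {0..} (\<lambda>_. borel))
       (\<lambda>(i, n) \<omega>. restrict (\<lambda>t. Y i n t \<omega>) {0..}) (Istar \<times> UNIV) \<and>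
     (\<forall>i\<in>I. \<forall>n. AE \<omega> in M. \<forall>t\<ge>0. Y (\<tau> i) n t \<omega> = Y i n t \<omega>)"

text \<open>
  The Ito integral of a matrix-valued integrand against a vector-valued Brownian motion.
  A simple integrand is \<open>\<Sum>j<N. \<xi> j * 1\<^bsub>(p j, p (j+1)]\<^esub>\<close> with \<open>\<xi> j\<close> bounded and measurable
  with respect to \<open>F (p j)\<close>.  A random variable \<open>Z\<close> is the integral of \<open>\<Phi>\<close> over \<open>[0, t]\<close> if some
  sequence of simple integrands \<open>S\<^sub>m\<close> satisfies \<open>\<integral>\<^sub>0\<^sup>t |S\<^sub>m - \<Phi>|\<^sup>2 ds \<rightarrow> 0\<close> in probability and
  the elementary integrals of \<open>S\<^sub>m\<close> converge to \<open>Z\<close> in probability.  This is the usual extension of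
  the integral from \<open>L\<^sup>2(\<Omega> \<times> [0,t])\<close> to adapted integrands with almost surely square-integrable
  paths.  The measurability clauses are needed because \<^const>\<open>emeasure\<close> and \<^const>\<open>measure\<close> are
  \<open>0\<close> on non-measurable sets.
\<close>

definition simple_integrand ::
  "'a measure \<Rightarrow> (real \<Rightarrow> 'a measure) \<Rightarrow> nat \<Rightarrow> (nat \<Rightarrow> real) \<Rightarrow> (nat \<Rightarrow> 'a \<Rightarrow> real ^ 'd ^ 'e) \<Rightarrow> bool"
  where
  "simple_integrand M F N p \<xi> \<longleftrightarrow>
     0 \<le> p 0 \<and>
     (\<forall>j<N. p j \<le> p (Suc j) \<and> \<xi> j \<in> borel_measurable (F (p j)) \<and> bounded (\<xi> j ` space M))"

definition simple_process ::
  "nat \<Rightarrow> (nat \<Rightarrow> real) \<Rightarrow> (nat \<Rightarrow> 'a \<Rightarrow> real ^ 'd ^ 'e) \<Rightarrow> real \<Rightarrow> 'a \<Rightarrow> real ^ 'd ^ 'e" where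
  "simple_process N p \<xi> s \<omega> = (\<Sum>j<N. indicator {p j<..p (Suc j)} s *\<^sub>R \<xi> j \<omega>)"

definition simple_integral ::
  "nat \<Rightarrow> (nat \<Rightarrow> real) \<Rightarrow> (nat \<Rightarrow> 'a \<Rightarrow> real ^ 'd ^ 'e) \<Rightarrow> (real \<Rightarrow> 'a \<Rightarrow> real ^ 'd) \<Rightarrow>
   real \<Rightarrow> 'a \<Rightarrow> real ^ 'e" where
  "simple_integral N p \<xi> W t \<omega> =
     (\<Sum>j<N. \<xi> j \<omega> *v (W (min t (p (Suc j))) \<omega> - W (min t (p j)) \<omega>))"

definition has_ito_integral ::
  "'a measure \<Rightarrow> (real \<Rightarrow> 'a measure) \<Rightarrow> (real \<Rightarrow> 'a \<Rightarrow> real ^ 'd) \<Rightarrow>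
   (real \<Rightarrow> 'a \<Rightarrow> real ^ 'd ^ 'e) \<Rightarrow> real \<Rightarrow> ('a \<Rightarrow> real ^ 'e) \<Rightarrow> bool" where
  "has_ito_integral M F W \<Phi> t Z \<longleftrightarrow>
     (AE \<omega> in M. set_borel_measurable borel {0..t} (\<lambda>s. \<Phi> s \<omega>)) \<and>
     Z \<in> borel_measurable M \<and>
     (\<exists>N p \<xi>.
        let err = (\<lambda>m \<omega>. \<integral>\<^sup>+ s\<in>{0..t}. ennreal ((norm (simple_process (N m) (p m) (\<xi> m) s \<omega> - \<Phi> s \<omega>))\<^sup>2) \<partial>lborel);
            J = (\<lambda>m. simple_integral (N m) (p m) (\<xi> m) W t)
        in (\<forall>m. simple_integrand M F (N m) (p m) (\<xi> m)) \<and>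
           (\<forall>m. err m \<in> borel_measurable M) \<and>
           (\<forall>\<epsilon>>0. (\<lambda>m. measure M {\<omega> \<in> space M. err m \<omega> > ennreal \<epsilon>}) \<longlonglongrightarrow> 0) \<and>
           (\<forall>m. J m \<in> borel_measurable M) \<and>
           (\<forall>\<epsilon>>0. (\<lambda>m. measure M {\<omega> \<in> space M. dist (J m \<omega>) (Z \<omega>) > \<epsilon>}) \<longlonglongrightarrow> 0))"

text \<open>
  Elements of \<open>\<ell>\<^sup>2(\<real>\<^sup>d)\<close> are sequences over the indices \<open>n \<ge> 1\<close>, extended by \<open>0\<close> to all
  integers, so that the convention \<open>X\<^sub>n = 0\<close> for \<open>n \<le> 0\<close> is part of membership.
\<close>

definition ell2 :: "(int \<Rightarrow> real ^ 'd) set" where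
  "ell2 = {x. (\<forall>n\<le>0. x n = 0) \<and> (\<lambda>n. (norm (x n))\<^sup>2) summable_on {1..}}"

definition ell2_norm :: "(int \<Rightarrow> real ^ 'd) \<Rightarrow> real" where
  "ell2_norm x = sqrt (\<Sum>\<^sub>\<infinity>n\<in>{1..}. (norm (x n))\<^sup>2)"

text \<open>
  \<open>k_coeff\<close> is \<open>k\<^bsub>i,n\<^esub>\<close> for \<open>i \<in> I\<close> and \<open>n \<ge> 1\<close>; the condition in it defines \<open>I\<^sub>n\<close>.  The letter
  \<open>l\<close> stands for the constant \<open>\<lambda>\<close>.
\<close>

definition k_coeff :: "real \<Rightarrow> ('i \<Rightarrow> real) \<Rightarrow> ('i \<Rightarrow> int) \<Rightarrow> ('i \<Rightarrow> int) \<Rightarrow> 'i \<Rightarrow> int \<Rightarrow> real" where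
  "k_coeff l k r h i n = (if n + r i \<ge> 1 \<and> n + h i \<ge> 1 then l powi n * k i else 0)"

definition B_coeff :: "(real ^ 'd \<Rightarrow> real ^ 'd \<Rightarrow> real ^ 'd) \<Rightarrow> 'd \<Rightarrow> 'd \<Rightarrow> 'd \<Rightarrow> real" where
  "B_coeff b \<alpha> \<beta> \<gamma> = b (axis \<beta> 1) (axis \<gamma> 1) $ \<alpha>"

definition L_matrix :: "(real ^ 'd \<Rightarrow> real ^ 'd \<Rightarrow> real ^ 'd) \<Rightarrow> real ^ 'd ^ 'd" where
  "L_matrix b = (\<chi> \<alpha> \<beta>. \<Sum>\<gamma>\<in>UNIV. \<Sum>\<delta>\<in>UNIV. B_coeff b \<alpha> \<gamma> \<delta> * B_coeff b \<beta> \<gamma> \<delta>)"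

text \<open>
  \<open>X t \<omega>\<close> is the element \<open>(X\<^sub>n(t))\<^sub>n\<close> of \<open>\<ell>\<^sup>2\<close>; \<open>Z i\<close> is the stochastic integral with integrand
  \<open>v \<mapsto> \<sigma> k\<^bsub>i,n\<^esub> B\<^sub>i(X\<^bsub>n+r\<^sub>i\<^esub>(s), v)\<close>.
\<close>

definition weak_solution ::
  "'i set \<Rightarrow> ('i \<Rightarrow> 'i) \<Rightarrow> 'i set \<Rightarrow> real \<Rightarrow> real \<Rightarrow> ('i \<Rightarrow> real) \<Rightarrow> ('i \<Rightarrow> int) \<Rightarrow> ('i \<Rightarrow> int) \<Rightarrow>
   ('i \<Rightarrow> real ^ 'd \<Rightarrow> real ^ 'd \<Rightarrow> real ^ 'd) \<Rightarrow> (int \<Rightarrow> real ^ 'd) \<Rightarrow>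
   'a measure \<Rightarrow> (real \<Rightarrow> 'a measure) \<Rightarrow> ('i \<Rightarrow> int \<Rightarrow> real \<Rightarrow> 'a \<Rightarrow> real ^ 'd) \<Rightarrow>
   (real \<Rightarrow> 'a \<Rightarrow> int \<Rightarrow> real ^ 'd) \<Rightarrow> bool" where
  "weak_solution I \<tau> Istar l \<sigma> k r h B x M F Y X \<longleftrightarrow>
     complete_filtered_prob_space M F \<and>
     (\<forall>i\<in>I. \<forall>n. brownian_motion M F (Y i n)) \<and>
     symmetric_family M I \<tau> Istar Y \<and>
     (\<forall>t\<ge>0. \<forall>\<omega>\<in>space M. X t \<omega> \<in> ell2) \<and>
     (\<forall>n\<ge>1. (\<forall>t\<ge>0. (\<lambda>\<omega>. X t \<omega> n) \<in> borel_measurable (F t)) \<and>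
             (AE \<omega> in M. continuous_on {0..} (\<lambda>t. X t \<omega> n))) \<and>
     (\<forall>n\<ge>1. \<forall>t\<ge>0. \<exists>Z.
        (\<forall>i\<in>I. has_ito_integral M F (Y i (n + h i))
                  (\<lambda>s \<omega>. matrix (\<lambda>v. (\<sigma> * k_coeff l k r h i n) *\<^sub>R B i (X s \<omega> (n + r i)) v)) t (Z i)) \<and>
        (AE \<omega> in M. X t \<omega> n = x n +
           (\<Sum>i\<in>I. Z i \<omega> -
              integral {0..t} (\<lambda>s. (\<sigma>\<^sup>2 / 2 * (k_coeff l k r h i n)\<^sup>2) *\<^sub>R (L_matrix (B i) *v X s \<omega> n)))))"

text \<open>
  Membership in \<open>L\<^sup>\<infinity>(\<Omega> \<times> [0,\<infinity>); \<ell>\<^sup>2)\<close>.  As \<open>\<ell>\<^sup>2\<close> is separable, measurability of an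
  \<open>\<ell>\<^sup>2\<close>-valued function is measurability of its components; the completed product is used because
  elements of \<open>L\<^sup>\<infinity>\<close> only matter up to null sets.
\<close>

definition in_L_infinity :: "'a measure \<Rightarrow> (real \<Rightarrow> 'a \<Rightarrow> int \<Rightarrow> real ^ 'd) \<Rightarrow> bool" where
  "in_L_infinity M X \<longleftrightarrow>
     (let P = completion (M \<Otimes>\<^sub>M restrict_space lborel {0..})
      in (\<forall>n\<ge>1. (\<lambda>(\<omega>, t). X t \<omega> n) \<in> borel_measurable P) \<and>
         (\<exists>C. AE (\<omega>, t) in P. X t \<omega> \<in> ell2 \<and> ell2_norm (X t \<omega>) \<le> C))"

definition energy_controlled_solution ::
  "'i set \<Rightarrow> ('i \<Rightarrow> 'i) \<Rightarrow> 'i set \<Rightarrow> real \<Rightarrow> real \<Rightarrow> ('i \<Rightarrow> real) \<Rightarrow> ('i \<Rightarrow> int) \<Rightarrow> ('i \<Rightarrow> int) \<Rightarrow>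
   ('i \<Rightarrow> real ^ 'd \<Rightarrow> real ^ 'd \<Rightarrow> real ^ 'd) \<Rightarrow> (int \<Rightarrow> real ^ 'd) \<Rightarrow>
   'a measure \<Rightarrow> (real \<Rightarrow> 'a measure) \<Rightarrow> ('i \<Rightarrow> int \<Rightarrow> real \<Rightarrow> 'a \<Rightarrow> real ^ 'd) \<Rightarrow>
   (real \<Rightarrow> 'a \<Rightarrow> int \<Rightarrow> real ^ 'd) \<Rightarrow> bool" where
  "energy_controlled_solution I \<tau> Istar l \<sigma> k r h B x M F Y X \<longleftrightarrow>
     weak_solution I \<tau> Istar l \<sigma> k r h B x M F Y X \<and> in_L_infinity M X"

end

theory Submission
  imports Defs
begin

text \<open>
  Let \<open>D\<close> be the difference of the two solutions and \<open>u\<^sub>n(t) = E |D\<^sub>n(t)|\<^sup>2\<close>.  The proof rests on two facts.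

  \<^item> The second moments satisfy a closed linear system.  Component \<open>n\<close> loses mass to its own drift
    at rate \<open>\<sigma>\<^sup>2 k\<^bsub>i,n\<^esub>\<^sup>2\<close> for each \<open>i\<close>, and the quadratic variation of the \<open>i\<close>-th noise term feeds
    back \<open>\<sigma>\<^sup>2 k\<^bsub>i,n\<^esub>\<^sup>2 |D\<^bsub>n+r\<^sub>i\<^esub>|\<^sup>2\<close>: the squared Hilbert-Schmidt norm of \<open>v \<mapsto> B\<^sub>i(y, v)\<close> is \<open>|y|\<^sup>2\<close>, because
    \<open>B\<^bsub>\<tau>(i)\<^esub>\<close> is adjoint to \<open>B\<^sub>i\<close> and \<open>L\<^bsub>\<tau>(i)\<^esub>\<close> is the identity.  The noise terms of one equation are
    uncorrelated, since the only coinciding motions are those of \<open>i\<close> and \<open>\<tau>(i)\<close> at equal second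
    index, and \<open>h\<^sub>i \<noteq> h\<^bsub>\<tau>(i)\<^esub>\<close> as \<open>r\<^sub>i \<noteq> 0\<close>.  Hence (\<open>second_moment_equation\<close>)
    \<open>u\<^sub>n(t) = \<Sum>\<^sub>i \<sigma>\<^sup>2 k\<^bsub>i,n\<^esub>\<^sup>2 \<integral>\<^sub>0\<^sup>t (u\<^bsub>n+r\<^sub>i\<^esub> - u\<^sub>n) ds\<close>.

  \<^item> This system has no nonzero solution that is nonnegative and bounded in \<open>\<ell>\<^sup>1\<close>
    (\<open>summable_system_vanishes\<close>), although its coefficients grow exponentially in \<open>n\<close>.  A summable
    nonnegative sequence attains its maximum; applied to the time integrals of \<open>u\<close>, the right-hand
    side is nonpositive at the maximum, which forces the maximum to be \<open>0\<close>.  Energy control provides the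
    bound in \<open>\<ell>\<^sup>1\<close>.

  So \<open>D\<^sub>n(t) = 0\<close> almost surely for each \<open>n\<close> and \<open>t\<close>, and continuity of paths gives all times at once.

  The second moments are computed from the Ito isometry and the martingale property alone.
  With \<open>c\<close> the drift rate, \<open>N(t) = D\<^sub>n(t) + c \<integral>\<^sub>0\<^sup>t D\<^sub>n ds\<close> is a sum of stochastic integrals, and pathwise
  \<open>N(t)\<^sup>2 = D\<^sub>n(t)\<^sup>2 + 2c \<integral>\<^sub>0\<^sup>t D\<^sub>n\<^sup>2 ds + 2c \<integral>\<^sub>0\<^sup>t D\<^sub>n(s) (N(t) - N(s)) ds\<close> in each coordinate, where the last
  term has mean zero (\<open>mean_square_identity\<close>).  The isometry and the martingale property hold for
  elementary integrands over any finite family of scalar motions with orthogonal increments and pass to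
  the limit in \<open>L\<^sup>2\<close>.  The stochastic integral of the system is a limit in probability; for a
  bounded integrand it is also a limit in \<open>L\<^sup>2\<close> of elementary integrals
  (\<open>L2_ito_integral_of_has_ito_integral\<close>).
\<close>

section \<open>Square-integrable functions\<close>

lemma integrable_mult_bounded_left:
  fixes f g :: "'a \<Rightarrow> real"
  assumes "f \<in> borel_measurable M" "\<And>x. x \<in> space M \<Longrightarrow> \<bar>f x\<bar> \<le> C" "integrable M g"
  shows "integrable M (\<lambda>x. f x * g x)"
proof (rule Bochner_Integration.integrable_bound)
  show "integrable M (\<lambda>x. C * \<bar>g x\<bar>)" using assms by simp
  show "(\<lambda>x. f x * g x) \<in> borel_measurable M" using assms by simp
  show "AE x in M. norm (f x * g x) \<le> norm (C * \<bar>g x\<bar>)"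
  proof (rule AE_I2)
    fix x assume "x \<in> space M"
    then have "\<bar>f x\<bar> * \<bar>g x\<bar> \<le> C * \<bar>g x\<bar>" using assms(2) by (intro mult_right_mono) auto
    also have "\<dots> \<le> \<bar>C * \<bar>g x\<bar>\<bar>" by (rule abs_ge_self)
    finally show "norm (f x * g x) \<le> norm (C * \<bar>g x\<bar>)" by (simp add: abs_mult)
  qed
qed

lemma integrable_mult_of_squares:
  fixes f g :: "'a \<Rightarrow> real"
  assumes [measurable]: "f \<in> borel_measurable M" "g \<in> borel_measurable M"
    and "integrable M (\<lambda>x. (f x)\<^sup>2)" "integrable M (\<lambda>x. (g x)\<^sup>2)"
  shows "integrable M (\<lambda>x. f x * g x)"
proof (rule Bochner_Integration.integrable_bound)
  show "integrable M (\<lambda>x. (f x)\<^sup>2 + (g x)\<^sup>2)" using assms by simp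
  show "(\<lambda>x. f x * g x) \<in> borel_measurable M" by measurable
  show "AE x in M. norm (f x * g x) \<le> norm ((f x)\<^sup>2 + (g x)\<^sup>2)"
  proof (rule AE_I2)
    fix x
    have "2 * \<bar>f x * g x\<bar> \<le> (f x)\<^sup>2 + (g x)\<^sup>2"
      using sum_squares_bound[of "\<bar>f x\<bar>" "\<bar>g x\<bar>"] by (simp add: abs_mult)
    then have "\<bar>f x * g x\<bar> \<le> (f x)\<^sup>2 + (g x)\<^sup>2" using abs_ge_zero[of "f x * g x"] by linarith
    then show "norm (f x * g x) \<le> norm ((f x)\<^sup>2 + (g x)\<^sup>2)" by simp
  qed
qed

lemma (in finite_measure) integrable_of_square:
  fixes f :: "'a \<Rightarrow> real"
  assumes [measurable]: "f \<in> borel_measurable M" and "integrable M (\<lambda>x. (f x)\<^sup>2)"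
  shows "integrable M f"
  using integrable_mult_of_squares[of f M "\<lambda>_. 1"] assms by simp

lemma integrable_square_add:
  fixes f g :: "'a \<Rightarrow> real"
  assumes "f \<in> borel_measurable M" "g \<in> borel_measurable M"
    and "integrable M (\<lambda>x. (f x)\<^sup>2)" "integrable M (\<lambda>x. (g x)\<^sup>2)"
  shows "integrable M (\<lambda>x. (f x + g x)\<^sup>2)" "integrable M (\<lambda>x. (f x - g x)\<^sup>2)"
  using integrable_mult_of_squares[OF assms] assms(3,4)
  by (simp_all add: power2_sum power2_diff mult.assoc)

text \<open>
  The quadratic polynomial \<open>c \<mapsto> \<integral> (c f + g)\<^sup>2\<close> is
  nonnegative, so its discriminant is not positive.
\<close>

lemma Cauchy_Schwarz_integral:
  fixes f g :: "'a \<Rightarrow> real"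
  assumes "f \<in> borel_measurable M" "g \<in> borel_measurable M"
    and "integrable M (\<lambda>x. (f x)\<^sup>2)" "integrable M (\<lambda>x. (g x)\<^sup>2)"
  shows "(\<integral>x. f x * g x \<partial>M)\<^sup>2 \<le> (\<integral>x. (f x)\<^sup>2 \<partial>M) * (\<integral>x. (g x)\<^sup>2 \<partial>M)"
proof -
  define A where "A = (\<integral>x. (f x)\<^sup>2 \<partial>M)"
  define B where "B = (\<integral>x. f x * g x \<partial>M)"
  define C where "C = (\<integral>x. (g x)\<^sup>2 \<partial>M)"
  have fg: "integrable M (\<lambda>x. f x * g x)" by (rule integrable_mult_of_squares[OF assms])
  have q: "0 \<le> c\<^sup>2 * A + 2 * c * B + C" for c
  proof -
    have "0 \<le> (\<integral>x. (c * f x + g x)\<^sup>2 \<partial>M)" by simp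
    also have "(\<lambda>x. (c * f x + g x)\<^sup>2) = (\<lambda>x. c\<^sup>2 * (f x)\<^sup>2 + 2 * c * (f x * g x) + (g x)\<^sup>2)"
      by (rule ext) (simp add: power2_sum power_mult_distrib)
    also have "(\<integral>x. c\<^sup>2 * (f x)\<^sup>2 + 2 * c * (f x * g x) + (g x)\<^sup>2 \<partial>M) = c\<^sup>2 * A + 2 * c * B + C"
      unfolding A_def B_def C_def using fg assms(3,4) by simp
    finally show ?thesis .
  qed
  have "0 \<le> A" by (simp add: A_def)
  have "B\<^sup>2 \<le> A * C"
  proof (cases "A = 0")
    case True
    have "B = 0"
    proof (rule ccontr)
      assume "B \<noteq> 0"
      then show False using q[of "- (C + 1) / (2 * B)"] True by (simp add: field_simps)
    qed
    then show ?thesis using True by simp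
  next
    case False
    then have "0 < A" using \<open>0 \<le> A\<close> by simp
    have "0 \<le> (- B / A)\<^sup>2 * A + 2 * (- B / A) * B + C" by (rule q)
    also have "\<dots> = (A * C - B\<^sup>2) / A"
      using \<open>0 < A\<close> by (simp add: field_simps power2_eq_square)
    finally show ?thesis using \<open>0 < A\<close> by (simp add: zero_le_divide_iff)
  qed
  then show ?thesis by (simp add: A_def B_def C_def)
qed

lemma L2_tendsto_imp_tendsto_integral_mult:
  fixes f :: "nat \<Rightarrow> 'a \<Rightarrow> real"
  assumes meas: "\<And>m. f m \<in> borel_measurable M" "f' \<in> borel_measurable M" "g \<in> borel_measurable M"
    and sq: "\<And>m. integrable M (\<lambda>x. (f m x)\<^sup>2)" "integrable M (\<lambda>x. (f' x)\<^sup>2)" "integrable M (\<lambda>x. (g x)\<^sup>2)"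
    and lim: "(\<lambda>m. \<integral>x. (f m x - f' x)\<^sup>2 \<partial>M) \<longlonglongrightarrow> 0"
  shows "(\<lambda>m. \<integral>x. f m x * g x \<partial>M) \<longlonglongrightarrow> (\<integral>x. f' x * g x \<partial>M)"
proof -
  define b where "b m = (\<integral>x. f m x * g x \<partial>M) - (\<integral>x. f' x * g x \<partial>M)" for m
  have b: "b m = (\<integral>x. (f m x - f' x) * g x \<partial>M)" for m
    using integrable_mult_of_squares[OF meas(1)[of m] meas(3) sq(1) sq(3)]
      integrable_mult_of_squares[OF meas(2) meas(3) sq(2) sq(3)]
    by (simp add: b_def left_diff_distrib)
  have "(b m)\<^sup>2 \<le> (\<integral>x. (f m x - f' x)\<^sup>2 \<partial>M) * (\<integral>x. (g x)\<^sup>2 \<partial>M)" for m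
    unfolding b using meas sq
    by (intro Cauchy_Schwarz_integral integrable_square_add) auto
  moreover have "(\<lambda>m. (\<integral>x. (f m x - f' x)\<^sup>2 \<partial>M) * (\<integral>x. (g x)\<^sup>2 \<partial>M)) \<longlonglongrightarrow> 0"
    using lim by (rule tendsto_mult_left_zero)
  ultimately have "(\<lambda>m. (b m)\<^sup>2) \<longlonglongrightarrow> 0"
    by (intro Lim_null_comparison[where f = "\<lambda>m. (b m)\<^sup>2"] always_eventually allI) (simp, assumption)
  then have "(\<lambda>m. sqrt ((b m)\<^sup>2)) \<longlonglongrightarrow> sqrt 0" by (rule tendsto_real_sqrt)
  then have "b \<longlonglongrightarrow> 0" by (simp add: tendsto_rabs_zero_iff)
  then show ?thesis unfolding b_def by (rule LIM_zero_cancel)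
qed

lemma L2_tendsto_imp_tendsto_integral_square:
  fixes f :: "nat \<Rightarrow> 'a \<Rightarrow> real"
  assumes meas: "\<And>m. f m \<in> borel_measurable M" "f' \<in> borel_measurable M"
    and sq: "\<And>m. integrable M (\<lambda>x. (f m x)\<^sup>2)" "integrable M (\<lambda>x. (f' x)\<^sup>2)"
    and lim: "(\<lambda>m. \<integral>x. (f m x - f' x)\<^sup>2 \<partial>M) \<longlonglongrightarrow> 0"
  shows "(\<lambda>m. \<integral>x. (f m x)\<^sup>2 \<partial>M) \<longlonglongrightarrow> (\<integral>x. (f' x)\<^sup>2 \<partial>M)"
proof -
  have 1: "(\<lambda>m. \<integral>x. f m x * f' x \<partial>M) \<longlonglongrightarrow> (\<integral>x. f' x * f' x \<partial>M)"
    by (rule L2_tendsto_imp_tendsto_integral_mult[OF meas meas(2) sq sq(2) lim])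
  have int: "integrable M (\<lambda>x. f m x * f' x)" for m
    by (rule integrable_mult_of_squares[OF meas sq])
  have eq: "(\<integral>x. (f m x)\<^sup>2 \<partial>M) =
      (\<integral>x. (f m x - f' x)\<^sup>2 \<partial>M) + 2 * (\<integral>x. f m x * f' x \<partial>M) - (\<integral>x. (f' x)\<^sup>2 \<partial>M)" for m
    using int[of m] sq by (simp add: power2_diff mult.assoc)
  have "(\<lambda>m. (\<integral>x. (f m x - f' x)\<^sup>2 \<partial>M) + 2 * (\<integral>x. f m x * f' x \<partial>M) - (\<integral>x. (f' x)\<^sup>2 \<partial>M))
      \<longlonglongrightarrow> 0 + 2 * (\<integral>x. f' x * f' x \<partial>M) - (\<integral>x. (f' x)\<^sup>2 \<partial>M)"
    by (intro tendsto_intros lim 1)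
  then show ?thesis unfolding eq by (simp add: power2_eq_square[of "f' _"])
qed

lemma (in prob_space) bounded_in_probability_imp_expectation_tendsto_0:
  fixes e :: "nat \<Rightarrow> 'a \<Rightarrow> real"
  assumes [measurable]: "\<And>m. e m \<in> borel_measurable M"
    and bnd: "\<And>m \<omega>. \<omega> \<in> space M \<Longrightarrow> 0 \<le> e m \<omega> \<and> e m \<omega> \<le> R"
    and lim: "\<And>\<epsilon>. \<epsilon> > 0 \<Longrightarrow> (\<lambda>m. prob {\<omega> \<in> space M. e m \<omega> > \<epsilon>}) \<longlonglongrightarrow> 0"
  shows "(\<lambda>m. expectation (e m)) \<longlonglongrightarrow> 0"
proof (rule tendstoI)
  fix \<epsilon> :: real assume "0 < \<epsilon>"
  define A where "A m = {\<omega> \<in> space M. e m \<omega> > \<epsilon> / 2}" for m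
  have [measurable]: "A m \<in> sets M" for m unfolding A_def by measurable
  have int: "integrable M (e m)" for m
    by (rule integrable_const_bound[where B = R]) (use bnd in auto)
  have le: "expectation (e m) \<le> \<epsilon> / 2 + R * prob (A m)" for m
  proof -
    have "expectation (e m) \<le> expectation (\<lambda>\<omega>. \<epsilon> / 2 + R * indicator (A m) \<omega>)"
    proof (rule integral_mono)
      fix \<omega> assume "\<omega> \<in> space M"
      then show "e m \<omega> \<le> \<epsilon> / 2 + R * indicator (A m) \<omega>"
        using bnd[of \<omega> m] \<open>0 < \<epsilon>\<close> by (auto simp: A_def indicator_def)
    qed (rule int, intro Bochner_Integration.integrable_add integrable_mult_right integrable_const,
        rule integrable_real_indicator, simp_all add: emeasure_eq_measure)
    also have "\<dots> = \<epsilon> / 2 + R * prob (A m)"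
      by (subst Bochner_Integration.integral_add) (auto simp: prob_space emeasure_eq_measure)
    finally show ?thesis .
  qed
  have "(\<lambda>m. R * prob (A m)) \<longlonglongrightarrow> R * 0"
    unfolding A_def using \<open>0 < \<epsilon>\<close> by (intro tendsto_intros lim) simp
  then have "\<forall>\<^sub>F m in sequentially. R * prob (A m) < \<epsilon> / 2"
    using \<open>0 < \<epsilon>\<close> by (auto dest!: order_tendstoD(2)[where a = "\<epsilon> / 2"])
  then show "\<forall>\<^sub>F m in sequentially. dist (expectation (e m)) 0 < \<epsilon>"
  proof (rule eventually_mono)
    fix m assume "R * prob (A m) < \<epsilon> / 2"
    moreover have "0 \<le> expectation (e m)" using bnd by (intro integral_nonneg_AE) auto
    ultimately show "dist (expectation (e m)) 0 < \<epsilon>" using le[of m] by simp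
  qed
qed

text \<open>
  Limits in probability identify limits in \<open>L\<^sup>2\<close>: along a subsequence the
  convergence is almost sure, and by Fatou's lemma \<open>E (J m - Z)\<^sup>2\<close> is at
  most the tail of the Cauchy condition.
\<close>

lemma (in prob_space) L2_Cauchy_in_probability:
  fixes J :: "nat \<Rightarrow> 'a \<Rightarrow> real"
  assumes meas [measurable]: "\<And>m. J m \<in> borel_measurable M" "Z \<in> borel_measurable M"
    and sq: "\<And>m. integrable M (\<lambda>\<omega>. (J m \<omega>)\<^sup>2)"
    and cauchy: "\<And>\<epsilon>. \<epsilon> > 0 \<Longrightarrow> \<exists>N. \<forall>m\<ge>N. \<forall>k\<ge>N. expectation (\<lambda>\<omega>. (J m \<omega> - J k \<omega>)\<^sup>2) \<le> \<epsilon>"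
    and lim: "\<And>\<epsilon>. \<epsilon> > 0 \<Longrightarrow> (\<lambda>m. prob {\<omega> \<in> space M. \<bar>J m \<omega> - Z \<omega>\<bar> > \<epsilon>}) \<longlonglongrightarrow> 0"
  shows "integrable M (\<lambda>\<omega>. (Z \<omega>)\<^sup>2)"
    and "(\<lambda>m. expectation (\<lambda>\<omega>. (J m \<omega> - Z \<omega>)\<^sup>2)) \<longlonglongrightarrow> 0"
proof -
  \<comment> \<open>Truncation at \<open>1\<close> turns convergence in probability into convergence in
    \<open>L\<^sup>1\<close>, which provides a subsequence that converges almost surely.\<close>
  define e where "e m \<omega> = min 1 \<bar>J m \<omega> - Z \<omega>\<bar>" for m \<omega>
  have e_meas [measurable]: "e m \<in> borel_measurable M" for m unfolding e_def by measurable
  have "(\<lambda>m. expectation (e m)) \<longlonglongrightarrow> 0"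
  proof (rule bounded_in_probability_imp_expectation_tendsto_0[where R = 1])
    fix \<epsilon> :: real assume "0 < \<epsilon>"
    have "prob {\<omega> \<in> space M. e m \<omega> > \<epsilon>} \<le> prob {\<omega> \<in> space M. \<bar>J m \<omega> - Z \<omega>\<bar> > \<epsilon>}" for m
      by (rule finite_measure_mono) (auto simp: e_def)
    then show "(\<lambda>m. prob {\<omega> \<in> space M. e m \<omega> > \<epsilon>}) \<longlonglongrightarrow> 0"
      by (intro Lim_null_comparison[OF _ lim[OF \<open>0 < \<epsilon>\<close>]] always_eventually allI) simp
  qed (auto simp: e_def)
  moreover have "norm (e m \<omega>) = e m \<omega>" for m \<omega> by (simp add: e_def)
  ultimately have "(\<lambda>m. expectation (\<lambda>\<omega>. norm (e m \<omega>))) \<longlonglongrightarrow> 0"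
    by (simp cong del: if_weak_cong)
  moreover have "integrable M (e m)" for m
    by (rule integrable_const_bound[where B = 1]) (auto simp: e_def)
  ultimately obtain \<rho> where \<rho>: "strict_mono \<rho>" "AE \<omega> in M. (\<lambda>k. e (\<rho> k) \<omega>) \<longlonglongrightarrow> 0"
    using tendsto_L1_AE_subseq[of M e] by metis
  have ae: "AE \<omega> in M. (\<lambda>k. J (\<rho> k) \<omega>) \<longlonglongrightarrow> Z \<omega>"
    using \<rho>(2)
  proof (rule AE_mp, intro AE_I2 impI)
    fix \<omega> assume "(\<lambda>k. e (\<rho> k) \<omega>) \<longlonglongrightarrow> 0"
    moreover from this have "\<forall>\<^sub>F k in sequentially. e (\<rho> k) \<omega> < 1"
      by (rule order_tendstoD) simp
    then have "\<forall>\<^sub>F k in sequentially. e (\<rho> k) \<omega> = \<bar>J (\<rho> k) \<omega> - Z \<omega>\<bar>"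
      by (rule eventually_mono) (auto simp: e_def)
    ultimately have "(\<lambda>k. \<bar>J (\<rho> k) \<omega> - Z \<omega>\<bar>) \<longlonglongrightarrow> 0"
      by (rule Lim_transform_eventually)
    then show "(\<lambda>k. J (\<rho> k) \<omega>) \<longlonglongrightarrow> Z \<omega>"
      using LIM_zero_cancel tendsto_rabs_zero_iff by blast
  qed
  have fatou: "(\<integral>\<^sup>+\<omega>. ennreal ((J m \<omega> - Z \<omega>)\<^sup>2) \<partial>M) \<le> ennreal \<epsilon>"
    if N: "\<forall>m\<ge>N. \<forall>k\<ge>N. expectation (\<lambda>\<omega>. (J m \<omega> - J k \<omega>)\<^sup>2) \<le> \<epsilon>" and "m \<ge> N" for m N \<epsilon>
  proof -
    have "(\<integral>\<^sup>+\<omega>. ennreal ((J m \<omega> - Z \<omega>)\<^sup>2) \<partial>M) =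
        (\<integral>\<^sup>+\<omega>. liminf (\<lambda>k. ennreal ((J m \<omega> - J (\<rho> k) \<omega>)\<^sup>2)) \<partial>M)"
    proof (rule nn_integral_cong_AE, rule AE_mp[OF ae], intro AE_I2 impI)
      fix \<omega> assume "(\<lambda>k. J (\<rho> k) \<omega>) \<longlonglongrightarrow> Z \<omega>"
      then have "(\<lambda>k. ennreal ((J m \<omega> - J (\<rho> k) \<omega>)\<^sup>2)) \<longlonglongrightarrow> ennreal ((J m \<omega> - Z \<omega>)\<^sup>2)"
        by (intro tendsto_ennrealI tendsto_intros)
      then show "ennreal ((J m \<omega> - Z \<omega>)\<^sup>2) = liminf (\<lambda>k. ennreal ((J m \<omega> - J (\<rho> k) \<omega>)\<^sup>2))"
        by (intro lim_imp_Liminf[symmetric]) simp_all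
    qed
    also have "\<dots> \<le> liminf (\<lambda>k. \<integral>\<^sup>+\<omega>. ennreal ((J m \<omega> - J (\<rho> k) \<omega>)\<^sup>2) \<partial>M)"
      by (rule nn_integral_liminf) measurable
    also have "\<dots> \<le> liminf (\<lambda>k::nat. ennreal \<epsilon>)"
    proof (rule Liminf_mono, rule eventually_sequentiallyI[of N])
      fix k assume "N \<le> k"
      then have "N \<le> \<rho> k" using seq_suble[OF \<rho>(1), of k] by simp
      have "(\<integral>\<^sup>+\<omega>. ennreal ((J m \<omega> - J (\<rho> k) \<omega>)\<^sup>2) \<partial>M) =
          ennreal (expectation (\<lambda>\<omega>. (J m \<omega> - J (\<rho> k) \<omega>)\<^sup>2))"
        by (rule nn_integral_eq_integral) (auto intro: integrable_square_add sq meas)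
      also have "\<dots> \<le> ennreal \<epsilon>" using N \<open>m \<ge> N\<close> \<open>N \<le> \<rho> k\<close> by (intro ennreal_leI) auto
      finally show "(\<integral>\<^sup>+\<omega>. ennreal ((J m \<omega> - J (\<rho> k) \<omega>)\<^sup>2) \<partial>M) \<le> ennreal \<epsilon>" .
    qed
    also have "\<dots> = ennreal \<epsilon>" by (simp add: Liminf_const)
    finally show ?thesis .
  qed
  have fin: "\<exists>N. \<forall>m\<ge>N. integrable M (\<lambda>\<omega>. (J m \<omega> - Z \<omega>)\<^sup>2) \<and> expectation (\<lambda>\<omega>. (J m \<omega> - Z \<omega>)\<^sup>2) \<le> \<epsilon>"
    if e0: "\<epsilon> > 0" for \<epsilon>
  proof -
    obtain N where N: "\<forall>m\<ge>N. \<forall>k\<ge>N. expectation (\<lambda>\<omega>. (J m \<omega> - J k \<omega>)\<^sup>2) \<le> \<epsilon>"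
      using cauchy[OF e0] by blast
    show ?thesis
    proof (intro exI[of _ N] allI impI)
      fix m assume "N \<le> m"
      have le: "(\<integral>\<^sup>+\<omega>. ennreal ((J m \<omega> - Z \<omega>)\<^sup>2) \<partial>M) \<le> ennreal \<epsilon>" by (rule fatou[OF N \<open>N \<le> m\<close>])
      have i: "integrable M (\<lambda>\<omega>. (J m \<omega> - Z \<omega>)\<^sup>2)"
      proof (rule integrableI_nonneg)
        show "(\<integral>\<^sup>+\<omega>. ennreal ((J m \<omega> - Z \<omega>)\<^sup>2) \<partial>M) < \<infinity>"
          using le by (rule order.strict_trans1) simp
      qed auto
      moreover have "expectation (\<lambda>\<omega>. (J m \<omega> - Z \<omega>)\<^sup>2) \<le> \<epsilon>"
        using le \<open>\<epsilon> > 0\<close> by (subst (asm) nn_integral_eq_integral[OF i]) auto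
      ultimately show "integrable M (\<lambda>\<omega>. (J m \<omega> - Z \<omega>)\<^sup>2) \<and> expectation (\<lambda>\<omega>. (J m \<omega> - Z \<omega>)\<^sup>2) \<le> \<epsilon>"
        by blast
    qed
  qed
  obtain N where "integrable M (\<lambda>\<omega>. (J N \<omega> - Z \<omega>)\<^sup>2)" using fin[of 1] by auto
  then have "integrable M (\<lambda>\<omega>. (J N \<omega> - (J N \<omega> - Z \<omega>))\<^sup>2)"
    using integrable_square_add(2)[of "J N" M "\<lambda>\<omega>. J N \<omega> - Z \<omega>"] sq by simp
  then show "integrable M (\<lambda>\<omega>. (Z \<omega>)\<^sup>2)" by simp
  show "(\<lambda>m. expectation (\<lambda>\<omega>. (J m \<omega> - Z \<omega>)\<^sup>2)) \<longlonglongrightarrow> 0"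
  proof (rule tendstoI)
    fix \<epsilon> :: real assume "0 < \<epsilon>"
    then obtain N where N: "\<forall>m\<ge>N. expectation (\<lambda>\<omega>. (J m \<omega> - Z \<omega>)\<^sup>2) \<le> \<epsilon> / 2"
      using fin[of "\<epsilon> / 2"] by auto
    show "\<forall>\<^sub>F m in sequentially. dist (expectation (\<lambda>\<omega>. (J m \<omega> - Z \<omega>)\<^sup>2)) 0 < \<epsilon>"
    proof (rule eventually_sequentiallyI[of N])
      fix m assume "N \<le> m"
      then have "expectation (\<lambda>\<omega>. (J m \<omega> - Z \<omega>)\<^sup>2) \<le> \<epsilon> / 2" using N by blast
      then show "dist (expectation (\<lambda>\<omega>. (J m \<omega> - Z \<omega>)\<^sup>2)) 0 < \<epsilon>" using \<open>0 < \<epsilon>\<close> by simp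
    qed
  qed
qed

lemma L2_tendsto_0_add:
  fixes f g :: "nat \<Rightarrow> 'a \<Rightarrow> real"
  assumes meas: "\<And>m. f m \<in> borel_measurable M" "\<And>m. g m \<in> borel_measurable M"
    and sq: "\<And>m. integrable M (\<lambda>x. (f m x)\<^sup>2)" "\<And>m. integrable M (\<lambda>x. (g m x)\<^sup>2)"
    and lim: "(\<lambda>m. \<integral>x. (f m x)\<^sup>2 \<partial>M) \<longlonglongrightarrow> 0" "(\<lambda>m. \<integral>x. (g m x)\<^sup>2 \<partial>M) \<longlonglongrightarrow> 0"
  shows "(\<lambda>m. \<integral>x. (f m x + g m x)\<^sup>2 \<partial>M) \<longlonglongrightarrow> 0"
proof (rule Lim_null_comparison)
  show "(\<lambda>m. 2 * (\<integral>x. (f m x)\<^sup>2 \<partial>M) + 2 * (\<integral>x. (g m x)\<^sup>2 \<partial>M)) \<longlonglongrightarrow> 0"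
    using tendsto_add[OF tendsto_mult_left[OF lim(1), of 2] tendsto_mult_left[OF lim(2), of 2]] by simp
  show "\<forall>\<^sub>F m in sequentially. norm (\<integral>x. (f m x + g m x)\<^sup>2 \<partial>M) \<le>
      2 * (\<integral>x. (f m x)\<^sup>2 \<partial>M) + 2 * (\<integral>x. (g m x)\<^sup>2 \<partial>M)"
  proof (intro always_eventually allI)
    fix m
    have "(\<integral>x. (f m x + g m x)\<^sup>2 \<partial>M) \<le> (\<integral>x. 2 * (f m x)\<^sup>2 + 2 * (g m x)\<^sup>2 \<partial>M)"
    proof (rule integral_mono)
      fix x
      show "(f m x + g m x)\<^sup>2 \<le> 2 * (f m x)\<^sup>2 + 2 * (g m x)\<^sup>2"
        using sum_squares_bound[of "f m x" "g m x"] by (simp add: power2_sum)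
    qed (use integrable_square_add(1)[OF meas sq] sq in auto)
    also have "\<dots> = 2 * (\<integral>x. (f m x)\<^sup>2 \<partial>M) + 2 * (\<integral>x. (g m x)\<^sup>2 \<partial>M)"
      using sq by simp
    finally show "norm (\<integral>x. (f m x + g m x)\<^sup>2 \<partial>M) \<le>
      2 * (\<integral>x. (f m x)\<^sup>2 \<partial>M) + 2 * (\<integral>x. (g m x)\<^sup>2 \<partial>M)" by simp
  qed
qed

lemma integral_double_sum:
  fixes f :: "'i \<Rightarrow> 'j \<Rightarrow> 'a \<Rightarrow> real"
  assumes "\<And>j k. integrable M (f j k)"
  shows "(\<integral>x. (\<Sum>j\<in>A. \<Sum>k\<in>B. f j k x) \<partial>M) = (\<Sum>j\<in>A. \<Sum>k\<in>B. \<integral>x. f j k x \<partial>M)"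
  by (simp add: assms)

section \<open>Increments of Brownian motions\<close>

lemma borel_measurable_vec_nth [measurable (raw)]:
  fixes f :: "'a \<Rightarrow> real ^ 'd"
  assumes "f \<in> borel_measurable M"
  shows "(\<lambda>x. f x $ a) \<in> borel_measurable M"
  by (rule borel_measurable_continuous_on[OF _ assms, of "\<lambda>v. v $ a"])
    (intro linear_continuous_on bounded_linear_vec_nth)

lemma (in prob_space) expectation_mult_indep:
  fixes X Y :: "'a \<Rightarrow> real"
  assumes "indep_set (sets A) (sets N)" "subalgebra M A" "subalgebra M N"
    and "X \<in> borel_measurable A" "Y \<in> borel_measurable N" "integrable M X" "integrable M Y"
  shows "integrable M (\<lambda>\<omega>. X \<omega> * Y \<omega>)"
    and "expectation (\<lambda>\<omega>. X \<omega> * Y \<omega>) = expectation X * expectation Y"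
proof -
  have gen: "sigma_sets (space M) {f -` S \<inter> space M |S. S \<in> sets borel} \<subseteq> sets N'"
    if "subalgebra M N'" "f \<in> borel_measurable N'" for N' and f :: "'a \<Rightarrow> real"
  proof -
    have sp: "space N' = space M" using that(1) by (simp add: subalgebra_def)
    have "{f -` S \<inter> space N' |S. S \<in> sets borel} \<subseteq> sets N'"
      using measurable_sets[OF that(2)] by blast
    then show ?thesis unfolding sp[symmetric] by (rule sets.sigma_sets_subset)
  qed
  have "indep_var borel X borel Y"
    unfolding indep_var_eq
  proof (intro conjI)
    show "random_variable borel X" using assms(2,4) by (rule measurable_from_subalg)
    show "random_variable borel Y" using assms(3,5) by (rule measurable_from_subalg)
    show "indep_set (sigma_sets (space M) {X -` S \<inter> space M |S. S \<in> sets borel})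
       (sigma_sets (space M) {Y -` S \<inter> space M |S. S \<in> sets borel})"
      using assms(1) unfolding indep_set_def
      by (rule indep_sets_mono_sets) (use gen[OF assms(2,4)] gen[OF assms(3,5)] in \<open>auto split: bool.split\<close>)
  qed
  then show "integrable M (\<lambda>\<omega>. X \<omega> * Y \<omega>)"
    and "expectation (\<lambda>\<omega>. X \<omega> * Y \<omega>) = expectation X * expectation Y"
    using assms(6,7) by (auto intro: indep_var_integrable indep_var_lebesgue_integral)
qed

lemma (in prob_space) indep_var_of_indep_vars:
  assumes "indep_vars M' X A" "x \<in> A" "y \<in> A" "x \<noteq> y"
  shows "indep_var (M' x) (X x) (M' y) (X y)"
proof -
  let ?G = "\<lambda>i. sigma_sets (space M) {X i -` B \<inter> space M |B. B \<in> sets (M' i)}"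
  have rv: "random_variable (M' x) (X x)" "random_variable (M' y) (X y)" and ind: "indep_sets ?G A"
    using assms unfolding indep_vars_def by auto
  have "indep_set (?G x) (?G y)"
  proof (rule indep_setI)
    show "?G x \<subseteq> events" "?G y \<subseteq> events"
      using ind assms(2,3) unfolding indep_sets_def by blast+
    fix a b assume ab: "a \<in> ?G x" "b \<in> ?G y"
    have "prob (\<Inter>j\<in>{x, y}. (if j = x then a else b)) = (\<Prod>j\<in>{x, y}. prob (if j = x then a else b))"
      by (rule indep_setsD[OF ind]) (use assms ab in auto)
    then show "prob (a \<inter> b) = prob a * prob b" using assms(4) by (simp add: Int_commute)
  qed
  then show ?thesis unfolding indep_var_eq using rv by blast
qed

locale filtered_prob_space = prob_space M for M :: "'a measure" +
  fixes F :: "real \<Rightarrow> 'a measure"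
  assumes subalg: "0 \<le> t \<Longrightarrow> subalgebra M (F t)"
    and sets_mono: "0 \<le> s \<Longrightarrow> s \<le> t \<Longrightarrow> sets (F s) \<subseteq> sets (F t)"
begin

lemma measurable_F_mono:
  assumes "f \<in> borel_measurable (F s)" "0 \<le> s" "s \<le> t"
  shows "f \<in> borel_measurable (F t)"
proof -
  have "subalgebra (F t) (F s)"
    using subalg[of s] subalg[of t] sets_mono[of s t] assms by (auto simp: subalgebra_def)
  then show ?thesis using assms(1) measurable_from_subalg by blast
qed

lemma measurable_F_M:
  assumes "f \<in> borel_measurable (F s)" "0 \<le> s"
  shows "f \<in> borel_measurable M"
  using assms subalg measurable_from_subalg by blast

lemma space_F: "0 \<le> s \<Longrightarrow> space (F s) = space M"
  using subalg by (auto simp: subalgebra_def)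

lemma brownian_measurable_F:
  assumes "brownian_motion M F W" "0 \<le> t"
  shows "(\<lambda>\<omega>. W t \<omega> $ a) \<in> borel_measurable (F t)"
  using assms unfolding brownian_motion_def by (intro borel_measurable_vec_nth) blast

lemma brownian_measurable:
  assumes "brownian_motion M F W" "0 \<le> t"
  shows "(\<lambda>\<omega>. W t \<omega> $ a) \<in> borel_measurable M"
  using brownian_measurable_F[OF assms] measurable_F_M assms(2) by blast

lemma brownian_increment_moments:
  assumes "brownian_motion M F W" "0 \<le> s" "s < t"
  shows "integrable M (\<lambda>\<omega>. W t \<omega> $ a - W s \<omega> $ a)"
    and "expectation (\<lambda>\<omega>. W t \<omega> $ a - W s \<omega> $ a) = 0"
    and "integrable M (\<lambda>\<omega>. (W t \<omega> $ a - W s \<omega> $ a)\<^sup>2)"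
    and "expectation (\<lambda>\<omega>. (W t \<omega> $ a - W s \<omega> $ a)\<^sup>2) = t - s"
proof -
  let ?X = "\<lambda>\<omega>. W t \<omega> $ a - W s \<omega> $ a"
  have D: "distributed M lborel ?X (normal_density 0 (sqrt (t - s)))"
    using assms unfolding brownian_motion_def vector_minus_component by blast
  have pos: "0 < sqrt (t - s)" using assms by simp
  have 1: "integrable M (\<lambda>\<omega>. ?X \<omega> ^ k)" for k
  proof -
    have "integrable lborel (\<lambda>x. normal_density 0 (sqrt (t - s)) x * x ^ k)"
      using integrable_normal_moment[OF pos, of 0 k] by (simp only: diff_zero)
    moreover have "integrable lborel (\<lambda>x. normal_density 0 (sqrt (t - s)) x * x ^ k) = integrable M (\<lambda>\<omega>. ?X \<omega> ^ k)"
      by (rule distributed_integrable[OF D]) (simp_all add: normal_density_nonneg)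
    ultimately show ?thesis by (simp only:)
  qed
  show i1: "integrable M ?X" using 1[of 1] by (simp only: power_one_right)
  show i2: "integrable M (\<lambda>\<omega>. (?X \<omega>)\<^sup>2)" by (rule 1)
  show e1: "expectation ?X = 0" by (rule normal_distributed_expectation[OF pos D])
  have "variance ?X = (sqrt (t - s))\<^sup>2" by (rule normal_distributed_variance[OF pos D])
  then show "expectation (\<lambda>\<omega>. (?X \<omega>)\<^sup>2) = t - s"
    unfolding e1 diff_zero using assms(3) by simp
qed

lemma brownian_increment_indep:
  fixes \<eta> :: "'a \<Rightarrow> real"
  assumes bm: "brownian_motion M F W" and st: "0 \<le> s" "s < t"
    and \<eta>: "\<eta> \<in> borel_measurable (F s)" "integrable M \<eta>"
    and G: "G \<in> borel_measurable borel" "integrable M (\<lambda>\<omega>. G (W t \<omega> - W s \<omega>) :: real)"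
  shows "integrable M (\<lambda>\<omega>. \<eta> \<omega> * G (W t \<omega> - W s \<omega>))"
    and "expectation (\<lambda>\<omega>. \<eta> \<omega> * G (W t \<omega> - W s \<omega>)) = expectation \<eta> * expectation (\<lambda>\<omega>. G (W t \<omega> - W s \<omega>))"
proof -
  let ?N = "vimage_algebra (space M) (\<lambda>\<omega>. W t \<omega> - W s \<omega>) borel"
  have m: "W u \<in> borel_measurable M" if "0 \<le> u" for u
  proof (rule measurable_from_subalg[OF subalg[OF that]])
    show "W u \<in> borel_measurable (F u)" using bm that unfolding brownian_motion_def by blast
  qed
  have [measurable]: "W s \<in> borel_measurable M" "W t \<in> borel_measurable M"
    using st by (auto intro!: m)
  have "(\<lambda>\<omega>. W t \<omega> - W s \<omega>) \<in> borel_measurable M" by measurable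
  then have N: "subalgebra M ?N"
    by (auto simp: subalgebra_def sets_vimage_algebra2 measurable_def)
  have ind: "indep_set (sets (F s)) (sets ?N)"
    using bm st unfolding brownian_motion_def by blast
  have meas: "(\<lambda>\<omega>. G (W t \<omega> - W s \<omega>)) \<in> borel_measurable ?N"
    by (rule measurable_compose[OF measurable_vimage_algebra1 G(1)]) auto
  show "integrable M (\<lambda>\<omega>. \<eta> \<omega> * G (W t \<omega> - W s \<omega>))"
    by (rule expectation_mult_indep(1)[OF ind subalg[OF st(1)] N \<eta>(1) meas \<eta>(2) G(2)])
  show "expectation (\<lambda>\<omega>. \<eta> \<omega> * G (W t \<omega> - W s \<omega>)) = expectation \<eta> * expectation (\<lambda>\<omega>. G (W t \<omega> - W s \<omega>))"
    by (rule expectation_mult_indep(2)[OF ind subalg[OF st(1)] N \<eta>(1) meas \<eta>(2) G(2)])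
qed

lemma brownian_increment_centred:
  fixes \<eta> :: "'a \<Rightarrow> real" and W :: "real \<Rightarrow> 'a \<Rightarrow> real ^ 'd"
  assumes bm: "brownian_motion M F W" and st: "0 \<le> s" "s \<le> t"
    and \<eta>: "\<eta> \<in> borel_measurable (F s)" "integrable M \<eta>"
  shows "integrable M (\<lambda>\<omega>. \<eta> \<omega> * (W t \<omega> $ a - W s \<omega> $ a))"
    and "expectation (\<lambda>\<omega>. \<eta> \<omega> * (W t \<omega> $ a - W s \<omega> $ a)) = 0"
proof -
  have "integrable M (\<lambda>\<omega>. \<eta> \<omega> * (W t \<omega> $ a - W s \<omega> $ a)) \<and>
    expectation (\<lambda>\<omega>. \<eta> \<omega> * (W t \<omega> $ a - W s \<omega> $ a)) = 0"
  proof (cases "s = t")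
    case False
    then have "s < t" using st by simp
    have G: "(\<lambda>v :: real ^ 'd. v $ a) \<in> borel_measurable borel"
      by (rule borel_measurable_vec_nth) simp
    have i: "integrable M (\<lambda>\<omega>. (W t \<omega> - W s \<omega>) $ a)" "expectation (\<lambda>\<omega>. (W t \<omega> - W s \<omega>) $ a) = 0"
      unfolding vector_minus_component by (rule brownian_increment_moments[OF bm st(1) \<open>s < t\<close>])+
    have "integrable M (\<lambda>\<omega>. \<eta> \<omega> * (W t \<omega> - W s \<omega>) $ a)"
      by (rule brownian_increment_indep(1)[OF bm st(1) \<open>s < t\<close> \<eta> G i(1)])
    moreover have "expectation (\<lambda>\<omega>. \<eta> \<omega> * (W t \<omega> - W s \<omega>) $ a) = 0"
      using brownian_increment_indep(2)[OF bm st(1) \<open>s < t\<close> \<eta> G i(1)] unfolding i(2) mult_zero_right .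
    ultimately show ?thesis unfolding vector_minus_component by (rule conjI)
  qed simp
  then show "integrable M (\<lambda>\<omega>. \<eta> \<omega> * (W t \<omega> $ a - W s \<omega> $ a))"
    and "expectation (\<lambda>\<omega>. \<eta> \<omega> * (W t \<omega> $ a - W s \<omega> $ a)) = 0" by auto
qed

lemma brownian_increment_square_integrable:
  assumes "brownian_motion M F W" "0 \<le> s" "s \<le> t"
  shows "integrable M (\<lambda>\<omega>. (W t \<omega> $ a - W s \<omega> $ a)\<^sup>2)"
  using brownian_increment_moments(3)[OF assms(1,2), of t a] assms(3) by (cases "s = t") auto

lemma brownian_increment_measurable_F:
  assumes "brownian_motion M F W" "0 \<le> s" "s \<le> t" "t \<le> u"
  shows "(\<lambda>\<omega>. W t \<omega> $ a - W s \<omega> $ a) \<in> borel_measurable (F u)"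
  using assms(2-4)
  by (intro borel_measurable_diff measurable_F_mono[OF brownian_measurable_F[OF assms(1)]]) auto

text \<open>
  The earlier increment times \<open>\<eta>\<close> is known at time \<open>s\<close>, so
  the later increment is centred given it.
\<close>

lemma brownian_disjoint_increments:
  fixes \<eta> :: "'a \<Rightarrow> real"
  assumes W: "brownian_motion M F W" and W': "brownian_motion M F W'"
    and t: "0 \<le> u" "u \<le> v" "v \<le> s" "s \<le> t"
    and \<eta>: "\<eta> \<in> borel_measurable (F s)" "\<And>\<omega>. \<omega> \<in> space M \<Longrightarrow> \<bar>\<eta> \<omega>\<bar> \<le> C"
  shows "integrable M (\<lambda>\<omega>. \<eta> \<omega> * ((W v \<omega> $ a - W u \<omega> $ a) * (W' t \<omega> $ b - W' s \<omega> $ b)))"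
    and "expectation (\<lambda>\<omega>. \<eta> \<omega> * ((W v \<omega> $ a - W u \<omega> $ a) * (W' t \<omega> $ b - W' s \<omega> $ b))) = 0"
proof -
  let ?\<eta> = "\<lambda>\<omega>. \<eta> \<omega> * (W v \<omega> $ a - W u \<omega> $ a)"
  have s: "0 \<le> s" and v: "0 \<le> v" using t by linarith+
  have m: "?\<eta> \<in> borel_measurable (F s)"
    by (rule borel_measurable_times[OF \<eta>(1) brownian_increment_measurable_F[OF W t(1-3)]])
  have d: "integrable M (\<lambda>\<omega>. W v \<omega> $ a - W u \<omega> $ a)"
    by (rule integrable_of_square[OF _ brownian_increment_square_integrable[OF W t(1,2)]])
      (rule borel_measurable_diff[OF brownian_measurable[OF W v] brownian_measurable[OF W t(1)]])
  have i: "integrable M ?\<eta>"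
    by (rule integrable_mult_bounded_left[OF measurable_F_M[OF \<eta>(1) s] \<eta>(2) d])
  show "integrable M (\<lambda>\<omega>. \<eta> \<omega> * ((W v \<omega> $ a - W u \<omega> $ a) * (W' t \<omega> $ b - W' s \<omega> $ b)))"
    and "expectation (\<lambda>\<omega>. \<eta> \<omega> * ((W v \<omega> $ a - W u \<omega> $ a) * (W' t \<omega> $ b - W' s \<omega> $ b))) = 0"
    using brownian_increment_centred[OF W' s t(4) m i, of b] unfolding mult.assoc .
qed

lemma brownian_increment_covariation_strict:
  fixes \<eta> :: "'a \<Rightarrow> real" and W :: "real \<Rightarrow> 'a \<Rightarrow> real ^ 'd"
  assumes bm: "brownian_motion M F W" and st: "0 \<le> s" "s < t"
    and \<eta>: "\<eta> \<in> borel_measurable (F s)" "integrable M \<eta>"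
  shows "expectation (\<lambda>\<omega>. \<eta> \<omega> * ((W t \<omega> $ a - W s \<omega> $ a) * (W t \<omega> $ b - W s \<omega> $ b))) =
    (if a = b then (t - s) * expectation \<eta> else 0)"
proof -
  let ?d = "\<lambda>c \<omega>. W t \<omega> $ c - W s \<omega> $ c"
  have meas: "?d c \<in> borel_measurable M" for c
    using st by (intro borel_measurable_diff brownian_measurable[OF bm]) auto
  have i: "integrable M (\<lambda>\<omega>. ?d a \<omega> * ?d b \<omega>)"
    using st by (intro integrable_mult_of_squares meas brownian_increment_square_integrable[OF bm]) auto
  have E1: "expectation (\<lambda>\<omega>. ?d a \<omega> * ?d b \<omega>) = (if a = b then t - s else 0)"
  proof (cases "a = b")
    case True
    then show ?thesis using brownian_increment_moments(4)[OF bm st, of b] unfolding power2_eq_square by simp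
  next
    case False
    have "indep_vars (\<lambda>_. borel) ?d UNIV"
      using bm st unfolding brownian_motion_def vector_minus_component by blast
    then have "indep_vars (\<lambda>_. borel) ?d {a, b}" by (rule indep_vars_subset) simp
    then have "expectation (\<lambda>\<omega>. \<Prod>c\<in>{a, b}. ?d c \<omega>) = (\<Prod>c\<in>{a, b}. expectation (?d c))"
      by (rule indep_vars_lebesgue_integral[rotated]) (simp_all only: brownian_increment_moments(1)[OF bm st] finite.intros)
    then have "expectation (\<lambda>\<omega>. ?d a \<omega> * ?d b \<omega>) = expectation (?d a) * expectation (?d b)"
      using False by simp
    then show ?thesis unfolding brownian_increment_moments(2)[OF bm st] using False by simp
  qed
  have E2: "expectation (\<lambda>\<omega>. \<eta> \<omega> * (?d a \<omega> * ?d b \<omega>)) = expectation \<eta> * expectation (\<lambda>\<omega>. ?d a \<omega> * ?d b \<omega>)"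
  proof -
    have "(\<lambda>v :: real ^ 'd. v $ a * v $ b) \<in> borel_measurable borel"
      by (intro borel_measurable_times borel_measurable_vec_nth) simp_all
    from brownian_increment_indep(2)[OF bm st \<eta> this, unfolded vector_minus_component, OF i]
    show ?thesis .
  qed
  show ?thesis unfolding E2 E1 by simp
qed

lemma brownian_increment_covariation:
  fixes \<eta> :: "'a \<Rightarrow> real" and W :: "real \<Rightarrow> 'a \<Rightarrow> real ^ 'd"
  assumes bm: "brownian_motion M F W" and st: "0 \<le> s" "s \<le> t"
    and \<eta>: "\<eta> \<in> borel_measurable (F s)" "integrable M \<eta>"
  shows "expectation (\<lambda>\<omega>. \<eta> \<omega> * ((W t \<omega> $ a - W s \<omega> $ a) * (W t \<omega> $ b - W s \<omega> $ b))) =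
    (if a = b then (t - s) * expectation \<eta> else 0)"
proof (cases "s = t")
  case True
  then show ?thesis by simp
next
  case False
  then have "s < t" using st by simp
  then show ?thesis by (rule brownian_increment_covariation_strict[OF bm st(1) _ \<eta>])
qed

lemma brownian_increment_expectation_product:
  assumes bm: "brownian_motion M F W" and p: "incseq p" "0 \<le> p 0" "\<And>k. p (Suc k) - p k = \<delta>"
  shows "expectation (\<lambda>\<omega>. (W (p (Suc j)) \<omega> $ a - W (p j) \<omega> $ a) * (W (p (Suc k)) \<omega> $ a - W (p k) \<omega> $ a)) =
    (if j = k then \<delta> else 0)"
proof -
  let ?d = "\<lambda>k \<omega>. W (p (Suc k)) \<omega> $ a - W (p k) \<omega> $ a"
  have p0: "0 \<le> p k" for k using p(1,2) incseqD[OF p(1), of 0 k] by simp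
  have le: "p k \<le> p (Suc k)" for k using p(1) incseq_SucD by auto
  have *: "expectation (\<lambda>\<omega>. ?d j \<omega> * ?d k \<omega>) = 0" if "j < k" for j k
  proof -
    have "p (Suc j) \<le> p k" using that by (intro incseqD[OF p(1)]) simp
    from brownian_disjoint_increments(2)[OF bm bm p0 le this le, of "\<lambda>_. 1" 1 a a]
    show ?thesis unfolding mult_1 by (rule meta_mp) simp_all
  qed
  show ?thesis
  proof (cases j k rule: linorder_cases)
    case equal
    show ?thesis
    proof (cases "p k < p (Suc k)")
      case True
      then show ?thesis
        using brownian_increment_moments(4)[OF bm p0 True, of a] equal p(3)[of k]
        by (simp add: power2_eq_square)
    next
      case False
      then have "p k = p (Suc k)" using le[of k] by simp
      then show ?thesis using equal p(3)[of k] by simp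
    qed
  next
    case less then show ?thesis using *[OF less] by simp
  next
    case greater then show ?thesis using *[OF greater] by (simp add: mult.commute)
  qed
qed

text \<open>
  Each motion has increments independent of \<open>F s\<close>, but this says nothing about
  the pair of increments: the sign of their product could be known at time \<open>s\<close>.
  What excludes such anticipation is that both are Brownian motions for the filtration at
  all times. Cut \<open>[s, t]\<close> into \<open>n\<close> equal steps. Products of
  increments over different steps are uncorrelated with \<open>\<eta>\<close>, so only the
  diagonal sum \<open>\<Sum>\<^sub>k d\<^sub>k d'\<^sub>k\<close> remains; by independence
  of the two processes its second moment is \<open>(t - s)\<^sup>2 / n\<close>, which tends
  to \<open>0\<close>.
\<close>

lemma independent_brownian_covariation:
  fixes \<eta> :: "'a \<Rightarrow> real" and W W' :: "real \<Rightarrow> 'a \<Rightarrow> real ^ 'd"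
  assumes W: "brownian_motion M F W" and W': "brownian_motion M F W'"
    and ind: "indep_var (PiM {0..} (\<lambda>_. borel)) (\<lambda>\<omega>. restrict (\<lambda>t. W t \<omega>) {0..})
        (PiM {0..} (\<lambda>_. borel)) (\<lambda>\<omega>. restrict (\<lambda>t. W' t \<omega>) {0..})"
    and st: "0 \<le> s" "s \<le> t"
    and \<eta>: "\<eta> \<in> borel_measurable (F s)" "\<And>\<omega>. \<omega> \<in> space M \<Longrightarrow> \<bar>\<eta> \<omega>\<bar> \<le> C"
  shows "expectation (\<lambda>\<omega>. \<eta> \<omega> * ((W t \<omega> $ a - W s \<omega> $ a) * (W' t \<omega> $ b - W' s \<omega> $ b))) = 0"
    (is "?E = 0")
proof -
  have bound: "?E\<^sup>2 \<le> (C\<^sup>2 * (t - s)\<^sup>2) * (1 / real (Suc n))" for n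
  proof -
    define N where "N = Suc n"
    have N: "0 < real N" by (simp add: N_def)
    define \<delta> where "\<delta> = (t - s) / N"
    define p where "p k = s + real k * \<delta>" for k
    have \<delta>: "0 \<le> \<delta>" using st by (simp add: \<delta>_def)
    have p: "incseq p" "0 \<le> p 0" "\<And>k. p (Suc k) - p k = \<delta>"
      using \<delta> st by (auto simp: p_def incseq_def algebra_simps intro!: mult_left_mono)
    have p_s: "s \<le> p k" for k using \<delta> by (simp add: p_def)
    have p0: "0 \<le> p k" for k using p_s[of k] st by simp
    have le: "p k \<le> p (Suc k)" for k using p(1) incseq_SucD by auto
    have pN: "p N = t" "p 0 = s" using N by (simp_all add: p_def \<delta>_def)
    define d where "d k \<omega> = W (p (Suc k)) \<omega> $ a - W (p k) \<omega> $ a" for k \<omega>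
    define d' where "d' k \<omega> = W' (p (Suc k)) \<omega> $ b - W' (p k) \<omega> $ b" for k \<omega>
    have d_meas [measurable]: "d k \<in> borel_measurable M" "d' k \<in> borel_measurable M" for k
      unfolding d_def d'_def using brownian_measurable[OF W p0] brownian_measurable[OF W' p0] by simp_all
    have d_sq: "integrable M (\<lambda>\<omega>. (d k \<omega>)\<^sup>2)" "integrable M (\<lambda>\<omega>. (d' k \<omega>)\<^sup>2)" for k
      unfolding d_def d'_def
      by (rule brownian_increment_square_integrable[OF W p0 le] brownian_increment_square_integrable[OF W' p0 le])+
    have dd: "integrable M (\<lambda>\<omega>. d j \<omega> * d k \<omega>)" "integrable M (\<lambda>\<omega>. d' j \<omega> * d' k \<omega>)"
      "integrable M (\<lambda>\<omega>. d j \<omega> * d' k \<omega>)" for j k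
      by (intro integrable_mult_of_squares d_sq d_meas)+
    have \<eta>_meas [measurable]: "\<eta> \<in> borel_measurable M" using \<eta>(1) st measurable_F_M by blast
    have \<eta>_p: "\<eta> \<in> borel_measurable (F (p k))" for k using measurable_F_mono[OF \<eta>(1) st(1) p_s] .
    have \<eta>dd: "integrable M (\<lambda>\<omega>. \<eta> \<omega> * (d j \<omega> * d' k \<omega>))" for j k
      by (rule integrable_mult_bounded_left[OF \<eta>_meas \<eta>(2) dd(3)])
    have cross: "expectation (\<lambda>\<omega>. \<eta> \<omega> * (d j \<omega> * d' k \<omega>)) = 0" if "j \<noteq> k" for j k
    proof (cases "j < k")
      case True
      then have "p (Suc j) \<le> p k" using incseqD[OF p(1)] by simp
      then show ?thesis unfolding d_def d'_def
        using brownian_disjoint_increments(2)[OF W W' p0 le _ le \<eta>_p \<eta>(2), of j k a b] by simp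
    next
      case False
      then have "p (Suc k) \<le> p j" using incseqD[OF p(1)] that by simp
      then show ?thesis unfolding d_def d'_def
        using brownian_disjoint_increments(2)[OF W' W p0 le _ le \<eta>_p \<eta>(2), of k j b a]
        by (simp add: mult.commute)
    qed
    define Q where "Q \<omega> = (\<Sum>k<N. d k \<omega> * d' k \<omega>)" for \<omega>
    have Q_meas [measurable]: "Q \<in> borel_measurable M" unfolding Q_def by measurable
    have prod_indep: "integrable M (\<lambda>\<omega>. (d j \<omega> * d k \<omega>) * (d' j \<omega> * d' k \<omega>)) \<and>
        expectation (\<lambda>\<omega>. (d j \<omega> * d k \<omega>) * (d' j \<omega> * d' k \<omega>)) =
        expectation (\<lambda>\<omega>. d j \<omega> * d k \<omega>) * expectation (\<lambda>\<omega>. d' j \<omega> * d' k \<omega>)" for j k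
    proof -
      define G :: "'d \<Rightarrow> (real \<Rightarrow> real ^ 'd) \<Rightarrow> real" where
        "G c w = (w (p (Suc j)) $ c - w (p j) $ c) * (w (p (Suc k)) $ c - w (p k) $ c)" for c w
      have "(\<lambda>w. w (p i) $ c) \<in> borel_measurable (PiM {0..} (\<lambda>_. borel :: (real ^ 'd) measure))" for i c
        using measurable_component_singleton[of "p i" "{0..}" "\<lambda>_. borel :: (real ^ 'd) measure"] p0[of i]
        by (intro borel_measurable_vec_nth) auto
      then have G: "G c \<in> borel_measurable (PiM {0..} (\<lambda>_. borel))" for c
        unfolding G_def by simp
      have "indep_var borel (G a \<circ> (\<lambda>\<omega>. restrict (\<lambda>t. W t \<omega>) {0..})) borel (G b \<circ> (\<lambda>\<omega>. restrict (\<lambda>t. W' t \<omega>) {0..}))"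
        by (rule indep_var_compose[OF ind G G])
      moreover have "G a \<circ> (\<lambda>\<omega>. restrict (\<lambda>t. W t \<omega>) {0..}) = (\<lambda>\<omega>. d j \<omega> * d k \<omega>)"
        "G b \<circ> (\<lambda>\<omega>. restrict (\<lambda>t. W' t \<omega>) {0..}) = (\<lambda>\<omega>. d' j \<omega> * d' k \<omega>)"
        using p0 by (auto simp: G_def d_def d'_def fun_eq_iff)
      ultimately have "indep_var borel (\<lambda>\<omega>. d j \<omega> * d k \<omega>) borel (\<lambda>\<omega>. d' j \<omega> * d' k \<omega>)" by simp
      from indep_var_integrable[OF this dd(1,2)] indep_var_lebesgue_integral[OF this dd(1,2)]
      show ?thesis by (rule conjI)
    qed
    have Q2: "(Q \<omega>)\<^sup>2 = (\<Sum>j<N. \<Sum>k<N. (d j \<omega> * d k \<omega>) * (d' j \<omega> * d' k \<omega>))" for \<omega>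
    proof -
      have "(Q \<omega>)\<^sup>2 = (\<Sum>j<N. \<Sum>k<N. (d j \<omega> * d' j \<omega>) * (d k \<omega> * d' k \<omega>))"
        unfolding Q_def power2_eq_square by (rule sum_product)
      then show ?thesis by (simp only: ac_simps)
    qed
    have Q_sq: "integrable M (\<lambda>\<omega>. (Q \<omega>)\<^sup>2)"
      unfolding Q2 using prod_indep by (intro Bochner_Integration.integrable_sum) (rule conjunct1)
    have "expectation (\<lambda>\<omega>. (Q \<omega>)\<^sup>2) = (\<Sum>j<N. \<Sum>k<N. (if j = k then \<delta> else 0) * (if j = k then \<delta> else 0))"
    proof -
      have "expectation (\<lambda>\<omega>. (Q \<omega>)\<^sup>2) =
          (\<Sum>j<N. \<Sum>k<N. expectation (\<lambda>\<omega>. (d j \<omega> * d k \<omega>) * (d' j \<omega> * d' k \<omega>)))"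
        unfolding Q2
        by (rule integral_double_sum) (rule conjunct1[OF prod_indep])
      also have "\<dots> = (\<Sum>j<N. \<Sum>k<N. (if j = k then \<delta> else 0) * (if j = k then \<delta> else 0))"
        unfolding conjunct2[OF prod_indep]
        unfolding d_def d'_def brownian_increment_expectation_product[OF W p]
          brownian_increment_expectation_product[OF W' p] ..
      finally show ?thesis .
    qed
    also have "\<dots> = real N * \<delta>\<^sup>2"
    proof -
      have "(\<Sum>k<N. (if j = k then \<delta> else 0) * (if j = k then \<delta> else 0)) = \<delta>\<^sup>2" if "j < N" for j
      proof -
        have "(\<Sum>k<N. (if j = k then \<delta> else 0) * (if j = k then \<delta> else 0)) = (\<Sum>k<N. if j = k then \<delta>\<^sup>2 else 0)"
          by (intro sum.cong refl) (simp add: power2_eq_square)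
        then show ?thesis using that by simp
      qed
      then show ?thesis by simp
    qed
    also have "\<dots> = (t - s)\<^sup>2 / real N"
      using N by (simp add: \<delta>_def power2_eq_square)
    finally have EQ: "expectation (\<lambda>\<omega>. (Q \<omega>)\<^sup>2) = (t - s)\<^sup>2 / real N" .
    have inc: "W t \<omega> $ a - W s \<omega> $ a = (\<Sum>k<N. d k \<omega>)" "W' t \<omega> $ b - W' s \<omega> $ b = (\<Sum>k<N. d' k \<omega>)" for \<omega>
      unfolding d_def d'_def
      using sum_lessThan_telescope[of "\<lambda>k. W (p k) \<omega> $ a" N] sum_lessThan_telescope[of "\<lambda>k. W' (p k) \<omega> $ b" N]
      by (simp_all add: pN)
    have "?E = expectation (\<lambda>\<omega>. \<Sum>j<N. \<Sum>k<N. \<eta> \<omega> * (d j \<omega> * d' k \<omega>))"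
      unfolding inc sum_product by (simp only: sum_distrib_left)
    also have "\<dots> = (\<Sum>j<N. \<Sum>k<N. expectation (\<lambda>\<omega>. \<eta> \<omega> * (d j \<omega> * d' k \<omega>)))"
      by (rule integral_double_sum) (rule \<eta>dd)
    also have "\<dots> = (\<Sum>j<N. \<Sum>k<N. if j = k then expectation (\<lambda>\<omega>. \<eta> \<omega> * (d j \<omega> * d' j \<omega>)) else 0)"
      by (intro sum.cong refl) (auto simp: cross)
    also have "\<dots> = (\<Sum>j<N. expectation (\<lambda>\<omega>. \<eta> \<omega> * (d j \<omega> * d' j \<omega>)))" by simp
    also have "\<dots> = expectation (\<lambda>\<omega>. \<eta> \<omega> * Q \<omega>)"
      unfolding Q_def sum_distrib_left
      by (intro Bochner_Integration.integral_sum[symmetric] \<eta>dd)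
    finally have E: "?E = expectation (\<lambda>\<omega>. \<eta> \<omega> * Q \<omega>)" .
    have \<eta>_sq: "(\<eta> \<omega>)\<^sup>2 \<le> C\<^sup>2" if "\<omega> \<in> space M" for \<omega>
      using \<eta>(2)[OF that] by (metis abs_ge_zero power2_abs power_mono)
    have \<eta>_sq_int: "integrable M (\<lambda>\<omega>. (\<eta> \<omega>)\<^sup>2)"
      by (rule integrable_const_bound[where B = "C\<^sup>2"]) (auto intro: \<eta>_sq)
    have \<eta>_le: "expectation (\<lambda>\<omega>. (\<eta> \<omega>)\<^sup>2) \<le> C\<^sup>2"
      by (rule integral_le_const[OF \<eta>_sq_int]) (auto intro: \<eta>_sq)
    have "?E\<^sup>2 \<le> expectation (\<lambda>\<omega>. (\<eta> \<omega>)\<^sup>2) * expectation (\<lambda>\<omega>. (Q \<omega>)\<^sup>2)"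
      unfolding E by (rule Cauchy_Schwarz_integral[OF \<eta>_meas Q_meas \<eta>_sq_int Q_sq])
    also have "\<dots> \<le> C\<^sup>2 * ((t - s)\<^sup>2 / real N)"
      unfolding EQ using N by (intro mult_right_mono \<eta>_le) simp
    also have "\<dots> = (C\<^sup>2 * (t - s)\<^sup>2) * (1 / real (Suc n))" by (simp add: N_def)
    finally show ?thesis .
  qed
  have "(\<lambda>n. (C\<^sup>2 * (t - s)\<^sup>2) * (1 / real (Suc n))) \<longlonglongrightarrow> (C\<^sup>2 * (t - s)\<^sup>2) * 0"
    by (rule tendsto_mult_left[OF lim_1_over_n[THEN LIMSEQ_Suc]])
  then have "?E\<^sup>2 \<le> (C\<^sup>2 * (t - s)\<^sup>2) * 0"
    by (rule LIMSEQ_le_const) (use bound in blast)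
  then have "?E\<^sup>2 \<le> 0" by (simp only: mult_zero_right)
  then show ?thesis by (simp only: power2_less_eq_zero_iff)
qed

end

section \<open>Elementary integrals\<close>

text \<open>
  Lebesgue measure on \<open>[0, T]\<close>, as a finite measure on the whole line: its
  measurable sets do not depend on \<open>T\<close>.
\<close>

abbreviation time_measure :: "real \<Rightarrow> real measure" where
  "time_measure T \<equiv> density lborel (indicator {0..T})"

lemma finite_time_measure: "finite_measure (time_measure T)"
  by (rule finite_measureI) (auto simp: emeasure_density emeasure_lborel_Icc_eq)

text \<open>
  The properties of scalar Brownian motions that the stochastic integral uses. They are
  stated for correlations with random variables known at the left end point, so that the
  family may consist of all coordinates of several vector-valued motions.
\<close>

locale orthogonal_increments = filtered_prob_space M F
  for M :: "'a measure" and F :: "real \<Rightarrow> 'a measure" +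
  fixes K :: "'k set" and W :: "'k \<Rightarrow> real \<Rightarrow> 'a \<Rightarrow> real"
  assumes finite_K: "finite K"
    and W_F: "\<And>\<kappa> t. \<kappa> \<in> K \<Longrightarrow> 0 \<le> t \<Longrightarrow> W \<kappa> t \<in> borel_measurable (F t)"
    and W_square: "\<And>\<kappa> s t. \<kappa> \<in> K \<Longrightarrow> 0 \<le> s \<Longrightarrow> s \<le> t \<Longrightarrow> integrable M (\<lambda>\<omega>. (W \<kappa> t \<omega> - W \<kappa> s \<omega>)\<^sup>2)"
    and centred: "\<And>\<kappa> s t \<eta> C. \<kappa> \<in> K \<Longrightarrow> 0 \<le> s \<Longrightarrow> s \<le> t \<Longrightarrow> \<eta> \<in> borel_measurable (F s) \<Longrightarrow>
      (\<And>\<omega>. \<omega> \<in> space M \<Longrightarrow> \<bar>\<eta> \<omega>\<bar> \<le> C) \<Longrightarrow> expectation (\<lambda>\<omega>. \<eta> \<omega> * (W \<kappa> t \<omega> - W \<kappa> s \<omega>)) = 0"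
    and disjoint: "\<And>\<kappa> \<kappa>' u v s t \<eta> C. \<kappa> \<in> K \<Longrightarrow> \<kappa>' \<in> K \<Longrightarrow> 0 \<le> u \<Longrightarrow> u \<le> v \<Longrightarrow> v \<le> s \<Longrightarrow> s \<le> t \<Longrightarrow>
      \<eta> \<in> borel_measurable (F s) \<Longrightarrow> (\<And>\<omega>. \<omega> \<in> space M \<Longrightarrow> \<bar>\<eta> \<omega>\<bar> \<le> C) \<Longrightarrow>
      expectation (\<lambda>\<omega>. \<eta> \<omega> * ((W \<kappa> v \<omega> - W \<kappa> u \<omega>) * (W \<kappa>' t \<omega> - W \<kappa>' s \<omega>))) = 0"
    and covariation: "\<And>\<kappa> \<kappa>' s t \<eta> C. \<kappa> \<in> K \<Longrightarrow> \<kappa>' \<in> K \<Longrightarrow> 0 \<le> s \<Longrightarrow> s \<le> t \<Longrightarrow>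
      \<eta> \<in> borel_measurable (F s) \<Longrightarrow> (\<And>\<omega>. \<omega> \<in> space M \<Longrightarrow> \<bar>\<eta> \<omega>\<bar> \<le> C) \<Longrightarrow>
      expectation (\<lambda>\<omega>. \<eta> \<omega> * ((W \<kappa> t \<omega> - W \<kappa> s \<omega>) * (W \<kappa>' t \<omega> - W \<kappa>' s \<omega>))) =
      (if \<kappa> = \<kappa>' then (t - s) * expectation \<eta> else 0)"
begin

lemma W_measurable: "\<kappa> \<in> K \<Longrightarrow> 0 \<le> t \<Longrightarrow> W \<kappa> t \<in> borel_measurable M"
  using W_F measurable_F_M by blast

lemma increment_product_integrable:
  assumes "\<kappa> \<in> K" "\<kappa>' \<in> K" "0 \<le> p" "p \<le> q" "0 \<le> p'" "p' \<le> q'"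
    and "\<eta> \<in> borel_measurable M" "\<And>\<omega>. \<omega> \<in> space M \<Longrightarrow> \<bar>\<eta> \<omega>\<bar> \<le> C"
  shows "integrable M (\<lambda>\<omega>. \<eta> \<omega> * ((W \<kappa> q \<omega> - W \<kappa> p \<omega>) * (W \<kappa>' q' \<omega> - W \<kappa>' p' \<omega>)))"
proof (rule integrable_mult_bounded_left[OF assms(7,8)])
  show "integrable M (\<lambda>\<omega>. (W \<kappa> q \<omega> - W \<kappa> p \<omega>) * (W \<kappa>' q' \<omega> - W \<kappa>' p' \<omega>))"
    using assms(1-6) W_measurable
    by (intro integrable_mult_of_squares W_square borel_measurable_diff) auto
qed

text \<open>
  Cut both intervals at \<open>p'\<close> and at \<open>min q q'\<close>. Only the common
  piece contributes; every other pair of pieces is disjoint and hence uncorrelated.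
\<close>

lemma increment_covariance_ordered:
  assumes K: "\<kappa> \<in> K" "\<kappa>' \<in> K" and p: "0 \<le> p" "p \<le> q" "p \<le> p'" "p' \<le> q'"
    and \<eta>: "\<eta> \<in> borel_measurable (F p')" "\<And>\<omega>. \<omega> \<in> space M \<Longrightarrow> \<bar>\<eta> \<omega>\<bar> \<le> C"
  shows "expectation (\<lambda>\<omega>. \<eta> \<omega> * ((W \<kappa> q \<omega> - W \<kappa> p \<omega>) * (W \<kappa>' q' \<omega> - W \<kappa>' p' \<omega>))) =
    (if \<kappa> = \<kappa>' then max 0 (min q q' - p') * expectation \<eta> else 0)"
proof (cases "q \<le> p'")
  case True
  then have "max 0 (min q q' - p') = 0" by simp
  then show ?thesis using disjoint[OF K p(1,2) True p(4) \<eta>] by simp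
next
  case False
  define m where "m = min q q'"
  have m: "p' \<le> m" "m \<le> q" "m \<le> q'" "m = q \<or> m = q'" using False p by (auto simp: m_def min_def)
  have p': "0 \<le> p'" using p by simp
  have \<eta>M: "\<eta> \<in> borel_measurable M" using measurable_F_M[OF \<eta>(1) p'] .
  have \<eta>m: "\<eta> \<in> borel_measurable (F m)" using measurable_F_mono[OF \<eta>(1) p' m(1)] .
  let ?X = "\<lambda>a b c d \<omega>. \<eta> \<omega> * ((W \<kappa> b \<omega> - W \<kappa> a \<omega>) * (W \<kappa>' d \<omega> - W \<kappa>' c \<omega>))"
  have i: "integrable M (?X a b c d)" if "0 \<le> a" "a \<le> b" "0 \<le> c" "c \<le> d" for a b c d
    by (rule increment_product_integrable[OF K that \<eta>M \<eta>(2)])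
  have eq: "?X p q p' q' = (\<lambda>\<omega>. ?X p p' p' q' \<omega> + ?X p' m p' m \<omega> + ?X p' m m q' \<omega>
      + ?X m q p' m \<omega> + ?X m q m q' \<omega>)"
    by (rule ext) (simp add: algebra_simps)
  have 1: "expectation (?X p p' p' q') = 0" by (rule disjoint[OF K p(1,3) order_refl p(4) \<eta>])
  have 2: "expectation (?X p' m m q') = 0" by (rule disjoint[OF K p' m(1) order_refl m(3) \<eta>m \<eta>(2)])
  have 3: "expectation (?X m q p' m) = 0"
    using disjoint[OF K(2,1) p' m(1) order_refl m(2) \<eta>m \<eta>(2)] by (simp add: mult.commute)
  have 4: "expectation (?X m q m q') = 0" using m(4) by auto
  have 5: "expectation (?X p' m p' m) = (if \<kappa> = \<kappa>' then (m - p') * expectation \<eta> else 0)"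
    by (rule covariation[OF K p' m(1) \<eta>])
  have "expectation (?X p q p' q') = expectation (?X p' m p' m)"
    unfolding eq using i p p' m
    by (simp add: Bochner_Integration.integral_add Bochner_Integration.integrable_add 1 2 3 4)
  moreover have "max 0 (m - p') = m - p'" using m(1) by simp
  ultimately show ?thesis unfolding m_def[symmetric] 5 by simp
qed

lemma increment_covariance:
  assumes K: "\<kappa> \<in> K" "\<kappa>' \<in> K" and p: "0 \<le> p" "p \<le> q" "0 \<le> p'" "p' \<le> q'"
    and \<xi>: "\<xi> \<in> borel_measurable (F p)" "\<And>\<omega>. \<omega> \<in> space M \<Longrightarrow> \<bar>\<xi> \<omega>\<bar> \<le> C"
    and \<xi>': "\<xi>' \<in> borel_measurable (F p')" "\<And>\<omega>. \<omega> \<in> space M \<Longrightarrow> \<bar>\<xi>' \<omega>\<bar> \<le> C'"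
  shows "expectation (\<lambda>\<omega>. (\<xi> \<omega> * (W \<kappa> q \<omega> - W \<kappa> p \<omega>)) * (\<xi>' \<omega> * (W \<kappa>' q' \<omega> - W \<kappa>' p' \<omega>))) =
    (if \<kappa> = \<kappa>' then max 0 (min q q' - max p p') * expectation (\<lambda>\<omega>. \<xi> \<omega> * \<xi>' \<omega>) else 0)"
proof -
  have b: "\<bar>\<xi> \<omega> * \<xi>' \<omega>\<bar> \<le> C * C'" if "\<omega> \<in> space M" for \<omega>
    unfolding abs_mult using \<xi>(2)[OF that] \<xi>'(2)[OF that] by (intro mult_mono) auto
  show ?thesis
  proof (cases "p \<le> p'")
    case True
    have "(\<lambda>\<omega>. \<xi> \<omega> * \<xi>' \<omega>) \<in> borel_measurable (F p')"
      using measurable_F_mono[OF \<xi>(1) p(1) True] \<xi>'(1) by simp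
    from increment_covariance_ordered[OF K p(1,2) True p(4) this b] True show ?thesis
      by (simp add: ac_simps max_def)
  next
    case False
    then have "p' \<le> p" by simp
    have "(\<lambda>\<omega>. \<xi> \<omega> * \<xi>' \<omega>) \<in> borel_measurable (F p)"
      using measurable_F_mono[OF \<xi>'(1) p(3) \<open>p' \<le> p\<close>] \<xi>(1) by simp
    from increment_covariance_ordered[OF K(2,1) p(3,4) \<open>p' \<le> p\<close> p(2) this b] False show ?thesis
      by (cases "\<kappa> = \<kappa>'") (auto simp: ac_simps max_def)
  qed
qed

text \<open>
  Step integrands together with their integrals, as the linear span of single steps. Keeping
  the integrand and the integral in one relation makes the integral additive without a
  common refinement of two partitions.
\<close>

inductive elementary :: "('k \<Rightarrow> real \<Rightarrow> 'a \<Rightarrow> real) \<Rightarrow> (real \<Rightarrow> 'a \<Rightarrow> real) \<Rightarrow> bool" where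
  zero: "elementary (\<lambda>_ _ _. 0) (\<lambda>_ _. 0)"
| single: "\<kappa> \<in> K \<Longrightarrow> 0 \<le> p \<Longrightarrow> p \<le> q \<Longrightarrow> \<xi> \<in> borel_measurable (F p) \<Longrightarrow>
    (\<And>\<omega>. \<omega> \<in> space M \<Longrightarrow> \<bar>\<xi> \<omega>\<bar> \<le> C) \<Longrightarrow>
    elementary (\<lambda>\<kappa>' s \<omega>. if \<kappa>' = \<kappa> then indicator {p<..q} s * \<xi> \<omega> else 0)
      (\<lambda>t \<omega>. \<xi> \<omega> * (W \<kappa> (min t q) \<omega> - W \<kappa> (min t p) \<omega>))"
| add: "elementary S J \<Longrightarrow> elementary S' J' \<Longrightarrow>
    elementary (\<lambda>\<kappa> s \<omega>. S \<kappa> s \<omega> + S' \<kappa> s \<omega>) (\<lambda>t \<omega>. J t \<omega> + J' t \<omega>)"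

lemma elementary_sum:
  assumes "finite A" "\<And>x. x \<in> A \<Longrightarrow> elementary (S x) (J x)"
  shows "elementary (\<lambda>\<kappa> s \<omega>. \<Sum>x\<in>A. S x \<kappa> s \<omega>) (\<lambda>t \<omega>. \<Sum>x\<in>A. J x t \<omega>)"
  using assms
proof (induction A rule: finite_induct)
  case (insert x A)
  then show ?case using elementary.add[of "S x" "J x"] by simp
qed (simp add: elementary.zero)

lemma elementary_uminus:
  assumes "elementary S J"
  shows "elementary (\<lambda>\<kappa> s \<omega>. - S \<kappa> s \<omega>) (\<lambda>t \<omega>. - J t \<omega>)"
  using assms
proof (induction)
  case zero
  then show ?case using elementary.zero by simp
next
  case (single \<kappa> p q \<xi> C)
  have "elementary (\<lambda>\<kappa>' s \<omega>. if \<kappa>' = \<kappa> then indicator {p<..q} s * (- \<xi> \<omega>) else 0)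
      (\<lambda>t \<omega>. (- \<xi> \<omega>) * (W \<kappa> (min t q) \<omega> - W \<kappa> (min t p) \<omega>))"
    using single by (intro elementary.single[where C = C]) auto
  moreover have "(\<lambda>\<kappa>' s \<omega>. if \<kappa>' = \<kappa> then indicator {p<..q} s * (- \<xi> \<omega>) else 0) =
    (\<lambda>\<kappa>' s \<omega>. - (if \<kappa>' = \<kappa> then indicator {p<..q} s * \<xi> \<omega> else 0))"
    by (intro ext) simp
  ultimately show ?case by simp
next
  case (add S J S' J')
  from elementary.add[OF add.IH] show ?case by (simp add: add.commute)
qed

abbreviation Q :: "real \<Rightarrow> ('a \<times> real) measure" where
  "Q T \<equiv> M \<Otimes>\<^sub>M time_measure T"

lemma borel_measurable_Q [simp]: "borel_measurable (Q T) = borel_measurable (M \<Otimes>\<^sub>M borel)"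
  by (intro measurable_cong_sets sets_pair_measure_cong) auto

lemma finite_Q: "finite_measure (Q T)"
  by (rule finite_measure_pair_measure) (auto intro: finite_time_measure finite_measure_axioms)

lemma space_Q: "space (Q T) = space M \<times> UNIV"
  by (simp add: space_pair_measure)

lemma integrable_Q_bounded:
  assumes "f \<in> borel_measurable (M \<Otimes>\<^sub>M borel)" "\<And>\<omega> s. \<omega> \<in> space M \<Longrightarrow> \<bar>f (\<omega>, s)\<bar> \<le> (C :: real)"
  shows "integrable (Q T) f"
  using assms by (intro finite_measure.integrable_const_bound[OF finite_Q, where B = C]) (auto simp: space_Q)

lemma elementary_measurable:
  "elementary S J \<Longrightarrow> (\<lambda>(\<omega>, s). S \<kappa> s \<omega>) \<in> borel_measurable (M \<Otimes>\<^sub>M borel)"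
proof (induction rule: elementary.induct)
  case (single \<kappa>' p q \<xi> C)
  have [measurable]: "\<xi> \<in> borel_measurable M" using measurable_F_M single by blast
  show ?case by (cases "\<kappa> = \<kappa>'") (simp_all add: case_prod_beta)
qed (auto simp: case_prod_beta)

lemma elementary_bounded:
  "elementary S J \<Longrightarrow> \<exists>C. \<forall>\<kappa> s. \<forall>\<omega>\<in>space M. \<bar>S \<kappa> s \<omega>\<bar> \<le> C"
proof (induction rule: elementary.induct)
  case (single \<kappa>' p q \<xi> C)
  have "\<forall>\<kappa> s. \<forall>\<omega>\<in>space M. \<bar>if \<kappa> = \<kappa>' then indicator {p<..q} s * \<xi> \<omega> else 0\<bar> \<le> \<bar>C\<bar>"
    using single(5) by (auto simp: abs_mult indicator_def intro: order_trans abs_ge_self)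
  then show ?case by blast
next
  case (add S J S' J')
  then obtain C C' where C: "\<forall>\<kappa> s. \<forall>\<omega>\<in>space M. \<bar>S \<kappa> s \<omega>\<bar> \<le> C" "\<forall>\<kappa> s. \<forall>\<omega>\<in>space M. \<bar>S' \<kappa> s \<omega>\<bar> \<le> C'"
    by blast
  have "\<forall>\<kappa> s. \<forall>\<omega>\<in>space M. \<bar>S \<kappa> s \<omega> + S' \<kappa> s \<omega>\<bar> \<le> C + C'"
    using C by (meson abs_triangle_ineq add_mono order_trans)
  then show ?case by blast
qed auto

lemma elementary_product_integrable:
  assumes "elementary S J" "elementary S' J'"
  shows "integrable (Q T) (\<lambda>(\<omega>, s). S \<kappa> s \<omega> * S' \<kappa> s \<omega>)"
proof -
  obtain C where C: "\<And>\<kappa> s \<omega>. \<omega> \<in> space M \<Longrightarrow> \<bar>S \<kappa> s \<omega>\<bar> \<le> C"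
    using elementary_bounded[OF assms(1)] by blast
  obtain C' where C': "\<And>\<kappa> s \<omega>. \<omega> \<in> space M \<Longrightarrow> \<bar>S' \<kappa> s \<omega>\<bar> \<le> C'"
    using elementary_bounded[OF assms(2)] by blast
  show ?thesis
  proof (rule integrable_Q_bounded[where C = "C * C'"])
    show "(\<lambda>(\<omega>, s). S \<kappa> s \<omega> * S' \<kappa> s \<omega>) \<in> borel_measurable (M \<Otimes>\<^sub>M borel)"
      using borel_measurable_times[OF elementary_measurable[OF assms(1), of \<kappa>] elementary_measurable[OF assms(2), of \<kappa>]]
      by (simp only: case_prod_unfold)
    fix \<omega> s assume \<omega>: "\<omega> \<in> space M"
    have "\<bar>S \<kappa> s \<omega>\<bar> * \<bar>S' \<kappa> s \<omega>\<bar> \<le> C * C'"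
      by (intro mult_mono C C' \<omega> abs_ge_zero order_trans[OF abs_ge_zero C[OF \<omega>]])
    then show "\<bar>case (\<omega>, s) of (\<omega>, s) \<Rightarrow> S \<kappa> s \<omega> * S' \<kappa> s \<omega>\<bar> \<le> C * C'" by (simp add: abs_mult)
  qed
qed

lemma elementary_square_integrable:
  assumes "elementary S J"
  shows "integrable (Q T) (\<lambda>(\<omega>, s). (S \<kappa> s \<omega>)\<^sup>2)"
  using elementary_product_integrable[OF assms assms] by (simp add: power2_eq_square)

lemma elementary_integral_L2:
  assumes "elementary S J" "0 \<le> t"
  shows "J t \<in> borel_measurable M \<and> integrable M (\<lambda>\<omega>. (J t \<omega>)\<^sup>2)"
  using assms
proof (induction rule: elementary.induct)
  case (single \<kappa> p q \<xi> C)
  have [measurable]: "\<xi> \<in> borel_measurable M" using measurable_F_M single by blast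
  have [measurable]: "W \<kappa> (min t q) \<in> borel_measurable M" "W \<kappa> (min t p) \<in> borel_measurable M"
    using single by (auto intro: W_measurable)
  have b: "\<bar>(\<xi> \<omega>)\<^sup>2\<bar> \<le> C\<^sup>2" if "\<omega> \<in> space M" for \<omega>
    using single(5)[OF that] by (metis abs_ge_zero abs_power2 power2_abs power_mono)
  have "integrable M (\<lambda>\<omega>. (\<xi> \<omega>)\<^sup>2 * (W \<kappa> (min t q) \<omega> - W \<kappa> (min t p) \<omega>)\<^sup>2)"
    using single b by (intro integrable_mult_bounded_left[where C = "C\<^sup>2"] W_square) auto
  then show ?case by (simp add: power_mult_distrib)
next
  case (add S J S' J')
  then show ?case using integrable_square_add(1)[of "J t" M "J' t"] by auto
qed auto

lemma elementary_isometry_single: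
  assumes K: "\<kappa> \<in> K" "\<kappa>' \<in> K" and p: "0 \<le> p" "p \<le> q" "0 \<le> p'" "p' \<le> q'"
    and \<xi>: "\<xi> \<in> borel_measurable (F p)" "\<And>\<omega>. \<omega> \<in> space M \<Longrightarrow> \<bar>\<xi> \<omega>\<bar> \<le> C"
    and \<xi>': "\<xi>' \<in> borel_measurable (F p')" "\<And>\<omega>. \<omega> \<in> space M \<Longrightarrow> \<bar>\<xi>' \<omega>\<bar> \<le> C'"
    and T: "0 \<le> T"
  shows "expectation (\<lambda>\<omega>. (\<xi> \<omega> * (W \<kappa> (min T q) \<omega> - W \<kappa> (min T p) \<omega>)) *
      (\<xi>' \<omega> * (W \<kappa>' (min T q') \<omega> - W \<kappa>' (min T p') \<omega>))) =
    (\<Sum>\<kappa>''\<in>K. \<integral>(\<omega>, s). (if \<kappa>'' = \<kappa> then indicator {p<..q} s * \<xi> \<omega> else 0) *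
      (if \<kappa>'' = \<kappa>' then indicator {p'<..q'} s * \<xi>' \<omega> else 0) \<partial>Q T)"
proof -
  have [measurable]: "\<xi> \<in> borel_measurable M" "\<xi>' \<in> borel_measurable M"
    using measurable_F_M \<xi> \<xi>' p by blast+
  define L where "L = max 0 (min T (min q q') - max p p')"
  have lhs: "expectation (\<lambda>\<omega>. (\<xi> \<omega> * (W \<kappa> (min T q) \<omega> - W \<kappa> (min T p) \<omega>)) *
      (\<xi>' \<omega> * (W \<kappa>' (min T q') \<omega> - W \<kappa>' (min T p') \<omega>))) =
      (if \<kappa> = \<kappa>' then L * expectation (\<lambda>\<omega>. \<xi> \<omega> * \<xi>' \<omega>) else 0)"
  proof (cases "p < T \<and> p' < T")
    case True
    then have "min T p = p" "min T p' = p'" by auto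
    moreover have "min (min T q) (min T q') = min T (min q q')" by (auto simp: min_def)
    ultimately show ?thesis
      using increment_covariance[OF K p(1) _ p(3) _ \<xi> \<xi>', of "min T q" "min T q'"] True p
      by (simp add: L_def)
  next
    case False
    then have "L = 0" by (auto simp: L_def)
    have "min T q = min T p \<or> min T q' = min T p'" using False p by auto
    then show ?thesis using \<open>L = 0\<close> by auto
  qed
  interpret Q: pair_sigma_finite M "time_measure T"
    using finite_time_measure[of T] finite_measure.axioms(1)
    by (auto intro!: pair_sigma_finite.intro sigma_finite_measure_axioms)
  let ?f = "\<lambda>\<omega> s. (indicator {p<..q} s * \<xi> \<omega>) * (indicator {p'<..q'} s * \<xi>' \<omega> :: real)"
  have ind: "?f \<omega> s = (\<xi> \<omega> * \<xi>' \<omega>) * indicator {max p p'<..min q q'} s" for \<omega> s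
    by (auto simp: indicator_def)
  have "integrable (Q T) (\<lambda>(\<omega>, s). ?f \<omega> s)"
  proof (rule integrable_Q_bounded[where C = "\<bar>C * C'\<bar>"])
    fix \<omega> s assume "\<omega> \<in> space M"
    then have "\<bar>\<xi> \<omega>\<bar> * \<bar>\<xi>' \<omega>\<bar> \<le> C * C'" using \<xi>(2) \<xi>'(2) by (intro mult_mono) (auto intro: order_trans[OF abs_ge_zero])
    then have "\<bar>\<xi> \<omega> * \<xi>' \<omega>\<bar> \<le> \<bar>C * C'\<bar>" unfolding abs_mult[of "\<xi> \<omega>"] by linarith
    then show "\<bar>case (\<omega>, s) of (\<omega>, s) \<Rightarrow> ?f \<omega> s\<bar> \<le> \<bar>C * C'\<bar>"
      unfolding prod.case ind by (cases "s \<in> {max p p'<..min q q'}") simp_all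
  qed measurable
  then have "(\<integral>(\<omega>, s). ?f \<omega> s \<partial>Q T) = (\<integral>\<omega>. (\<integral>s. ?f \<omega> s \<partial>time_measure T) \<partial>M)"
    by (rule Q.integral_fst'[symmetric, where f = "\<lambda>(\<omega>, s). ?f \<omega> s", simplified])
  also have "\<dots> = (\<integral>\<omega>. (\<xi> \<omega> * \<xi>' \<omega>) * L \<partial>M)"
  proof -
    have "measure (time_measure T) {max p p'<..min q q'} = L"
    proof -
      have "{0..T} \<inter> {max p p'<..min q q'} = {max p p'<..min T (min q q')}" using p by auto
      then have "emeasure (time_measure T) {max p p'<..min q q'} = emeasure lborel {max p p'<..min T (min q q')}"
        by (simp add: emeasure_density indicator_inter_arith[symmetric])
      also have "emeasure lborel {a<..b} = ennreal (max 0 (b - a))" for a b :: real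
        by (cases "a \<le> b") simp_all
      finally have "emeasure (time_measure T) {max p p'<..min q q'} = ennreal L"
        unfolding L_def .
      then show ?thesis
        by (rule measure_eq_emeasure_eq_ennreal[rotated]) (unfold L_def, rule max.cobounded1)
    qed
    then show ?thesis unfolding ind by simp
  qed
  also have "\<dots> = L * expectation (\<lambda>\<omega>. \<xi> \<omega> * \<xi>' \<omega>)"
    by (simp only: integral_mult_right_zero mult.commute[of _ L])
  finally have rhs: "(\<integral>(\<omega>, s). ?f \<omega> s \<partial>Q T) = L * expectation (\<lambda>\<omega>. \<xi> \<omega> * \<xi>' \<omega>)" .
  have "(\<Sum>\<kappa>''\<in>K. \<integral>(\<omega>, s). (if \<kappa>'' = \<kappa> then indicator {p<..q} s * \<xi> \<omega> else 0) *
      (if \<kappa>'' = \<kappa>' then indicator {p'<..q'} s * \<xi>' \<omega> else 0) \<partial>Q T) =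
      (\<Sum>\<kappa>''\<in>K. if \<kappa>'' = \<kappa> then (if \<kappa> = \<kappa>' then (\<integral>(\<omega>, s). ?f \<omega> s \<partial>Q T) else 0) else 0)"
    by (intro sum.cong refl) (auto simp: case_prod_unfold)
  then show ?thesis unfolding lhs rhs using K finite_K by simp
qed

text \<open>
  Both sides are bilinear, so two single steps suffice.
\<close>

lemma elementary_isometry:
  assumes "elementary S J" "elementary S' J'" and T: "0 \<le> T"
  shows "expectation (\<lambda>\<omega>. J T \<omega> * J' T \<omega>) = (\<Sum>\<kappa>\<in>K. \<integral>(\<omega>, s). S \<kappa> s \<omega> * S' \<kappa> s \<omega> \<partial>Q T)"
proof -
  have int: "integrable M (\<lambda>\<omega>. J1 T \<omega> * J2 T \<omega>)" if "elementary S1 J1" "elementary S2 J2" for S1 J1 S2 J2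
    using elementary_integral_L2[OF _ T] that by (intro integrable_mult_of_squares) auto
  have lin: "expectation (\<lambda>\<omega>. (J1 T \<omega> + J2 T \<omega>) * J3 T \<omega>) =
      (\<Sum>\<kappa>\<in>K. \<integral>(\<omega>, s). (S1 \<kappa> s \<omega> + S2 \<kappa> s \<omega>) * S3 \<kappa> s \<omega> \<partial>Q T)"
    if e: "elementary S1 J1" "elementary S2 J2" "elementary S3 J3"
      and "expectation (\<lambda>\<omega>. J1 T \<omega> * J3 T \<omega>) = (\<Sum>\<kappa>\<in>K. \<integral>(\<omega>, s). S1 \<kappa> s \<omega> * S3 \<kappa> s \<omega> \<partial>Q T)"
      and "expectation (\<lambda>\<omega>. J2 T \<omega> * J3 T \<omega>) = (\<Sum>\<kappa>\<in>K. \<integral>(\<omega>, s). S2 \<kappa> s \<omega> * S3 \<kappa> s \<omega> \<partial>Q T)"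
    for S1 J1 S2 J2 S3 J3
  proof -
    have "(\<integral>(\<omega>, s). (S1 \<kappa> s \<omega> + S2 \<kappa> s \<omega>) * S3 \<kappa> s \<omega> \<partial>Q T) =
        (\<integral>(\<omega>, s). S1 \<kappa> s \<omega> * S3 \<kappa> s \<omega> \<partial>Q T) + (\<integral>(\<omega>, s). S2 \<kappa> s \<omega> * S3 \<kappa> s \<omega> \<partial>Q T)" for \<kappa>
      using Bochner_Integration.integral_add[OF elementary_product_integrable[OF e(1,3), of T \<kappa>]
          elementary_product_integrable[OF e(2,3), of T \<kappa>]]
      by (simp only: case_prod_unfold distrib_right)
    moreover have "expectation (\<lambda>\<omega>. (J1 T \<omega> + J2 T \<omega>) * J3 T \<omega>) =
        expectation (\<lambda>\<omega>. J1 T \<omega> * J3 T \<omega>) + expectation (\<lambda>\<omega>. J2 T \<omega> * J3 T \<omega>)"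
      unfolding distrib_right by (rule Bochner_Integration.integral_add[OF int[OF e(1,3)] int[OF e(2,3)]])
    ultimately show ?thesis by (simp only: that(4,5) sum.distrib)
  qed
  have one: "expectation (\<lambda>\<omega>. (\<xi> \<omega> * (W \<kappa> (min T q) \<omega> - W \<kappa> (min T p) \<omega>)) * J2 T \<omega>) =
      (\<Sum>\<kappa>''\<in>K. \<integral>(\<omega>, s). (if \<kappa>'' = \<kappa> then indicator {p<..q} s * \<xi> \<omega> else 0) * S2 \<kappa>'' s \<omega> \<partial>Q T)"
    if s: "\<kappa> \<in> K" "0 \<le> p" "p \<le> q" "\<xi> \<in> borel_measurable (F p)" "\<And>\<omega>. \<omega> \<in> space M \<Longrightarrow> \<bar>\<xi> \<omega>\<bar> \<le> C"
      and e: "elementary S2 J2" for \<kappa> p q \<xi> C S2 J2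
    using e
  proof (induction rule: elementary.induct)
    case (single \<kappa>' p' q' \<xi>' C')
    show ?case
      by (rule elementary_isometry_single[OF s(1) single(1) s(2,3) single(2,3) s(4,5) single(4,5) T])
  next
    case (add S1 J1 S2 J2)
    have "elementary (\<lambda>\<kappa>' s \<omega>. if \<kappa>' = \<kappa> then indicator {p<..q} s * \<xi> \<omega> else 0)
      (\<lambda>t \<omega>. \<xi> \<omega> * (W \<kappa> (min t q) \<omega> - W \<kappa> (min t p) \<omega>))"
      using s by (rule elementary.single)
    from lin[OF add.hyps this] add.IH show ?case by (simp only: mult.commute)
  qed simp
  show ?thesis
    using assms(1)
  proof (induction rule: elementary.induct)
    case zero
    then show ?case by simp
  next
    case (single \<kappa> p q \<xi> C)
    show ?case by (rule one[OF single assms(2)])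
  next
    case (add S1 J1 S2 J2)
    show ?case by (rule lin[OF add.hyps assms(2) add.IH])
  qed
qed

lemma increment_mult_integrable:
  assumes "\<kappa> \<in> K" "0 \<le> a" "a \<le> b"
    and "\<eta> \<in> borel_measurable M" "\<And>\<omega>. \<omega> \<in> space M \<Longrightarrow> \<bar>\<eta> \<omega>\<bar> \<le> C"
  shows "integrable M (\<lambda>\<omega>. \<eta> \<omega> * (W \<kappa> b \<omega> - W \<kappa> a \<omega>))"
proof (rule integrable_mult_bounded_left[OF assms(4,5)])
  have "0 \<le> b" using assms by linarith
  show "integrable M (\<lambda>\<omega>. W \<kappa> b \<omega> - W \<kappa> a \<omega>)"
    by (rule integrable_of_square[OF borel_measurable_diff[OF W_measurable[OF assms(1) \<open>0 \<le> b\<close>] W_measurable[OF assms(1,2)]]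
          W_square[OF assms(1-3)]])
qed

text \<open>
  Only the part of a step after time \<open>s\<close> matters, and there the coefficient
  times \<open>\<eta>\<close> is known at the left end point.
\<close>

lemma elementary_martingale:
  assumes "elementary S J" and st: "0 \<le> s" "s \<le> t"
    and \<eta>: "\<eta> \<in> borel_measurable (F s)" "\<And>\<omega>. \<omega> \<in> space M \<Longrightarrow> \<bar>\<eta> \<omega>\<bar> \<le> C"
  shows "expectation (\<lambda>\<omega>. \<eta> \<omega> * J t \<omega>) = expectation (\<lambda>\<omega>. \<eta> \<omega> * J s \<omega>)"
  using assms(1)
proof (induction rule: elementary.induct)
  case zero
  then show ?case by simp
next
  case (single \<kappa> p q \<xi> D)
  note \<kappa> = single(1) and p = single(2) and pq = single(3)
  have b: "\<bar>\<eta> \<omega> * \<xi> \<omega>\<bar> \<le> C * D" if "\<omega> \<in> space M" for \<omega>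
    unfolding abs_mult using \<eta>(2)[OF that] single(5)[OF that] by (intro mult_mono) auto
  let ?\<zeta> = "\<lambda>\<omega>. \<eta> \<omega> * \<xi> \<omega>"
  have \<zeta>M: "?\<zeta> \<in> borel_measurable M"
    by (rule borel_measurable_times[OF measurable_F_M[OF \<eta>(1) st(1)] measurable_F_M[OF single(4) p]])
  show ?case
  proof (cases "p \<le> s")
    case True
    have m: "?\<zeta> \<in> borel_measurable (F s)"
      by (rule borel_measurable_times[OF \<eta>(1) measurable_F_mono[OF single(4) p True]])
    have z: "expectation (\<lambda>\<omega>. ?\<zeta> \<omega> * (W \<kappa> (min t q) \<omega> - W \<kappa> (min s q) \<omega>)) = 0"
    proof (cases "q \<le> s")
      case True
      then have "min t q = min s q" using st by simp
      then show ?thesis by simp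
    next
      case False
      then have eq: "min s q = s" and le: "s \<le> min t q" using st by simp_all
      show ?thesis unfolding eq by (rule centred[OF \<kappa> st(1) le m b])
    qed
    have t: "min t p = p" "min s p = p" using True st by simp_all
    have le: "p \<le> min s q" "min s q \<le> min t q" "0 \<le> min s q" using True pq p st by auto
    have i1: "integrable M (\<lambda>\<omega>. ?\<zeta> \<omega> * (W \<kappa> (min t q) \<omega> - W \<kappa> (min s q) \<omega>))"
      by (rule increment_mult_integrable[OF \<kappa> le(3,2) \<zeta>M b])
    have i2: "integrable M (\<lambda>\<omega>. ?\<zeta> \<omega> * (W \<kappa> (min s q) \<omega> - W \<kappa> p \<omega>))"
      by (rule increment_mult_integrable[OF \<kappa> p le(1) \<zeta>M b])
    have "expectation (\<lambda>\<omega>. \<eta> \<omega> * (\<xi> \<omega> * (W \<kappa> (min t q) \<omega> - W \<kappa> (min t p) \<omega>))) =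
      expectation (\<lambda>\<omega>. ?\<zeta> \<omega> * (W \<kappa> (min t q) \<omega> - W \<kappa> (min s q) \<omega>) +
         ?\<zeta> \<omega> * (W \<kappa> (min s q) \<omega> - W \<kappa> p \<omega>))"
      unfolding t by (rule arg_cong[where f = expectation]) (simp add: fun_eq_iff algebra_simps)
    also have "\<dots> = 0 + expectation (\<lambda>\<omega>. ?\<zeta> \<omega> * (W \<kappa> (min s q) \<omega> - W \<kappa> p \<omega>))"
      unfolding Bochner_Integration.integral_add[OF i1 i2] z ..
    also have "\<dots> = expectation (\<lambda>\<omega>. \<eta> \<omega> * (\<xi> \<omega> * (W \<kappa> (min s q) \<omega> - W \<kappa> (min s p) \<omega>)))"
      unfolding t mult.assoc by (rule add_0)
    finally show ?thesis .
  next
    case False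
    then have sp: "s \<le> p" by simp
    have m: "?\<zeta> \<in> borel_measurable (F p)"
      by (rule borel_measurable_times[OF measurable_F_mono[OF \<eta>(1) st(1) sp] single(4)])
    have z: "expectation (\<lambda>\<omega>. ?\<zeta> \<omega> * (W \<kappa> (min t q) \<omega> - W \<kappa> (min t p) \<omega>)) = 0"
    proof (cases "t \<le> p")
      case True
      then have "min t q = min t p" using pq by simp
      then show ?thesis by simp
    next
      case False
      then have eq: "min t p = p" and le: "p \<le> min t q" using pq by simp_all
      show ?thesis unfolding eq by (rule centred[OF \<kappa> p le m b])
    qed
    have "min s q = min s p" using sp pq by simp
    then show ?thesis using z unfolding mult.assoc by simp
  qed
next
  case (add S J S' J')
  have i: "integrable M (\<lambda>\<omega>. \<eta> \<omega> * J u \<omega>)" if "0 \<le> u" "elementary S J" for u S J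
    by (rule integrable_mult_bounded_left[OF measurable_F_M[OF \<eta>(1) st(1)] \<eta>(2)])
      (use elementary_integral_L2[OF that(2,1)] integrable_of_square in blast)+
  have "0 \<le> t" using st by linarith
  show ?case
    unfolding distrib_left
      Bochner_Integration.integral_add[OF i[OF \<open>0 \<le> t\<close> add.hyps(1)] i[OF \<open>0 \<le> t\<close> add.hyps(2)]]
      Bochner_Integration.integral_add[OF i[OF st(1) add.hyps(1)] i[OF st(1) add.hyps(2)]]
      add.IH ..
qed

end

section \<open>Square-integrable integrands\<close>

lemma sigma_finite_time_measure: "sigma_finite_measure (time_measure T)"
  using finite_time_measure by (rule finite_measure.axioms(1))

context orthogonal_increments
begin

lemma pair_sigma_finite_Q: "pair_sigma_finite M (time_measure T)"
  by (intro pair_sigma_finite.intro sigma_finite_measure_axioms sigma_finite_time_measure)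

lemma nn_integral_Q:
  fixes f :: "'a \<times> real \<Rightarrow> real"
  assumes "f \<in> borel_measurable (M \<Otimes>\<^sub>M borel)"
  shows "(\<integral>\<^sup>+x. ennreal (f x) \<partial>Q T) = (\<integral>\<^sup>+\<omega>. (\<integral>\<^sup>+s. ennreal (f (\<omega>, s)) * indicator {0..T} s \<partial>lborel) \<partial>M)"
proof -
  have m: "(\<lambda>x. ennreal (f x)) \<in> borel_measurable (Q T)" using assms by simp
  have "(\<integral>\<^sup>+x. ennreal (f x) \<partial>Q T) = (\<integral>\<^sup>+\<omega>. (\<integral>\<^sup>+s. ennreal (f (\<omega>, s)) \<partial>time_measure T) \<partial>M)"
    by (rule sigma_finite_measure.nn_integral_fst[OF sigma_finite_time_measure m, symmetric])
  also have "\<dots> = (\<integral>\<^sup>+\<omega>. (\<integral>\<^sup>+s. ennreal (f (\<omega>, s)) * indicator {0..T} s \<partial>lborel) \<partial>M)"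
  proof (rule nn_integral_cong)
    fix \<omega> assume "\<omega> \<in> space M"
    then have "(\<lambda>s. f (\<omega>, s)) \<in> borel_measurable borel"
      using measurable_Pair2[OF assms] by simp
    then show "(\<integral>\<^sup>+s. ennreal (f (\<omega>, s)) \<partial>time_measure T) = (\<integral>\<^sup>+s. ennreal (f (\<omega>, s)) * indicator {0..T} s \<partial>lborel)"
      by (subst nn_integral_density) (auto simp: mult.commute)
  qed
  finally show ?thesis .
qed

lemma integral_Q_mono_time:
  fixes f :: "'a \<times> real \<Rightarrow> real"
  assumes m: "f \<in> borel_measurable (M \<Otimes>\<^sub>M borel)" and int: "integrable (Q t) f"
    and nonneg: "\<And>x. 0 \<le> f x" and "s \<le> t"
  shows "integrable (Q s) f" "integral\<^sup>L (Q s) f \<le> integral\<^sup>L (Q t) f"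
proof -
  have le: "(\<integral>\<^sup>+x. ennreal (f x) \<partial>Q s) \<le> (\<integral>\<^sup>+x. ennreal (f x) \<partial>Q t)"
    unfolding nn_integral_Q[OF m] using \<open>s \<le> t\<close>
    by (intro nn_integral_mono mult_left_mono) (auto simp: indicator_def)
  also have eq: "\<dots> = ennreal (integral\<^sup>L (Q t) f)"
    by (rule nn_integral_eq_integral[OF int]) (use nonneg in simp)
  finally have "(\<integral>\<^sup>+x. ennreal (f x) \<partial>Q s) \<le> ennreal (integral\<^sup>L (Q t) f)" .
  then have fin: "(\<integral>\<^sup>+x. ennreal (f x) \<partial>Q s) < \<infinity>" by (rule order.strict_trans1) simp
  have ms: "f \<in> borel_measurable (Q s)" using m by (simp only: borel_measurable_Q)
  show i: "integrable (Q s) f"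
    by (rule integrableI_nonneg[OF ms _ fin]) (use nonneg in simp)
  have "ennreal (integral\<^sup>L (Q s) f) \<le> ennreal (integral\<^sup>L (Q t) f)"
    using le unfolding eq by (subst (asm) nn_integral_eq_integral[OF i]) (use nonneg in simp_all)
  then show "integral\<^sup>L (Q s) f \<le> integral\<^sup>L (Q t) f"
    using Bochner_Integration.integral_nonneg[OF nonneg, of "Q t"] by simp
qed

text \<open>
  The integrand as a function on the product space, where \<open>L\<^sup>2\<close>
  convergence takes place.
\<close>

definition path :: "('k \<Rightarrow> real \<Rightarrow> 'a \<Rightarrow> real) \<Rightarrow> 'k \<Rightarrow> 'a \<times> real \<Rightarrow> real" where
  "path \<Phi> \<kappa> x = \<Phi> \<kappa> (snd x) (fst x)"

definition L2_integrand :: "('k \<Rightarrow> real \<Rightarrow> 'a \<Rightarrow> real) \<Rightarrow> real \<Rightarrow> bool" where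
  "L2_integrand \<Phi> T \<longleftrightarrow>
     (\<forall>\<kappa>\<in>K. path \<Phi> \<kappa> \<in> borel_measurable (M \<Otimes>\<^sub>M borel) \<and> integrable (Q T) (\<lambda>x. (path \<Phi> \<kappa> x)\<^sup>2))"

definition L2_approximation ::
  "(nat \<Rightarrow> 'k \<Rightarrow> real \<Rightarrow> 'a \<Rightarrow> real) \<Rightarrow> (nat \<Rightarrow> real \<Rightarrow> 'a \<Rightarrow> real) \<Rightarrow>
   ('k \<Rightarrow> real \<Rightarrow> 'a \<Rightarrow> real) \<Rightarrow> real \<Rightarrow> ('a \<Rightarrow> real) \<Rightarrow> bool" where
  "L2_approximation S J \<Phi> T Z \<longleftrightarrow>
     (\<forall>m. elementary (S m) (J m)) \<and>
     (\<forall>\<kappa>\<in>K. (\<lambda>m. \<integral>x. (path (S m) \<kappa> x - path \<Phi> \<kappa> x)\<^sup>2 \<partial>Q T) \<longlonglongrightarrow> 0) \<and>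
     (\<lambda>m. \<integral>\<omega>. (J m T \<omega> - Z \<omega>)\<^sup>2 \<partial>M) \<longlonglongrightarrow> 0"

lemma L2_approximationD:
  assumes "L2_approximation S J \<Phi> T Z"
  shows "\<And>m. elementary (S m) (J m)"
    "\<And>\<kappa>. \<kappa> \<in> K \<Longrightarrow> (\<lambda>m. \<integral>x. (path (S m) \<kappa> x - path \<Phi> \<kappa> x)\<^sup>2 \<partial>Q T) \<longlonglongrightarrow> 0"
    "(\<lambda>m. \<integral>\<omega>. (J m T \<omega> - Z \<omega>)\<^sup>2 \<partial>M) \<longlonglongrightarrow> 0"
  using assms unfolding L2_approximation_def by blast+

definition L2_ito_integral :: "('k \<Rightarrow> real \<Rightarrow> 'a \<Rightarrow> real) \<Rightarrow> real \<Rightarrow> ('a \<Rightarrow> real) \<Rightarrow> bool" where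
  "L2_ito_integral \<Phi> T Z \<longleftrightarrow>
     Z \<in> borel_measurable M \<and> integrable M (\<lambda>\<omega>. (Z \<omega>)\<^sup>2) \<and> L2_integrand \<Phi> T \<and>
     (\<exists>S J. L2_approximation S J \<Phi> T Z)"

lemma L2_ito_integralD:
  assumes "L2_ito_integral \<Phi> T Z"
  shows "Z \<in> borel_measurable M" "integrable M (\<lambda>\<omega>. (Z \<omega>)\<^sup>2)" "L2_integrand \<Phi> T"
    "\<exists>S J. L2_approximation S J \<Phi> T Z"
  using assms unfolding L2_ito_integral_def by blast+

lemma L2_ito_integralI:
  assumes "Z \<in> borel_measurable M" "integrable M (\<lambda>\<omega>. (Z \<omega>)\<^sup>2)" "L2_integrand \<Phi> T"
    and "\<And>m. elementary (S m) (J m)"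
    and "\<And>\<kappa>. \<kappa> \<in> K \<Longrightarrow> (\<lambda>m. \<integral>x. (path (S m) \<kappa> x - path \<Phi> \<kappa> x)\<^sup>2 \<partial>Q T) \<longlonglongrightarrow> 0"
    and "(\<lambda>m. \<integral>\<omega>. (J m T \<omega> - Z \<omega>)\<^sup>2 \<partial>M) \<longlonglongrightarrow> 0"
  shows "L2_ito_integral \<Phi> T Z"
  using assms unfolding L2_ito_integral_def L2_approximation_def by blast

lemma L2_integrandD:
  assumes "L2_integrand \<Phi> T" "\<kappa> \<in> K"
  shows "path \<Phi> \<kappa> \<in> borel_measurable (M \<Otimes>\<^sub>M borel)" "path \<Phi> \<kappa> \<in> borel_measurable (Q T)"
    "integrable (Q T) (\<lambda>x. (path \<Phi> \<kappa> x)\<^sup>2)"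
  using assms unfolding L2_integrand_def borel_measurable_Q by blast+

lemma elementary_L2_integrand:
  assumes "elementary S J"
  shows "L2_integrand S T"
  unfolding L2_integrand_def path_def
  using elementary_measurable[OF assms] elementary_square_integrable[OF assms, of T]
  by (simp only: case_prod_unfold) blast

lemma path_add: "path (\<lambda>\<kappa> s \<omega>. \<Phi> \<kappa> s \<omega> + \<Psi> \<kappa> s \<omega>) \<kappa> x = path \<Phi> \<kappa> x + path \<Psi> \<kappa> x"
  by (simp add: path_def)

lemma path_uminus: "path (\<lambda>\<kappa> s \<omega>. - \<Phi> \<kappa> s \<omega>) \<kappa> x = - path \<Phi> \<kappa> x"
  by (simp add: path_def)

lemma L2_integrand_add:
  assumes "L2_integrand \<Phi> T" "L2_integrand \<Psi> T"
  shows "L2_integrand (\<lambda>\<kappa> s \<omega>. \<Phi> \<kappa> s \<omega> + \<Psi> \<kappa> s \<omega>) T"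
proof -
  have eq: "path (\<lambda>\<kappa> s \<omega>. \<Phi> \<kappa> s \<omega> + \<Psi> \<kappa> s \<omega>) \<kappa> = (\<lambda>x. path \<Phi> \<kappa> x + path \<Psi> \<kappa> x)" for \<kappa>
    by (simp add: path_def fun_eq_iff)
  show ?thesis
    unfolding L2_integrand_def eq
  proof (intro ballI conjI)
  fix \<kappa> assume \<kappa>: "\<kappa> \<in> K"
  note 1 = L2_integrandD[OF assms(1) \<kappa>] and 2 = L2_integrandD[OF assms(2) \<kappa>]
  show "integrable (Q T) (\<lambda>x. (path \<Phi> \<kappa> x + path \<Psi> \<kappa> x)\<^sup>2)"
    by (rule integrable_square_add(1)[OF 1(2) 2(2) 1(3) 2(3)])
  have "(\<lambda>x. path \<Phi> \<kappa> x + path \<Psi> \<kappa> x) \<in> borel_measurable (M \<Otimes>\<^sub>M borel)"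
    by (rule borel_measurable_add[OF 1(1) 2(1)])
  then show "(\<lambda>x. path \<Phi> \<kappa> x + path \<Psi> \<kappa> x) \<in> borel_measurable (M \<Otimes>\<^sub>M borel)" .
  qed
qed

lemma elementary_L2_isometry:
  assumes "elementary S J" and T: "0 \<le> T"
  shows "(\<integral>\<omega>. (J T \<omega>)\<^sup>2 \<partial>M) = (\<Sum>\<kappa>\<in>K. \<integral>x. (path S \<kappa> x)\<^sup>2 \<partial>Q T)"
  using elementary_isometry[OF assms(1,1) T] unfolding path_def power2_eq_square
  by (simp only: case_prod_unfold)

lemma elementary_diff:
  assumes "elementary S J" "elementary S' J'"
  shows "elementary (\<lambda>\<kappa> s \<omega>. S \<kappa> s \<omega> - S' \<kappa> s \<omega>) (\<lambda>t \<omega>. J t \<omega> - J' t \<omega>)"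
  using elementary.add[OF assms(1) elementary_uminus[OF assms(2)]] by simp

lemma elementary_L2_isometry_diff:
  assumes "elementary S J" "elementary S' J'" and T: "0 \<le> T"
  shows "(\<integral>\<omega>. (J T \<omega> - J' T \<omega>)\<^sup>2 \<partial>M) = (\<Sum>\<kappa>\<in>K. \<integral>x. (path S \<kappa> x - path S' \<kappa> x)\<^sup>2 \<partial>Q T)"
  using elementary_L2_isometry[OF elementary_diff[OF assms(1,2)] T] by (simp only: path_def)

lemma L2_ito_integral_zero: "L2_ito_integral (\<lambda>_ _ _. 0) T (\<lambda>_. 0)"
  by (rule L2_ito_integralI[where S = "\<lambda>_ _ _ _. 0" and J = "\<lambda>_ _ _. 0"])
    (simp_all add: elementary.zero elementary_L2_integrand[OF elementary.zero])

lemma L2_ito_integral_add: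
  assumes "L2_ito_integral \<Phi> T Z" "L2_ito_integral \<Psi> T Z'" and T: "0 \<le> T"
  shows "L2_ito_integral (\<lambda>\<kappa> s \<omega>. \<Phi> \<kappa> s \<omega> + \<Psi> \<kappa> s \<omega>) T (\<lambda>\<omega>. Z \<omega> + Z' \<omega>)"
proof -
  note Z = L2_ito_integralD(1,2)[OF assms(1)] and \<Phi> = L2_ito_integralD(3)[OF assms(1)]
    and Z' = L2_ito_integralD(1,2)[OF assms(2)] and \<Psi> = L2_ito_integralD(3)[OF assms(2)]
  obtain S J where Sa: "L2_approximation S J \<Phi> T Z"
    using L2_ito_integralD(4)[OF assms(1)] by blast
  note S = L2_approximationD[OF Sa]
  obtain S' J' where S'a: "L2_approximation S' J' \<Psi> T Z'"
    using L2_ito_integralD(4)[OF assms(2)] by blast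
  note S' = L2_approximationD[OF S'a]
  note J = elementary_integral_L2[OF S(1) T] and J' = elementary_integral_L2[OF S'(1) T]
  have "(\<lambda>m. \<integral>\<omega>. ((J m T \<omega> - Z \<omega>) + (J' m T \<omega> - Z' \<omega>))\<^sup>2 \<partial>M) \<longlonglongrightarrow> 0"
    by (rule L2_tendsto_0_add[OF _ _ _ _ S(3) S'(3)])
      (intro borel_measurable_diff integrable_square_add(2) conjunct1[OF J] conjunct2[OF J]
        conjunct1[OF J'] conjunct2[OF J'] Z Z')+
  then have limJ: "(\<lambda>m. \<integral>\<omega>. ((J m T \<omega> + J' m T \<omega>) - (Z \<omega> + Z' \<omega>))\<^sup>2 \<partial>M) \<longlonglongrightarrow> 0"
    by (simp only: add_diff_add)
  have limS: "(\<lambda>m. \<integral>x. (path (\<lambda>\<kappa> s \<omega>. S m \<kappa> s \<omega> + S' m \<kappa> s \<omega>) \<kappa> x -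
      path (\<lambda>\<kappa> s \<omega>. \<Phi> \<kappa> s \<omega> + \<Psi> \<kappa> s \<omega>) \<kappa> x)\<^sup>2 \<partial>Q T) \<longlonglongrightarrow> 0" if \<kappa>: "\<kappa> \<in> K" for \<kappa>
  proof -
    note S1 = L2_integrandD[OF elementary_L2_integrand[OF S(1)] \<kappa>]
      and S2 = L2_integrandD[OF elementary_L2_integrand[OF S'(1)] \<kappa>]
      and p = L2_integrandD[OF \<Phi> \<kappa>] and q = L2_integrandD[OF \<Psi> \<kappa>]
    have "(\<lambda>m. \<integral>x. ((path (S m) \<kappa> x - path \<Phi> \<kappa> x) + (path (S' m) \<kappa> x - path \<Psi> \<kappa> x))\<^sup>2 \<partial>Q T) \<longlonglongrightarrow> 0"
      by (rule L2_tendsto_0_add[OF _ _ _ _ S(2)[OF \<kappa>] S'(2)[OF \<kappa>]])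
        (intro borel_measurable_diff integrable_square_add(2) S1(2,3) S2(2,3) p(2,3) q(2,3))+
    then show ?thesis by (simp only: path_add add_diff_add)
  qed
  show ?thesis
    by (rule L2_ito_integralI[OF borel_measurable_add[OF Z(1) Z'(1)]
          integrable_square_add(1)[OF Z(1) Z'(1) Z(2) Z'(2)] L2_integrand_add[OF \<Phi> \<Psi>]
          elementary.add[OF S(1) S'(1)] limS limJ])
qed

lemma L2_ito_integral_sum:
  assumes "finite A" "\<And>i. i \<in> A \<Longrightarrow> L2_ito_integral (\<Phi> i) T (Z i)" and T: "0 \<le> T"
  shows "L2_ito_integral (\<lambda>\<kappa> s \<omega>. \<Sum>i\<in>A. \<Phi> i \<kappa> s \<omega>) T (\<lambda>\<omega>. \<Sum>i\<in>A. Z i \<omega>)"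
  using assms(1,2)
proof (induction A rule: finite_induct)
  case empty
  show ?case by (simp add: L2_ito_integral_zero)
next
  case (insert i A)
  have "L2_ito_integral (\<lambda>\<kappa> s \<omega>. \<Phi> i \<kappa> s \<omega> + (\<Sum>i\<in>A. \<Phi> i \<kappa> s \<omega>)) T (\<lambda>\<omega>. Z i \<omega> + (\<Sum>i\<in>A. Z i \<omega>))"
    by (intro L2_ito_integral_add T insert.prems insert.IH insertI1 insertI2)
  then show ?case using insert.hyps by simp
qed

lemma L2_ito_integral_uminus:
  assumes "L2_ito_integral \<Phi> T Z"
  shows "L2_ito_integral (\<lambda>\<kappa> s \<omega>. - \<Phi> \<kappa> s \<omega>) T (\<lambda>\<omega>. - Z \<omega>)"
proof -
  obtain S J where Sa: "L2_approximation S J \<Phi> T Z"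
    using L2_ito_integralD(4)[OF assms] by blast
  note S = L2_approximationD[OF Sa]
  have sq: "(- a - - b)\<^sup>2 = (a - b)\<^sup>2" for a b :: real by (simp add: power2_commute)
  note Z = L2_ito_integralD(1,2)[OF assms(1)] and \<Phi> = L2_ito_integralD(3)[OF assms(1)]
  show ?thesis
  proof (rule L2_ito_integralI[where S = "\<lambda>m \<kappa> s \<omega>. - S m \<kappa> s \<omega>" and J = "\<lambda>m t \<omega>. - J m t \<omega>"], unfold path_uminus sq)
    show "(\<lambda>\<omega>. - Z \<omega>) \<in> borel_measurable M" by (rule borel_measurable_uminus[OF Z(1)])
    show "integrable M (\<lambda>\<omega>. (- Z \<omega>)\<^sup>2)" using Z(2) by (simp only: power2_minus)
    show "L2_integrand (\<lambda>\<kappa> s \<omega>. - \<Phi> \<kappa> s \<omega>) T"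
      unfolding L2_integrand_def path_uminus power2_minus path_uminus[abs_def]
      using L2_integrandD[OF \<Phi>] borel_measurable_uminus by blast
  qed (intro elementary_uminus S, assumption?)+
qed

lemma L2_ito_integral_cong_AE:
  assumes "L2_ito_integral \<Phi> T Z" "AE \<omega> in M. Z \<omega> = Z' \<omega>" "Z' \<in> borel_measurable M" and T: "0 \<le> T"
  shows "L2_ito_integral \<Phi> T Z'"
proof -
  note Z = L2_ito_integralD(1,2)[OF assms(1)] and \<Phi> = L2_ito_integralD(3)[OF assms(1)]
  have meas: "(\<lambda>\<omega>. (Z \<omega>)\<^sup>2) \<in> borel_measurable M" "(\<lambda>\<omega>. (Z' \<omega>)\<^sup>2) \<in> borel_measurable M"
    by (intro borel_measurable_power Z(1) assms(3))+
  have "AE \<omega> in M. (Z \<omega>)\<^sup>2 = (Z' \<omega>)\<^sup>2" by (rule AE_mp[OF assms(2)]) simp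
  then have Z'_sq: "integrable M (\<lambda>\<omega>. (Z' \<omega>)\<^sup>2)"
    by (rule integrable_cong_AE_imp[OF Z(2) meas(2)])
  obtain S J where Sa: "L2_approximation S J \<Phi> T Z"
    using L2_ito_integralD(4)[OF assms(1)] by blast
  note S = L2_approximationD[OF Sa]
  have "(\<integral>\<omega>. (J m T \<omega> - Z' \<omega>)\<^sup>2 \<partial>M) = (\<integral>\<omega>. (J m T \<omega> - Z \<omega>)\<^sup>2 \<partial>M)" for m
  proof (rule Bochner_Integration.integral_cong_AE)
    have J: "J m T \<in> borel_measurable M" using elementary_integral_L2[OF S(1) T] by blast
    show "(\<lambda>\<omega>. (J m T \<omega> - Z' \<omega>)\<^sup>2) \<in> borel_measurable M"
      by (intro borel_measurable_power borel_measurable_diff J assms(3))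
    show "(\<lambda>\<omega>. (J m T \<omega> - Z \<omega>)\<^sup>2) \<in> borel_measurable M"
      by (intro borel_measurable_power borel_measurable_diff J Z(1))
    show "AE \<omega> in M. (J m T \<omega> - Z' \<omega>)\<^sup>2 = (J m T \<omega> - Z \<omega>)\<^sup>2" by (rule AE_mp[OF assms(2)]) simp
  qed
  then have lim: "(\<lambda>m. \<integral>\<omega>. (J m T \<omega> - Z' \<omega>)\<^sup>2 \<partial>M) \<longlonglongrightarrow> 0" using S(3) by simp
  show ?thesis by (rule L2_ito_integralI[OF assms(3) Z'_sq \<Phi> S(1,2) lim])
qed

lemma L2_ito_integral_isometry:
  assumes "L2_ito_integral \<Phi> T Z" and T: "0 \<le> T"
  shows "(\<integral>\<omega>. (Z \<omega>)\<^sup>2 \<partial>M) = (\<Sum>\<kappa>\<in>K. \<integral>x. (path \<Phi> \<kappa> x)\<^sup>2 \<partial>Q T)"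
proof -
  note Z = L2_ito_integralD(1,2)[OF assms(1)] and \<Phi> = L2_ito_integralD(3)[OF assms(1)]
  obtain S J where Sa: "L2_approximation S J \<Phi> T Z"
    using L2_ito_integralD(4)[OF assms(1)] by blast
  note S = L2_approximationD[OF Sa]
  note J = elementary_integral_L2[OF S(1) T]
  have 1: "(\<lambda>m. \<integral>\<omega>. (J m T \<omega>)\<^sup>2 \<partial>M) \<longlonglongrightarrow> (\<integral>\<omega>. (Z \<omega>)\<^sup>2 \<partial>M)"
    by (rule L2_tendsto_imp_tendsto_integral_square[OF conjunct1[OF J] Z(1) conjunct2[OF J] Z(2) S(3)])
  have "(\<lambda>m. \<Sum>\<kappa>\<in>K. \<integral>x. (path (S m) \<kappa> x)\<^sup>2 \<partial>Q T) \<longlonglongrightarrow> (\<Sum>\<kappa>\<in>K. \<integral>x. (path \<Phi> \<kappa> x)\<^sup>2 \<partial>Q T)"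
  proof (rule tendsto_sum)
    fix \<kappa> assume \<kappa>: "\<kappa> \<in> K"
    note S1 = L2_integrandD[OF elementary_L2_integrand[OF S(1)] \<kappa>] and p = L2_integrandD[OF \<Phi> \<kappa>]
    show "(\<lambda>m. \<integral>x. (path (S m) \<kappa> x)\<^sup>2 \<partial>Q T) \<longlonglongrightarrow> (\<integral>x. (path \<Phi> \<kappa> x)\<^sup>2 \<partial>Q T)"
      by (rule L2_tendsto_imp_tendsto_integral_square[OF S1(2) p(2) S1(3) p(3) S(2)[OF \<kappa>]])
  qed
  then have "(\<lambda>m. \<integral>\<omega>. (J m T \<omega>)\<^sup>2 \<partial>M) \<longlonglongrightarrow> (\<Sum>\<kappa>\<in>K. \<integral>x. (path \<Phi> \<kappa> x)\<^sup>2 \<partial>Q T)"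
    by (simp only: elementary_L2_isometry[OF S(1) T])
  with 1 show ?thesis by (rule LIMSEQ_unique)
qed

text \<open>
  The integrals over \<open>[0, t]\<close> and \<open>[0, s]\<close> come with unrelated
  approximating sequences. Both sequences approximate \<open>\<Phi>\<close> on \<open>[0,
  s]\<close>, so by the isometry their integrals over \<open>[0, s]\<close> have the same
  limit.
\<close>

lemma L2_ito_integral_martingale:
  assumes t_int: "L2_ito_integral \<Phi> t Z" and s_int: "L2_ito_integral \<Phi> s Z'" and st: "0 \<le> s" "s \<le> t"
    and \<eta>: "\<eta> \<in> borel_measurable (F s)" "\<And>\<omega>. \<omega> \<in> space M \<Longrightarrow> \<bar>\<eta> \<omega>\<bar> \<le> C"
  shows "expectation (\<lambda>\<omega>. Z \<omega> * \<eta> \<omega>) = expectation (\<lambda>\<omega>. Z' \<omega> * \<eta> \<omega>)"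
proof -
  have t: "0 \<le> t" using st by linarith
  note Z = L2_ito_integralD(1,2)[OF t_int] and \<Phi>t = L2_ito_integralD(3)[OF t_int]
    and Z' = L2_ito_integralD(1,2)[OF s_int] and \<Phi>s = L2_ito_integralD(3)[OF s_int]
  obtain S J where Sa: "L2_approximation S J \<Phi> t Z"
    using L2_ito_integralD(4)[OF t_int] by blast
  note S = L2_approximationD[OF Sa]
  obtain S' J' where S'a: "L2_approximation S' J' \<Phi> s Z'"
    using L2_ito_integralD(4)[OF s_int] by blast
  note S' = L2_approximationD[OF S'a]
  note Jt = elementary_integral_L2[OF S(1) t] and Js = elementary_integral_L2[OF S(1) st(1)]
    and J's = elementary_integral_L2[OF S'(1) st(1)]
  have \<eta>M: "\<eta> \<in> borel_measurable M" by (rule measurable_F_M[OF \<eta>(1) st(1)])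
  have \<eta>_sq: "integrable M (\<lambda>\<omega>. (\<eta> \<omega>)\<^sup>2)"
  proof (rule integrable_const_bound[where B = "C\<^sup>2"])
    show "(\<lambda>\<omega>. (\<eta> \<omega>)\<^sup>2) \<in> borel_measurable M" by (rule borel_measurable_power[OF \<eta>M])
    show "AE \<omega> in M. norm ((\<eta> \<omega>)\<^sup>2) \<le> C\<^sup>2"
    proof (rule AE_I2)
      fix \<omega> assume "\<omega> \<in> space M"
      from power_mono[OF \<eta>(2)[OF this], of 2] show "norm ((\<eta> \<omega>)\<^sup>2) \<le> C\<^sup>2" by simp
    qed
  qed
  have 1: "(\<lambda>m. expectation (\<lambda>\<omega>. J m t \<omega> * \<eta> \<omega>)) \<longlonglongrightarrow> expectation (\<lambda>\<omega>. Z \<omega> * \<eta> \<omega>)"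
    by (rule L2_tendsto_imp_tendsto_integral_mult[OF conjunct1[OF Jt] Z(1) \<eta>M conjunct2[OF Jt] Z(2) \<eta>_sq S(3)])
  have 2: "(\<lambda>m. expectation (\<lambda>\<omega>. J' m s \<omega> * \<eta> \<omega>)) \<longlonglongrightarrow> expectation (\<lambda>\<omega>. Z' \<omega> * \<eta> \<omega>)"
    by (rule L2_tendsto_imp_tendsto_integral_mult[OF conjunct1[OF J's] Z'(1) \<eta>M conjunct2[OF J's] Z'(2) \<eta>_sq S'(3)])
  have mart: "expectation (\<lambda>\<omega>. J m t \<omega> * \<eta> \<omega>) = expectation (\<lambda>\<omega>. J m s \<omega> * \<eta> \<omega>)" for m
    using elementary_martingale[OF S(1) st \<eta>(1), of C m] \<eta>(2) by (simp only: mult.commute[of "\<eta> _"])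
  have lim_s: "(\<lambda>m. \<integral>x. (path (S m) \<kappa> x - path (S' m) \<kappa> x)\<^sup>2 \<partial>Q s) \<longlonglongrightarrow> 0" if \<kappa>: "\<kappa> \<in> K" for \<kappa>
  proof -
    note S1 = L2_integrandD[OF elementary_L2_integrand[OF S(1)] \<kappa>]
      and S2 = L2_integrandD[OF elementary_L2_integrand[OF S'(1)] \<kappa>]
      and p = L2_integrandD[OF \<Phi>s \<kappa>] and q = L2_integrandD[OF \<Phi>t \<kappa>]
    have le: "(\<integral>x. (path (S m) \<kappa> x - path \<Phi> \<kappa> x)\<^sup>2 \<partial>Q s) \<le> (\<integral>x. (path (S m) \<kappa> x - path \<Phi> \<kappa> x)\<^sup>2 \<partial>Q t)" for m
      by (rule integral_Q_mono_time(2)[OF _ _ _ st(2)])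
        (intro borel_measurable_power borel_measurable_diff S1 p integrable_square_add(2) q zero_le_power2)+
    have A: "(\<lambda>m. \<integral>x. (path (S m) \<kappa> x - path \<Phi> \<kappa> x)\<^sup>2 \<partial>Q s) \<longlonglongrightarrow> 0"
      by (rule Lim_null_comparison[OF always_eventually S(2)[OF \<kappa>]]) (use le in simp)
    have B: "(\<lambda>m. \<integral>x. (path \<Phi> \<kappa> x - path (S' m) \<kappa> x)\<^sup>2 \<partial>Q s) \<longlonglongrightarrow> 0"
      using S'(2)[OF \<kappa>] by (simp only: power2_commute)
    have "(\<lambda>m. \<integral>x. ((path (S m) \<kappa> x - path \<Phi> \<kappa> x) + (path \<Phi> \<kappa> x - path (S' m) \<kappa> x))\<^sup>2 \<partial>Q s) \<longlonglongrightarrow> 0"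
      by (rule L2_tendsto_0_add[OF _ _ _ _ A B])
        (intro borel_measurable_diff integrable_square_add(2) S1(2,3) S2(2,3) p(2,3))+
    then show ?thesis by (simp only: diff_add_cancel add_diff_eq)
  qed
  have "(\<lambda>m. \<Sum>\<kappa>\<in>K. \<integral>x. (path (S m) \<kappa> x - path (S' m) \<kappa> x)\<^sup>2 \<partial>Q s) \<longlonglongrightarrow> (\<Sum>\<kappa>\<in>K. 0)"
    by (rule tendsto_sum) (rule lim_s)
  then have "(\<lambda>m. \<integral>\<omega>. ((J m s \<omega> - J' m s \<omega>) - 0)\<^sup>2 \<partial>M) \<longlonglongrightarrow> 0"
    by (simp only: elementary_L2_isometry_diff[OF S(1) S'(1) st(1)] diff_zero sum.neutral_const)
  then have "(\<lambda>m. expectation (\<lambda>\<omega>. (J m s \<omega> - J' m s \<omega>) * \<eta> \<omega>)) \<longlonglongrightarrow> expectation (\<lambda>\<omega>. 0 * \<eta> \<omega>)"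
    by (intro L2_tendsto_imp_tendsto_integral_mult[OF _ _ \<eta>M _ _ \<eta>_sq] borel_measurable_diff
        borel_measurable_const conjunct1[OF Js] conjunct1[OF J's] integrable_square_add(2)
        conjunct2[OF Js] conjunct2[OF J's]) simp_all
  moreover have "expectation (\<lambda>\<omega>. (J m s \<omega> - J' m s \<omega>) * \<eta> \<omega>) =
      expectation (\<lambda>\<omega>. J m s \<omega> * \<eta> \<omega>) - expectation (\<lambda>\<omega>. J' m s \<omega> * \<eta> \<omega>)" for m
    unfolding left_diff_distrib
    by (rule Bochner_Integration.integral_diff;
        intro integrable_mult_of_squares conjunct1[OF Js] conjunct1[OF J's] \<eta>M conjunct2[OF Js] conjunct2[OF J's] \<eta>_sq)
  ultimately have "(\<lambda>m. expectation (\<lambda>\<omega>. J m t \<omega> * \<eta> \<omega>) - expectation (\<lambda>\<omega>. J' m s \<omega> * \<eta> \<omega>)) \<longlonglongrightarrow> 0"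
    by (simp add: mart)
  moreover have "(\<lambda>m. expectation (\<lambda>\<omega>. J m t \<omega> * \<eta> \<omega>) - expectation (\<lambda>\<omega>. J' m s \<omega> * \<eta> \<omega>))
      \<longlonglongrightarrow> expectation (\<lambda>\<omega>. Z \<omega> * \<eta> \<omega>) - expectation (\<lambda>\<omega>. Z' \<omega> * \<eta> \<omega>)"
    by (rule tendsto_diff[OF 1 2])
  ultimately have "expectation (\<lambda>\<omega>. Z \<omega> * \<eta> \<omega>) - expectation (\<lambda>\<omega>. Z' \<omega> * \<eta> \<omega>) = 0"
    using LIMSEQ_unique by blast
  then show ?thesis by simp
qed

end

section \<open>Integrals defined by convergence in probability\<close>

lemma borel_measurable_norm_comp:
  fixes f :: "'a \<Rightarrow> real ^ 'd ^ 'e"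
  assumes [measurable]: "f \<in> borel_measurable M"
  shows "(\<lambda>x. norm (f x)) \<in> borel_measurable M"
  by measurable

lemma (in prob_space) prob_null_comparison:
  assumes "\<And>m. prob (A m) \<le> b m" and "b \<longlonglongrightarrow> 0 + 0"
  shows "(\<lambda>m. prob (A m)) \<longlonglongrightarrow> 0"
proof (rule Lim_null_comparison)
  show "b \<longlonglongrightarrow> 0" using assms(2) by simp
  show "\<forall>\<^sub>F m in sequentially. norm (prob (A m)) \<le> b m" using assms(1) by simp
qed

text \<open>
  Terms are added as long as the running total, including the current term, stays within the
  budget \<open>R\<close>. Applied to the energies of the steps of an integrand, this bounds
  the energy of the integrand that is switched off when the budget is spent.
\<close>

lemma sum_until_exhausted_le:
  fixes a :: "nat \<Rightarrow> real"
  assumes "\<And>j. j < n \<Longrightarrow> 0 \<le> a j" and "0 \<le> R"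
  shows "(\<Sum>j<n. if (\<Sum>i\<le>j. a i) \<le> R then a j else 0) \<le> min R (\<Sum>j<n. a j)"
  using assms(1)
proof (induction n)
  case 0
  then show ?case using assms(2) by simp
next
  case (Suc n)
  have IH: "(\<Sum>j<n. if (\<Sum>i\<le>j. a i) \<le> R then a j else 0) \<le> min R (\<Sum>j<n. a j)"
    by (rule Suc.IH) (use Suc.prems in simp)
  have "0 \<le> a n" using Suc.prems by simp
  have eq: "(\<Sum>i\<le>n. a i) = (\<Sum>j<n. a j) + a n" by (simp add: lessThan_Suc_atMost[symmetric])
  show ?case
  proof (cases "(\<Sum>i\<le>n. a i) \<le> R")
    case True
    then show ?thesis using IH eq by simp
  next
    case False
    then show ?thesis using IH eq \<open>0 \<le> a n\<close> by simp
  qed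
qed

lemma partition_mono:
  assumes "\<forall>j<N. p j \<le> p (Suc j)" and "i \<le> j" "j \<le> N"
  shows "p i \<le> (p j :: real)"
  using assms(2,3)
proof (induction j rule: dec_induct)
  case (step j)
  then have "p i \<le> p j" "p j \<le> p (Suc j)" using assms(1) by simp_all
  then show ?case by (rule order_trans)
qed simp

lemma norm_simple_process_square:
  fixes \<xi> :: "nat \<Rightarrow> 'a \<Rightarrow> real ^ 'd ^ 'e"
  assumes "\<forall>j<N. p j \<le> p (Suc j)"
  shows "(norm (simple_process N p \<xi> s \<omega>))\<^sup>2 = (\<Sum>j<N. indicator {p j<..p (Suc j)} s * (norm (\<xi> j \<omega>))\<^sup>2)"
  using assms
proof (induction N)
  case 0
  then show ?case by (simp add: simple_process_def)
next
  case (Suc N)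
  have IH: "(norm (simple_process N p \<xi> s \<omega>))\<^sup>2 = (\<Sum>j<N. indicator {p j<..p (Suc j)} s * (norm (\<xi> j \<omega>))\<^sup>2)"
    by (rule Suc.IH) (use Suc.prems in simp)
  show ?case
  proof (cases "s \<in> {p N<..p (Suc N)}")
    case True
    have "indicator {p j<..p (Suc j)} s = (0 :: real)" if "j < N" for j
      using partition_mono[of N p "Suc j" N] Suc.prems that True by (simp add: indicator_def)
    then show ?thesis using True by (simp add: simple_process_def)
  next
    case False
    then show ?thesis using IH by (simp add: simple_process_def)
  qed
qed

lemma time_measure_interval:
  assumes "0 \<le> T" "0 \<le> p" "p \<le> q"
  shows "measure (time_measure T) {p<..q} = min T q - min T p"
proof -
  have "{0..T} \<inter> {p<..q} = {min T p<..min T q}" using assms by auto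
  then have "emeasure (time_measure T) {p<..q} = emeasure lborel {min T p<..min T q}"
    by (simp add: emeasure_density indicator_inter_arith[symmetric])
  also have "\<dots> = ennreal (min T q - min T p)" using assms by (intro emeasure_lborel_Ioc) auto
  finally show ?thesis by (rule measure_eq_emeasure_eq_ennreal[rotated]) (use assms in auto)
qed

lemma measure_time_measure: "0 \<le> T \<Longrightarrow> measure (time_measure T) UNIV = T"
  by (simp add: measure_def emeasure_density)

lemma integrable_time_measure_bounded:
  fixes f :: "real \<Rightarrow> real"
  assumes "f \<in> borel_measurable borel" "\<And>s. \<bar>f s\<bar> \<le> C"
  shows "integrable (time_measure T) f"
  using assms by (intro finite_measure.integrable_const_bound[OF finite_time_measure, where B = C]) auto

lemma simple_process_energy:
  fixes \<xi> :: "nat \<Rightarrow> 'a \<Rightarrow> real ^ 'd ^ 'e"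
  assumes p: "\<forall>j<N. p j \<le> p (Suc j)" "0 \<le> p 0" and T: "0 \<le> T"
  shows "integrable (time_measure T) (\<lambda>s. (norm (simple_process N p \<xi> s \<omega>))\<^sup>2)"
    and "(\<integral>s. (norm (simple_process N p \<xi> s \<omega>))\<^sup>2 \<partial>time_measure T) =
      (\<Sum>j<N. (min T (p (Suc j)) - min T (p j)) * (norm (\<xi> j \<omega>))\<^sup>2)"
proof -
  have i: "integrable (time_measure T) (\<lambda>s. indicator {p j<..p (Suc j)} s * (norm (\<xi> j \<omega>))\<^sup>2)" for j
    by (rule integrable_time_measure_bounded[where C = "(norm (\<xi> j \<omega>))\<^sup>2"]) (auto simp: indicator_def)
  have p0: "0 \<le> p j" if "j < N" for j
    using partition_mono[of N p 0 j] p that by simp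
  show "integrable (time_measure T) (\<lambda>s. (norm (simple_process N p \<xi> s \<omega>))\<^sup>2)"
    unfolding norm_simple_process_square[OF p(1)] by (rule Bochner_Integration.integrable_sum) (rule i)
  have "(\<integral>s. (norm (simple_process N p \<xi> s \<omega>))\<^sup>2 \<partial>time_measure T) =
      (\<Sum>j<N. \<integral>s. indicator {p j<..p (Suc j)} s * (norm (\<xi> j \<omega>))\<^sup>2 \<partial>time_measure T)"
    unfolding norm_simple_process_square[OF p(1)] by (rule Bochner_Integration.integral_sum) (rule i)
  also have "\<dots> = (\<Sum>j<N. (min T (p (Suc j)) - min T (p j)) * (norm (\<xi> j \<omega>))\<^sup>2)"
  proof (rule sum.cong[OF refl])
    fix j assume "j \<in> {..<N}"
    then have j: "j < N" by simp
    show "(\<integral>s. indicator {p j<..p (Suc j)} s * (norm (\<xi> j \<omega>))\<^sup>2 \<partial>time_measure T) =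
        (min T (p (Suc j)) - min T (p j)) * (norm (\<xi> j \<omega>))\<^sup>2"
      using time_measure_interval[OF T p0[OF j], of "p (Suc j)"] p(1) j by simp
  qed
  finally show "(\<integral>s. (norm (simple_process N p \<xi> s \<omega>))\<^sup>2 \<partial>time_measure T) =
      (\<Sum>j<N. (min T (p (Suc j)) - min T (p j)) * (norm (\<xi> j \<omega>))\<^sup>2)" .
qed

lemma simple_process_measurable:
  fixes \<xi> :: "nat \<Rightarrow> 'a \<Rightarrow> real ^ 'd ^ 'e"
  assumes "\<And>j. j < N \<Longrightarrow> \<xi> j \<in> borel_measurable M"
  shows "(\<lambda>x. simple_process N p \<xi> (snd x) (fst x)) \<in> borel_measurable (M \<Otimes>\<^sub>M borel)"
  unfolding simple_process_def
proof (rule borel_measurable_sum)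
  fix j assume "j \<in> {..<N}"
  then have [measurable]: "\<xi> j \<in> borel_measurable M" using assms by simp
  show "(\<lambda>x. indicator {p j<..p (Suc j)} (snd x) *\<^sub>R \<xi> j (fst x)) \<in> borel_measurable (M \<Otimes>\<^sub>M borel)"
    by measurable
qed

lemma norm_square_le_double:
  fixes a b :: "'b :: real_normed_vector"
  shows "(norm a)\<^sup>2 \<le> 2 * (norm (a - b))\<^sup>2 + 2 * (norm b)\<^sup>2"
proof -
  have "norm a \<le> norm (a - b) + norm b" using norm_triangle_ineq[of "a - b" b] by simp
  then have "(norm a)\<^sup>2 \<le> (norm (a - b) + norm b)\<^sup>2" by (intro power_mono) auto
  also have "\<dots> \<le> 2 * (norm (a - b))\<^sup>2 + 2 * (norm b)\<^sup>2"
    using sum_squares_bound[of "norm (a - b)" "norm b"] by (simp add: power2_sum)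
  finally show ?thesis .
qed

lemma sum_selected_entry_square_le:
  fixes v :: "real ^ 'd ^ 'e"
  assumes "inj c"
  shows "(\<Sum>d\<in>UNIV. if \<kappa> = c d then v $ e $ d else 0)\<^sup>2 \<le> (norm v)\<^sup>2"
proof (cases "\<kappa> \<in> range c")
  case True
  then obtain d0 where "\<kappa> = c d0" by blast
  then have "(\<Sum>d\<in>UNIV. if \<kappa> = c d then v $ e $ d else 0) = v $ e $ d0"
    using assms by (simp add: inj_eq)
  moreover have "\<bar>v $ e $ d0\<bar> \<le> norm v"
    using component_le_norm_cart[of "v $ e" d0] Finite_Cartesian_Product.norm_nth_le[of v e] by linarith
  ultimately show ?thesis by (metis abs_ge_zero power2_abs power_mono)
next
  case False
  then have "(\<Sum>d\<in>UNIV. if \<kappa> = c d then v $ e $ d else 0) = 0"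
    by (intro sum.neutral) auto
  then show ?thesis by simp
qed

context orthogonal_increments
begin

text \<open>
  The step integrands \<open>\<xi> m\<close> approximate \<open>\<Phi>\<close> only in
  probability and may have large second moments. They are switched off at the first step at
  which the accumulated energy would exceed \<open>R\<close>. The energy of a step is known
  at its left end point, so the result \<open>\<xi>'\<close> is again a step integrand; its
  distance to \<open>\<Psi>\<close> is bounded, hence tends to \<open>0\<close> in mean.
  Nothing is switched off where the squared distance from \<open>\<xi> m\<close> to
  \<open>\<Psi>\<close> is at most \<open>1\<close>, and the probability of the remaining
  event tends to \<open>0\<close>; so the integrals of \<open>\<xi>'\<close> have the same
  limit in probability as those of \<open>\<xi>\<close>, and by the isometry they form a
  Cauchy sequence in \<open>L\<^sup>2\<close>.
\<close>

lemma L2_ito_integral_of_has_ito_integral: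
  fixes V :: "real \<Rightarrow> 'a \<Rightarrow> real ^ 'd" and \<Phi> \<Psi> :: "real \<Rightarrow> 'a \<Rightarrow> real ^ 'd ^ 'e" and c :: "'d \<Rightarrow> 'k"
  assumes c: "inj c" "range c \<subseteq> K" "\<And>d t. W (c d) t = (\<lambda>\<omega>. V t \<omega> $ d)"
    and ito: "has_ito_integral M F V \<Phi> T Z" and T: "0 \<le> T"
    and \<Psi>: "(\<lambda>x. \<Psi> (snd x) (fst x)) \<in> borel_measurable (M \<Otimes>\<^sub>M borel)"
      "\<And>s \<omega>. \<omega> \<in> space M \<Longrightarrow> norm (\<Psi> s \<omega>) \<le> C"
    and ae: "AE \<omega> in M. \<forall>s\<in>{0..T}. \<Phi> s \<omega> = \<Psi> s \<omega>"
  shows "L2_ito_integral (\<lambda>\<kappa> s \<omega>. \<Sum>d\<in>UNIV. if \<kappa> = c d then \<Psi> s \<omega> $ e $ d else 0) T (\<lambda>\<omega>. Z \<omega> $ e)"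
proof -
  have Z [measurable]: "Z \<in> borel_measurable M" using ito unfolding has_ito_integral_def by blast
  define err where "err N p \<xi> \<omega> = (\<integral>\<^sup>+ s\<in>{0..T}. ennreal ((norm (simple_process N p \<xi> s \<omega> - \<Phi> s \<omega>))\<^sup>2) \<partial>lborel)"
    for N p and \<xi> :: "nat \<Rightarrow> 'a \<Rightarrow> real ^ 'd ^ 'e" and \<omega>
  from ito obtain N p \<xi> where simple: "\<And>m. simple_integrand M F (N m) (p m) (\<xi> m)"
    and err_meas: "\<And>m. err (N m) (p m) (\<xi> m) \<in> borel_measurable M"
    and err_lim: "\<And>\<epsilon>. \<epsilon> > 0 \<Longrightarrow> (\<lambda>m. prob {\<omega> \<in> space M. err (N m) (p m) (\<xi> m) \<omega> > ennreal \<epsilon>}) \<longlonglongrightarrow> 0"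
    and I_meas: "\<And>m. simple_integral (N m) (p m) (\<xi> m) V T \<in> borel_measurable M"
    and I_lim: "\<And>\<epsilon>. \<epsilon> > 0 \<Longrightarrow>
      (\<lambda>m. prob {\<omega> \<in> space M. dist (simple_integral (N m) (p m) (\<xi> m) V T \<omega>) (Z \<omega>) > \<epsilon>}) \<longlonglongrightarrow> 0"
    unfolding has_ito_integral_def Let_def err_def[abs_def] by blast
  have p0: "0 \<le> p m 0" and pS: "\<forall>j<N m. p m j \<le> p m (Suc j)"
    and \<xi>_F: "\<And>j. j < N m \<Longrightarrow> \<xi> m j \<in> borel_measurable (F (p m j))"
    and \<xi>_bdd: "\<And>j. j < N m \<Longrightarrow> bounded (\<xi> m j ` space M)" for m
    using simple[of m] unfolding simple_integrand_def by blast+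
  have p_nonneg: "0 \<le> p m j" if "j \<le> N m" for m j
    using partition_mono[OF pS[of m], of 0 j] p0[of m] that by simp
  have \<xi>_M: "\<xi> m j \<in> borel_measurable M" if "j < N m" for m j
    by (rule measurable_F_M[OF \<xi>_F[OF that] p_nonneg]) (use that in simp)
  have "0 \<le> C" using \<Psi>(2) not_empty by (metis all_not_in_conv norm_ge_zero order_trans)
  \<comment> \<open>The energy of a process whose squared distance to \<open>\<Psi>\<close> is at most
    \<open>1\<close> does not exceed \<open>R\<close>.\<close>
  define R where "R = 2 * C\<^sup>2 * T + 2"
  have "0 \<le> R" using T by (simp add: R_def)
  define a where "a m i \<omega> = (min T (p m (Suc i)) - min T (p m i)) * (norm (\<xi> m i \<omega>))\<^sup>2" for m i \<omega>
  have a_nonneg: "0 \<le> a m i \<omega>" if "i < N m" for m i \<omega>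
    using pS[of m] that by (auto simp: a_def intro!: mult_nonneg_nonneg)
  define \<xi>' where "\<xi>' m j \<omega> = (if (\<Sum>i\<le>j. a m i \<omega>) \<le> R then \<xi> m j \<omega> else 0)" for m j \<omega>
  have \<xi>'_F: "\<xi>' m j \<in> borel_measurable (F (p m j))" if j: "j < N m" for m j
  proof -
    have "(\<lambda>\<omega>. \<Sum>i\<le>j. a m i \<omega>) \<in> borel_measurable (F (p m j))"
    proof (rule borel_measurable_sum)
      fix i assume "i \<in> {..j}"
      then have i: "i \<le> j" "i < N m" using j by auto
      have "\<xi> m i \<in> borel_measurable (F (p m j))"
        by (rule measurable_F_mono[OF \<xi>_F[OF i(2)] p_nonneg partition_mono[OF pS i(1)]]) (use i j in simp_all)
      then show "a m i \<in> borel_measurable (F (p m j))"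
        unfolding a_def by (intro borel_measurable_times borel_measurable_const borel_measurable_power borel_measurable_norm_comp)
    qed
    then have "{\<omega> \<in> space (F (p m j)). (\<Sum>i\<le>j. a m i \<omega>) \<le> R} \<in> sets (F (p m j))"
      by (rule borel_measurable_le) (rule borel_measurable_const)
    then show ?thesis
      unfolding \<xi>'_def by (intro measurable_If \<xi>_F[OF j] borel_measurable_const)
  qed
  have \<xi>'_M: "\<xi>' m j \<in> borel_measurable M" if "j < N m" for m j
    by (rule measurable_F_M[OF \<xi>'_F[OF that] p_nonneg]) (use that in simp)
  define P where "P m s \<omega> = simple_process (N m) (p m) (\<xi>' m) s \<omega>" for m s \<omega>
  define P0 where "P0 m s \<omega> = simple_process (N m) (p m) (\<xi> m) s \<omega>" for m s \<omega>
  have P_meas: "(\<lambda>x. P m (snd x) (fst x)) \<in> borel_measurable (M \<Otimes>\<^sub>M borel)" for m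
    unfolding P_def by (rule simple_process_measurable) (rule \<xi>'_M)
  have P0_meas: "(\<lambda>x. P0 m (snd x) (fst x)) \<in> borel_measurable (M \<Otimes>\<^sub>M borel)" for m
    unfolding P0_def by (rule simple_process_measurable) (rule \<xi>_M)
  have P_int: "integrable (time_measure T) (\<lambda>s. (norm (P m s \<omega>))\<^sup>2)" for m \<omega>
    unfolding P_def by (rule simple_process_energy(1)[OF pS p0 T])
  have P0_int: "integrable (time_measure T) (\<lambda>s. (norm (P0 m s \<omega>))\<^sup>2)" for m \<omega>
    unfolding P0_def by (rule simple_process_energy(1)[OF pS p0 T])
  have P_energy: "(\<integral>s. (norm (P m s \<omega>))\<^sup>2 \<partial>time_measure T) \<le> R" for m \<omega>
  proof -
    have "(\<integral>s. (norm (P m s \<omega>))\<^sup>2 \<partial>time_measure T) =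
        (\<Sum>j<N m. (min T (p m (Suc j)) - min T (p m j)) * (norm (\<xi>' m j \<omega>))\<^sup>2)"
      unfolding P_def by (rule simple_process_energy(2)[OF pS p0 T])
    also have "\<dots> = (\<Sum>j<N m. if (\<Sum>i\<le>j. a m i \<omega>) \<le> R then a m j \<omega> else 0)"
      by (intro sum.cong refl) (simp add: \<xi>'_def a_def)
    also have "\<dots> \<le> R" using sum_until_exhausted_le[of "N m" "\<lambda>j. a m j \<omega>" R, OF a_nonneg \<open>0 \<le> R\<close>] by simp
    finally show ?thesis .
  qed
  have \<xi>'_eq: "\<xi>' m j \<omega> = \<xi> m j \<omega>" if "(\<integral>s. (norm (P0 m s \<omega>))\<^sup>2 \<partial>time_measure T) \<le> R" and "j < N m" for m j \<omega>
  proof -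
    have "(\<Sum>i\<le>j. a m i \<omega>) \<le> (\<Sum>i<N m. a m i \<omega>)"
      using that(2) a_nonneg by (intro sum_mono2) auto
    also have "\<dots> = (\<integral>s. (norm (P0 m s \<omega>))\<^sup>2 \<partial>time_measure T)"
      unfolding P0_def a_def by (rule simple_process_energy(2)[OF pS p0 T, symmetric])
    finally show ?thesis using that(1) by (simp add: \<xi>'_def)
  qed
  have section_meas: "(\<lambda>s. f s \<omega>) \<in> borel_measurable borel"
    if "(\<lambda>x. f (snd x) (fst x)) \<in> borel_measurable (M \<Otimes>\<^sub>M borel)" "\<omega> \<in> space M"
    for f :: "real \<Rightarrow> 'a \<Rightarrow> real ^ 'd ^ 'e" and \<omega>
    using measurable_Pair2[OF that] by simp
  have diff_int: "integrable (time_measure T) (\<lambda>s. (norm (f s \<omega> - \<Psi> s \<omega>))\<^sup>2)"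
    and diff_le: "(\<integral>s. (norm (f s \<omega> - \<Psi> s \<omega>))\<^sup>2 \<partial>time_measure T) \<le> 2 * (\<integral>s. (norm (f s \<omega>))\<^sup>2 \<partial>time_measure T) + 2 * C\<^sup>2 * T"
    and energy_le: "(\<integral>s. (norm (f s \<omega>))\<^sup>2 \<partial>time_measure T) \<le> 2 * (\<integral>s. (norm (f s \<omega> - \<Psi> s \<omega>))\<^sup>2 \<partial>time_measure T) + 2 * C\<^sup>2 * T"
    if f: "(\<lambda>x. f (snd x) (fst x)) \<in> borel_measurable (M \<Otimes>\<^sub>M borel)"
      "integrable (time_measure T) (\<lambda>s. (norm (f s \<omega>))\<^sup>2)" and \<omega>: "\<omega> \<in> space M"
    for f :: "real \<Rightarrow> 'a \<Rightarrow> real ^ 'd ^ 'e" and \<omega>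
  proof -
    have \<Psi>_sq: "(norm (\<Psi> s \<omega>))\<^sup>2 \<le> C\<^sup>2" for s using \<Psi>(2)[OF \<omega>] by (intro power_mono) auto
    have const: "integrable (time_measure T) (\<lambda>s. 2 * C\<^sup>2)"
      by (rule finite_measure.integrable_const[OF finite_time_measure])
    have const_eq: "(\<integral>s. 2 * C\<^sup>2 \<partial>time_measure T) = 2 * C\<^sup>2 * T"
      using measure_time_measure[OF T] by simp
    have bnd: "(norm (f s \<omega> - \<Psi> s \<omega>))\<^sup>2 \<le> 2 * (norm (f s \<omega>))\<^sup>2 + 2 * C\<^sup>2" for s
      using norm_square_le_double[of "f s \<omega> - \<Psi> s \<omega>" "- \<Psi> s \<omega>"] \<Psi>_sq[of s] by simp
    have two: "integrable (time_measure T) (\<lambda>s. 2 * (norm (f s \<omega>))\<^sup>2)" using f(2) by simp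
    have sum_int: "integrable (time_measure T) (\<lambda>s. 2 * (norm (f s \<omega>))\<^sup>2 + 2 * C\<^sup>2)"
      by (rule Bochner_Integration.integrable_add[OF two const])
    show d: "integrable (time_measure T) (\<lambda>s. (norm (f s \<omega> - \<Psi> s \<omega>))\<^sup>2)"
    proof (rule Bochner_Integration.integrable_bound[OF sum_int])
      have "(\<lambda>s. (norm (f s \<omega> - \<Psi> s \<omega>))\<^sup>2) \<in> borel_measurable borel"
        by (intro borel_measurable_power borel_measurable_norm_comp borel_measurable_diff
            section_meas[OF f(1) \<omega>] section_meas[OF \<Psi>(1) \<omega>])
      then show "(\<lambda>s. (norm (f s \<omega> - \<Psi> s \<omega>))\<^sup>2) \<in> borel_measurable (time_measure T)" by simp
      show "AE s in time_measure T. norm ((norm (f s \<omega> - \<Psi> s \<omega>))\<^sup>2) \<le> norm (2 * (norm (f s \<omega>))\<^sup>2 + 2 * C\<^sup>2)"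
        using bnd by (intro AE_I2) simp
    qed
    have "(\<integral>s. (norm (f s \<omega> - \<Psi> s \<omega>))\<^sup>2 \<partial>time_measure T) \<le> (\<integral>s. 2 * (norm (f s \<omega>))\<^sup>2 + 2 * C\<^sup>2 \<partial>time_measure T)"
      by (rule integral_mono[OF d sum_int]) (rule bnd)
    also have "\<dots> = 2 * (\<integral>s. (norm (f s \<omega>))\<^sup>2 \<partial>time_measure T) + 2 * C\<^sup>2 * T"
      unfolding Bochner_Integration.integral_add[OF two const] const_eq by simp
    finally show "(\<integral>s. (norm (f s \<omega> - \<Psi> s \<omega>))\<^sup>2 \<partial>time_measure T) \<le> 2 * (\<integral>s. (norm (f s \<omega>))\<^sup>2 \<partial>time_measure T) + 2 * C\<^sup>2 * T" .
    have two': "integrable (time_measure T) (\<lambda>s. 2 * (norm (f s \<omega> - \<Psi> s \<omega>))\<^sup>2)" using d by simp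
    have "(\<integral>s. (norm (f s \<omega>))\<^sup>2 \<partial>time_measure T) \<le> (\<integral>s. 2 * (norm (f s \<omega> - \<Psi> s \<omega>))\<^sup>2 + 2 * C\<^sup>2 \<partial>time_measure T)"
    proof (rule integral_mono[OF f(2) Bochner_Integration.integrable_add[OF two' const]])
      fix s
      show "(norm (f s \<omega>))\<^sup>2 \<le> 2 * (norm (f s \<omega> - \<Psi> s \<omega>))\<^sup>2 + 2 * C\<^sup>2"
        using norm_square_le_double[of "f s \<omega>" "\<Psi> s \<omega>"] \<Psi>_sq[of s] by linarith
    qed
    also have "\<dots> = 2 * (\<integral>s. (norm (f s \<omega> - \<Psi> s \<omega>))\<^sup>2 \<partial>time_measure T) + 2 * C\<^sup>2 * T"
      unfolding Bochner_Integration.integral_add[OF two' const] const_eq by simp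
    finally show "(\<integral>s. (norm (f s \<omega>))\<^sup>2 \<partial>time_measure T) \<le> 2 * (\<integral>s. (norm (f s \<omega> - \<Psi> s \<omega>))\<^sup>2 \<partial>time_measure T) + 2 * C\<^sup>2 * T" .
  qed
  \<comment> \<open>The squared distances to \<open>\<Psi>\<close> before and after switching off.\<close>
  define e0 where "e0 m \<omega> = (\<integral>s. (norm (P0 m s \<omega> - \<Psi> s \<omega>))\<^sup>2 \<partial>time_measure T)" for m \<omega>
  define e1 where "e1 m \<omega> = (\<integral>s. (norm (P m s \<omega> - \<Psi> s \<omega>))\<^sup>2 \<partial>time_measure T)" for m \<omega>
  have sq_meas: "(\<lambda>x. (norm (P m (snd x) (fst x) - \<Psi> (snd x) (fst x)))\<^sup>2) \<in> borel_measurable (M \<Otimes>\<^sub>M borel)" for m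
    by (intro borel_measurable_power borel_measurable_norm_comp borel_measurable_diff P_meas \<Psi>(1))
  have e1_meas: "e1 m \<in> borel_measurable M" for m
    unfolding e1_def
  proof (rule sigma_finite_measure.borel_measurable_lebesgue_integral[OF sigma_finite_time_measure])
    show "(\<lambda>(\<omega>, s). (norm (P m s \<omega> - \<Psi> s \<omega>))\<^sup>2) \<in> borel_measurable (Q T)"
      using sq_meas[of m] unfolding borel_measurable_Q case_prod_unfold .
  qed
  have e1_bounds: "0 \<le> e1 m \<omega> \<and> e1 m \<omega> \<le> 2 * R + 2 * C\<^sup>2 * T" if "\<omega> \<in> space M" for m \<omega>
    using diff_le[OF P_meas[of m] P_int[of m] that] P_energy[of m \<omega>] by (simp add: e1_def)
  have good: "\<xi>' m j \<omega> = \<xi> m j \<omega>" if "e0 m \<omega> \<le> 1" "\<omega> \<in> space M" "j < N m" for m j \<omega>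
    using energy_le[OF P0_meas[of m] P0_int[of m] that(2)] that(1)
    by (intro \<xi>'_eq[OF _ that(3)]) (simp add: e0_def R_def)
  have err_eq: "AE \<omega> in M. err (N m) (p m) (\<xi> m) \<omega> = ennreal (e0 m \<omega>)" for m
  proof (rule AE_mp[OF ae], intro AE_I2 impI)
    fix \<omega> assume \<omega>: "\<omega> \<in> space M" and eq: "\<forall>s\<in>{0..T}. \<Phi> s \<omega> = \<Psi> s \<omega>"
    have m: "(\<lambda>s. ennreal ((norm (P0 m s \<omega> - \<Psi> s \<omega>))\<^sup>2)) \<in> borel_measurable lborel"
      using section_meas[OF P0_meas[of m] \<omega>] section_meas[OF \<Psi>(1) \<omega>] by measurable
    have "err (N m) (p m) (\<xi> m) \<omega> = (\<integral>\<^sup>+ s. indicator {0..T} s * ennreal ((norm (P0 m s \<omega> - \<Psi> s \<omega>))\<^sup>2) \<partial>lborel)"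
      unfolding err_def P0_def by (rule nn_integral_cong) (use eq in \<open>auto simp: indicator_def\<close>)
    also have "\<dots> = (\<integral>\<^sup>+ s. ennreal ((norm (P0 m s \<omega> - \<Psi> s \<omega>))\<^sup>2) \<partial>time_measure T)"
      by (rule nn_integral_density[symmetric, OF _ m]) simp
    also have "\<dots> = ennreal (e0 m \<omega>)"
      unfolding e0_def by (rule nn_integral_eq_integral[OF diff_int[OF P0_meas P0_int \<omega>]]) simp
    finally show "err (N m) (p m) (\<xi> m) \<omega> = ennreal (e0 m \<omega>)" .
  qed
  define Bad where "Bad m \<epsilon> = {\<omega> \<in> space M. err (N m) (p m) (\<xi> m) \<omega> > ennreal \<epsilon>}" for m \<epsilon>
  have Bad_sets: "Bad m \<epsilon> \<in> sets M" for m \<epsilon>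
    unfolding Bad_def by (rule borel_measurable_less[OF borel_measurable_const err_meas])
  have e1_lim: "(\<lambda>m. expectation (e1 m)) \<longlonglongrightarrow> 0"
  proof (rule bounded_in_probability_imp_expectation_tendsto_0[OF e1_meas e1_bounds])
    fix \<epsilon> :: real assume "0 < \<epsilon>"
    have le: "prob {\<omega> \<in> space M. e1 m \<omega> > \<epsilon>} \<le> prob (Bad m \<epsilon>) + prob (Bad m 1)" for m
    proof -
      have "prob {\<omega> \<in> space M. e1 m \<omega> > \<epsilon>} \<le> prob (Bad m \<epsilon> \<union> Bad m 1)"
      proof (rule finite_measure_mono_AE)
        show "AE \<omega> in M. \<omega> \<in> {\<omega> \<in> space M. e1 m \<omega> > \<epsilon>} \<longrightarrow> \<omega> \<in> Bad m \<epsilon> \<union> Bad m 1"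
        proof (rule AE_mp[OF err_eq[of m]], intro AE_I2 impI)
          fix \<omega> assume \<omega>: "\<omega> \<in> space M" and eq: "err (N m) (p m) (\<xi> m) \<omega> = ennreal (e0 m \<omega>)"
            and gt: "\<omega> \<in> {\<omega> \<in> space M. e1 m \<omega> > \<epsilon>}"
          show "\<omega> \<in> Bad m \<epsilon> \<union> Bad m 1"
          proof (cases "e0 m \<omega> \<le> 1")
            case True
            have "P m s \<omega> = P0 m s \<omega>" for s
              unfolding P_def P0_def simple_process_def
              by (intro sum.cong refl) (use good[OF True \<omega>] in simp)
            then have "e1 m \<omega> = e0 m \<omega>" by (simp add: e0_def e1_def)
            then have "ennreal \<epsilon> < ennreal (e0 m \<omega>)" using gt \<open>0 < \<epsilon>\<close> by (simp add: ennreal_less_iff)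
            then show ?thesis using \<omega> eq by (simp add: Bad_def)
          next
            case False
            then have "ennreal 1 < ennreal (e0 m \<omega>)" by (simp add: ennreal_less_iff)
            then show ?thesis using \<omega> eq by (simp add: Bad_def)
          qed
        qed
      qed (intro sets.Un Bad_sets)
      also have "\<dots> \<le> prob (Bad m \<epsilon>) + prob (Bad m 1)"
        by (rule measure_Un_le[OF Bad_sets Bad_sets])
      finally show ?thesis .
    qed
    have "(\<lambda>m. prob (Bad m \<epsilon>) + prob (Bad m 1)) \<longlonglongrightarrow> 0 + 0"
      unfolding Bad_def by (intro tendsto_add err_lim \<open>0 < \<epsilon>\<close> zero_less_one)
    then show "(\<lambda>m. prob {\<omega> \<in> space M. e1 m \<omega> > \<epsilon>}) \<longlonglongrightarrow> 0"
      by (rule prob_null_comparison[OF le])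
  qed
  let ?\<Phi> = "\<lambda>\<kappa> s \<omega>. \<Sum>d\<in>UNIV. if \<kappa> = c d then \<Psi> s \<omega> $ e $ d else 0"
  define S where "S m \<kappa> s \<omega> = (\<Sum>d\<in>UNIV. if \<kappa> = c d then P m s \<omega> $ e $ d else 0)" for m \<kappa> s \<omega>
  define J where "J m t \<omega> = simple_integral (N m) (p m) (\<xi>' m) V t \<omega> $ e" for m t \<omega>
  have elem: "elementary (S m) (J m)" for m
  proof -
    let ?S = "\<lambda>x \<kappa> s \<omega>. if \<kappa> = c (snd x) then indicator {p m (fst x)<..p m (Suc (fst x))} s * (\<xi>' m (fst x) \<omega> $ e $ snd x) else 0"
    let ?J = "\<lambda>x t \<omega>. (\<xi>' m (fst x) \<omega> $ e $ snd x) *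
      (W (c (snd x)) (min t (p m (Suc (fst x)))) \<omega> - W (c (snd x)) (min t (p m (fst x))) \<omega>)"
    have "elementary (\<lambda>\<kappa> s \<omega>. \<Sum>x\<in>{..<N m} \<times> UNIV. ?S x \<kappa> s \<omega>) (\<lambda>t \<omega>. \<Sum>x\<in>{..<N m} \<times> UNIV. ?J x t \<omega>)"
    proof (rule elementary_sum)
      fix x :: "nat \<times> 'd" assume "x \<in> {..<N m} \<times> UNIV"
      then have j: "fst x < N m" by auto
      obtain D where D: "\<And>\<omega>. \<omega> \<in> space M \<Longrightarrow> norm (\<xi> m (fst x) \<omega>) \<le> D"
        using \<xi>_bdd[OF j] unfolding bounded_iff by blast
      show "elementary (?S x) (?J x)"
      proof (rule elementary.single)
        show "c (snd x) \<in> K" using c(2) by blast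
        show "0 \<le> p m (fst x)" using p_nonneg[of "fst x" m] j by simp
        show "p m (fst x) \<le> p m (Suc (fst x))" using pS[of m] j by blast
        show "(\<lambda>\<omega>. \<xi>' m (fst x) \<omega> $ e $ snd x) \<in> borel_measurable (F (p m (fst x)))"
        proof -
          have "(\<lambda>v :: real ^ 'd ^ 'e. v $ e) \<in> borel_measurable borel"
            by (intro borel_measurable_continuous_onI linear_continuous_on bounded_linear_vec_nth)
          from measurable_compose[OF \<xi>'_F[OF j] this] show ?thesis by (rule borel_measurable_vec_nth)
        qed
        fix \<omega> assume \<omega>: "\<omega> \<in> space M"
        have "\<bar>\<xi>' m (fst x) \<omega> $ e $ snd x\<bar> \<le> norm (\<xi>' m (fst x) \<omega>)"
          using component_le_norm_cart[of "\<xi>' m (fst x) \<omega> $ e" "snd x"] Finite_Cartesian_Product.norm_nth_le[of "\<xi>' m (fst x) \<omega>" e] by linarith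
        also have "\<dots> \<le> norm (\<xi> m (fst x) \<omega>)" by (simp add: \<xi>'_def)
        also have "\<dots> \<le> D" by (rule D[OF \<omega>])
        finally show "\<bar>\<xi>' m (fst x) \<omega> $ e $ snd x\<bar> \<le> D" .
      qed
    qed simp
    moreover have "(\<Sum>x\<in>{..<N m} \<times> UNIV. ?S x \<kappa> s \<omega>) = S m \<kappa> s \<omega>" for \<kappa> s \<omega>
    proof -
      have "(\<Sum>x\<in>{..<N m} \<times> UNIV. ?S x \<kappa> s \<omega>) = (\<Sum>j<N m. \<Sum>d\<in>UNIV. ?S (j, d) \<kappa> s \<omega>)"
        by (simp only: sum.cartesian_product case_prod_unfold prod.collapse)
      also have "\<dots> = (\<Sum>d\<in>UNIV. \<Sum>j<N m. ?S (j, d) \<kappa> s \<omega>)" by (rule sum.swap)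
      also have "\<dots> = S m \<kappa> s \<omega>"
        unfolding S_def P_def simple_process_def by (intro sum.cong refl) simp
      finally show ?thesis .
    qed
    moreover have "(\<Sum>x\<in>{..<N m} \<times> UNIV. ?J x t \<omega>) = J m t \<omega>" for t \<omega>
    proof -
      have "(\<Sum>x\<in>{..<N m} \<times> UNIV. ?J x t \<omega>) = (\<Sum>j<N m. \<Sum>d\<in>UNIV. ?J (j, d) t \<omega>)"
        by (simp only: sum.cartesian_product case_prod_unfold prod.collapse)
      also have "\<dots> = J m t \<omega>"
        unfolding J_def simple_integral_def sum_component matrix_vector_mult_def c(3) by simp
      finally show ?thesis .
    qed
    ultimately show ?thesis by simp
  qed
  have S_diff: "path (S m) \<kappa> x - path ?\<Phi> \<kappa> x =
      (\<Sum>d\<in>UNIV. if \<kappa> = c d then (P m (snd x) (fst x) - \<Psi> (snd x) (fst x)) $ e $ d else 0)" for m \<kappa> x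
    unfolding path_def S_def sum_subtractf[symmetric] by (intro sum.cong refl) simp
  have \<Psi>_entry: "(\<lambda>x. \<Psi> (snd x) (fst x) $ e $ d) \<in> borel_measurable (M \<Otimes>\<^sub>M borel)" for d
  proof -
    have "(\<lambda>v :: real ^ 'd ^ 'e. v $ e) \<in> borel_measurable borel"
      by (intro borel_measurable_continuous_onI linear_continuous_on bounded_linear_vec_nth)
    from measurable_compose[OF \<Psi>(1) this] show ?thesis by (rule borel_measurable_vec_nth)
  qed
  have \<Phi>_meas: "path ?\<Phi> \<kappa> \<in> borel_measurable (M \<Otimes>\<^sub>M borel)" for \<kappa>
  proof -
    have "(\<lambda>x. if \<kappa> = c d then \<Psi> (snd x) (fst x) $ e $ d else 0) \<in> borel_measurable (M \<Otimes>\<^sub>M borel)" for d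
      using \<Psi>_entry[of d] by (cases "\<kappa> = c d") simp_all
    then have "(\<lambda>x. \<Sum>d\<in>UNIV. if \<kappa> = c d then \<Psi> (snd x) (fst x) $ e $ d else 0) \<in> borel_measurable (M \<Otimes>\<^sub>M borel)"
      by (intro borel_measurable_sum)
    then show ?thesis by (simp only: path_def[abs_def])
  qed
  have \<Phi>_sq: "(path ?\<Phi> \<kappa> (\<omega>, s))\<^sup>2 \<le> C\<^sup>2" if "\<omega> \<in> space M" for \<kappa> \<omega> s
  proof -
    have "(path ?\<Phi> \<kappa> (\<omega>, s))\<^sup>2 \<le> (norm (\<Psi> s \<omega>))\<^sup>2"
      using sum_selected_entry_square_le[OF c(1), of \<kappa> "\<Psi> s \<omega>" e] by (simp add: path_def)
    also have "\<dots> \<le> C\<^sup>2" by (rule power_mono[OF \<Psi>(2)[OF that] norm_ge_zero])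
    finally show ?thesis .
  qed
  have \<Phi>_L2: "L2_integrand ?\<Phi> T"
    unfolding L2_integrand_def
  proof (intro ballI conjI \<Phi>_meas)
    fix \<kappa> assume "\<kappa> \<in> K"
    show "integrable (Q T) (\<lambda>x. (path ?\<Phi> \<kappa> x)\<^sup>2)"
      by (rule integrable_Q_bounded[where C = "C\<^sup>2"])
        (rule borel_measurable_power[OF \<Phi>_meas], use \<Phi>_sq in simp)
  qed
  have S_lim: "(\<lambda>m. \<integral>x. (path (S m) \<kappa> x - path ?\<Phi> \<kappa> x)\<^sup>2 \<partial>Q T) \<longlonglongrightarrow> 0" if \<kappa>: "\<kappa> \<in> K" for \<kappa>
  proof -
    have le: "(\<integral>x. (path (S m) \<kappa> x - path ?\<Phi> \<kappa> x)\<^sup>2 \<partial>Q T) \<le> expectation (e1 m)" for m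
    proof -
      note S1 = L2_integrandD[OF elementary_L2_integrand[OF elem] \<kappa>] and p1 = L2_integrandD[OF \<Phi>_L2 \<kappa>]
      have int1: "integrable (Q T) (\<lambda>x. (path (S m) \<kappa> x - path ?\<Phi> \<kappa> x)\<^sup>2)"
        by (intro integrable_square_add(2) S1(2,3) p1(2,3))
      have nn: "(\<integral>\<^sup>+x. ennreal ((norm (P m (snd x) (fst x) - \<Psi> (snd x) (fst x)))\<^sup>2) \<partial>Q T) = ennreal (expectation (e1 m))"
      proof -
        have "(\<integral>\<^sup>+x. ennreal ((norm (P m (snd x) (fst x) - \<Psi> (snd x) (fst x)))\<^sup>2) \<partial>Q T) =
            (\<integral>\<^sup>+\<omega>. (\<integral>\<^sup>+s. ennreal ((norm (P m s \<omega> - \<Psi> s \<omega>))\<^sup>2) \<partial>time_measure T) \<partial>M)"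
          using sigma_finite_measure.nn_integral_fst[OF sigma_finite_time_measure,
              of "\<lambda>x. ennreal ((norm (P m (snd x) (fst x) - \<Psi> (snd x) (fst x)))\<^sup>2)" M T]
            measurable_compose[OF sq_meas[of m] measurable_ennreal] by simp
        also have "\<dots> = (\<integral>\<^sup>+\<omega>. ennreal (e1 m \<omega>) \<partial>M)"
        proof (rule nn_integral_cong)
          fix \<omega> assume \<omega>: "\<omega> \<in> space M"
          show "(\<integral>\<^sup>+s. ennreal ((norm (P m s \<omega> - \<Psi> s \<omega>))\<^sup>2) \<partial>time_measure T) = ennreal (e1 m \<omega>)"
            unfolding e1_def by (rule nn_integral_eq_integral[OF diff_int[OF P_meas P_int \<omega>]]) simp
        qed
        also have "\<dots> = ennreal (expectation (e1 m))"
        proof (rule nn_integral_eq_integral)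
          show "integrable M (e1 m)"
            by (rule integrable_const_bound[where B = "2 * R + 2 * C\<^sup>2 * T"])
              (use e1_bounds in \<open>auto intro!: AE_I2\<close>, rule e1_meas)
          show "AE \<omega> in M. 0 \<le> e1 m \<omega>" using e1_bounds by (intro AE_I2) blast
        qed
        finally show ?thesis .
      qed
      have "ennreal (\<integral>x. (path (S m) \<kappa> x - path ?\<Phi> \<kappa> x)\<^sup>2 \<partial>Q T) =
          (\<integral>\<^sup>+x. ennreal ((path (S m) \<kappa> x - path ?\<Phi> \<kappa> x)\<^sup>2) \<partial>Q T)"
        by (rule nn_integral_eq_integral[OF int1, symmetric]) simp
      also have "\<dots> \<le> (\<integral>\<^sup>+x. ennreal ((norm (P m (snd x) (fst x) - \<Psi> (snd x) (fst x)))\<^sup>2) \<partial>Q T)"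
        unfolding S_diff by (intro nn_integral_mono ennreal_leI sum_selected_entry_square_le c(1))
      also have "\<dots> = ennreal (expectation (e1 m))" by (rule nn)
      finally have "ennreal (\<integral>x. (path (S m) \<kappa> x - path ?\<Phi> \<kappa> x)\<^sup>2 \<partial>Q T) \<le> ennreal (expectation (e1 m))" .
      moreover have "0 \<le> expectation (e1 m)" by (rule integral_nonneg_AE) (use e1_bounds in auto)
      ultimately show ?thesis by (subst (asm) ennreal_le_iff)
    qed
    show ?thesis
      by (rule Lim_null_comparison[OF always_eventually e1_lim], rule allI) (simp only: real_norm_def abs_of_nonneg[OF Bochner_Integration.integral_nonneg] zero_le_power2 le)
  qed
  define g where "g m = (\<Sum>\<kappa>\<in>K. \<integral>x. (path (S m) \<kappa> x - path ?\<Phi> \<kappa> x)\<^sup>2 \<partial>Q T)" for m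
  have "g \<longlonglongrightarrow> (\<Sum>\<kappa>\<in>K. 0)" unfolding g_def by (rule tendsto_sum) (rule S_lim)
  then have g_lim: "g \<longlonglongrightarrow> 0" by simp
  have J_le: "expectation (\<lambda>\<omega>. (J m T \<omega> - J k T \<omega>)\<^sup>2) \<le> 2 * g m + 2 * g k" for m k
  proof -
    have "(\<integral>x. (path (S m) \<kappa> x - path (S k) \<kappa> x)\<^sup>2 \<partial>Q T) \<le>
        2 * (\<integral>x. (path (S m) \<kappa> x - path ?\<Phi> \<kappa> x)\<^sup>2 \<partial>Q T) + 2 * (\<integral>x. (path (S k) \<kappa> x - path ?\<Phi> \<kappa> x)\<^sup>2 \<partial>Q T)"
      if \<kappa>: "\<kappa> \<in> K" for \<kappa>
    proof -
      note S1 = L2_integrandD[OF elementary_L2_integrand[OF elem] \<kappa>] and p1 = L2_integrandD[OF \<Phi>_L2 \<kappa>]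
      have int: "integrable (Q T) (\<lambda>x. 2 * (path (S m) \<kappa> x - path ?\<Phi> \<kappa> x)\<^sup>2)" for m
        by (intro integrable_mult_right integrable_square_add(2) S1(2,3) p1(2,3))
      have "(\<integral>x. (path (S m) \<kappa> x - path (S k) \<kappa> x)\<^sup>2 \<partial>Q T) \<le>
          (\<integral>x. 2 * (path (S m) \<kappa> x - path ?\<Phi> \<kappa> x)\<^sup>2 + 2 * (path (S k) \<kappa> x - path ?\<Phi> \<kappa> x)\<^sup>2 \<partial>Q T)"
      proof (rule integral_mono[OF _ Bochner_Integration.integrable_add[OF int int]])
        show "integrable (Q T) (\<lambda>x. (path (S m) \<kappa> x - path (S k) \<kappa> x)\<^sup>2)"
          by (intro integrable_square_add(2) S1(2,3))
        show "(path (S m) \<kappa> x - path (S k) \<kappa> x)\<^sup>2 \<le>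
            2 * (path (S m) \<kappa> x - path ?\<Phi> \<kappa> x)\<^sup>2 + 2 * (path (S k) \<kappa> x - path ?\<Phi> \<kappa> x)\<^sup>2" for x
          using norm_square_le_double[of "path (S m) \<kappa> x - path (S k) \<kappa> x" "path ?\<Phi> \<kappa> x - path (S k) \<kappa> x"]
          by (simp add: power2_commute)
      qed
      also have "\<dots> = 2 * (\<integral>x. (path (S m) \<kappa> x - path ?\<Phi> \<kappa> x)\<^sup>2 \<partial>Q T) + 2 * (\<integral>x. (path (S k) \<kappa> x - path ?\<Phi> \<kappa> x)\<^sup>2 \<partial>Q T)"
        unfolding Bochner_Integration.integral_add[OF int int] by (simp only: integral_mult_right_zero)
      finally show ?thesis .
    qed
    then show ?thesis
      unfolding elementary_L2_isometry_diff[OF elem elem T] g_def sum_distrib_left sum.distrib[symmetric]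
      by (rule sum_mono)
  qed
  note J_L2 = elementary_integral_L2[OF elem T]
  have Ze: "(\<lambda>\<omega>. Z \<omega> $ e) \<in> borel_measurable M" by (rule borel_measurable_vec_nth[OF Z])
  have cauchy: "\<exists>n. \<forall>m\<ge>n. \<forall>k\<ge>n. expectation (\<lambda>\<omega>. (J m T \<omega> - J k T \<omega>)\<^sup>2) \<le> \<epsilon>" if "0 < \<epsilon>" for \<epsilon>
  proof -
    have "\<forall>\<^sub>F m in sequentially. g m < \<epsilon> / 4" by (rule order_tendstoD(2)[OF g_lim]) (use that in simp)
    then obtain n where n: "\<And>m. n \<le> m \<Longrightarrow> g m < \<epsilon> / 4" unfolding eventually_sequentially by blast
    show ?thesis
    proof (intro exI[of _ n] allI impI)
      fix m k assume "n \<le> m" "n \<le> k"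
      then show "expectation (\<lambda>\<omega>. (J m T \<omega> - J k T \<omega>)\<^sup>2) \<le> \<epsilon>"
        using J_le[of m k] n[of m] n[of k] by linarith
    qed
  qed
  have J_lim: "(\<lambda>m. prob {\<omega> \<in> space M. \<bar>J m T \<omega> - Z \<omega> $ e\<bar> > \<epsilon>}) \<longlonglongrightarrow> 0" if "0 < \<epsilon>" for \<epsilon>
  proof -
    define Far where "Far m = {\<omega> \<in> space M. dist (simple_integral (N m) (p m) (\<xi> m) V T \<omega>) (Z \<omega>) > \<epsilon>}" for m
    have Far_sets: "Far m \<in> sets M" for m
      unfolding Far_def by (rule borel_measurable_less[OF borel_measurable_const borel_measurable_dist[OF I_meas Z]])
    have le: "prob {\<omega> \<in> space M. \<bar>J m T \<omega> - Z \<omega> $ e\<bar> > \<epsilon>} \<le> prob (Far m) + prob (Bad m 1)" for m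
    proof -
      have "prob {\<omega> \<in> space M. \<bar>J m T \<omega> - Z \<omega> $ e\<bar> > \<epsilon>} \<le> prob (Far m \<union> Bad m 1)"
      proof (rule finite_measure_mono_AE)
        show "AE \<omega> in M. \<omega> \<in> {\<omega> \<in> space M. \<bar>J m T \<omega> - Z \<omega> $ e\<bar> > \<epsilon>} \<longrightarrow> \<omega> \<in> Far m \<union> Bad m 1"
        proof (rule AE_mp[OF err_eq[of m]], intro AE_I2 impI)
          fix \<omega> assume \<omega>: "\<omega> \<in> space M" and eq: "err (N m) (p m) (\<xi> m) \<omega> = ennreal (e0 m \<omega>)"
            and gt: "\<omega> \<in> {\<omega> \<in> space M. \<bar>J m T \<omega> - Z \<omega> $ e\<bar> > \<epsilon>}"
          show "\<omega> \<in> Far m \<union> Bad m 1"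
          proof (cases "e0 m \<omega> \<le> 1")
            case True
            have "simple_integral (N m) (p m) (\<xi>' m) V T \<omega> = simple_integral (N m) (p m) (\<xi> m) V T \<omega>"
              unfolding simple_integral_def by (intro sum.cong refl) (use good[OF True \<omega>] in simp)
            then have "\<bar>J m T \<omega> - Z \<omega> $ e\<bar> \<le> dist (simple_integral (N m) (p m) (\<xi> m) V T \<omega>) (Z \<omega>)"
              using component_le_norm_cart[of "simple_integral (N m) (p m) (\<xi> m) V T \<omega> - Z \<omega>" e]
              by (simp add: J_def dist_norm)
            then show ?thesis using gt \<omega> by (simp add: Far_def)
          next
            case False
            then have "ennreal 1 < ennreal (e0 m \<omega>)" by (simp add: ennreal_less_iff)
            then show ?thesis using \<omega> eq by (simp add: Bad_def)
          qed
        qed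
      qed (intro sets.Un Bad_sets Far_sets)
      also have "\<dots> \<le> prob (Far m) + prob (Bad m 1)"
        by (rule measure_Un_le[OF Far_sets Bad_sets])
      finally show ?thesis .
    qed
    have "(\<lambda>m. prob (Far m) + prob (Bad m 1)) \<longlonglongrightarrow> 0 + 0"
      unfolding Bad_def Far_def by (intro tendsto_add err_lim I_lim that zero_less_one)
    then show ?thesis
      by (rule prob_null_comparison[OF le])
  qed
  have Z_sq: "integrable M (\<lambda>\<omega>. (Z \<omega> $ e)\<^sup>2)"
    by (rule L2_Cauchy_in_probability(1)[OF conjunct1[OF J_L2] Ze conjunct2[OF J_L2] cauchy J_lim])
  have Z_lim: "(\<lambda>m. expectation (\<lambda>\<omega>. (J m T \<omega> - Z \<omega> $ e)\<^sup>2)) \<longlonglongrightarrow> 0"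
    by (rule L2_Cauchy_in_probability(2)[OF conjunct1[OF J_L2] Ze conjunct2[OF J_L2] cauchy J_lim])
  show ?thesis by (rule L2_ito_integralI[OF Ze Z_sq \<Phi>_L2 elem S_lim Z_lim])
qed

end

section \<open>Second moments of a linear equation\<close>

lemma AE_time_measure: "AE s in time_measure T. s \<in> {0..T}"
  by (subst AE_density) (auto simp: indicator_def)

lemma integral_time_measure_eq:
  fixes f :: "real \<Rightarrow> real"
  assumes "f \<in> borel_measurable borel"
  shows "(\<integral>s. f s \<partial>time_measure T) = (\<integral>s. indicator {0..T} s *\<^sub>R f s \<partial>lborel)"
proof -
  have "(\<integral>s. f s \<partial>density lborel (\<lambda>s. ennreal (indicator {0..T} s))) = (\<integral>s. indicator {0..T} s *\<^sub>R f s \<partial>lborel)"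
    by (rule integral_density) (use assms in auto)
  then show ?thesis by (simp only: ennreal_indicator)
qed

lemma integral_time_measure_cong:
  fixes f g :: "real \<Rightarrow> real"
  assumes "f \<in> borel_measurable borel" "g \<in> borel_measurable borel" "\<And>s. 0 \<le> s \<Longrightarrow> s \<le> T \<Longrightarrow> f s = g s"
  shows "(\<integral>s. f s \<partial>time_measure T) = (\<integral>s. g s \<partial>time_measure T)"
proof (rule Bochner_Integration.integral_cong_AE)
  show "AE s in time_measure T. f s = g s"
    by (rule AE_mp[OF AE_time_measure]) (use assms(3) in auto)
qed (use assms in auto)

lemma integral_time_measure_eq_integral:
  fixes f :: "real \<Rightarrow> real"
  assumes "f \<in> borel_measurable borel" "continuous_on {0..T} f"
  shows "(\<integral>s. f s \<partial>time_measure T) = integral {0..T} f"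
  unfolding integral_time_measure_eq[OF assms(1)]
  using set_borel_integral_eq_integral(2)[OF borel_integrable_atLeastAtMost'[OF assms(2)]]
  by (simp only: set_lebesgue_integral_def)

lemma time_integral_measurable:
  fixes f :: "'a \<times> real \<Rightarrow> real"
  assumes [measurable]: "f \<in> borel_measurable (M \<Otimes>\<^sub>M borel)" "T \<in> borel_measurable M"
  shows "(\<lambda>x. \<integral>s. f (x, s) \<partial>time_measure (T x)) \<in> borel_measurable M"
proof -
  have "(\<lambda>(x, s). (if 0 \<le> s \<and> s \<le> T x then f (x, s) else 0)) \<in> borel_measurable (M \<Otimes>\<^sub>M lborel)"
    by measurable
  then have "(\<lambda>x. \<integral>s. (if 0 \<le> s \<and> s \<le> T x then f (x, s) else 0) \<partial>lborel) \<in> borel_measurable M"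
    by (rule sigma_finite_measure.borel_measurable_lebesgue_integral[OF sigma_finite_lborel])
  moreover have "(\<integral>s. f (x, s) \<partial>time_measure (T x)) = (\<integral>s. (if 0 \<le> s \<and> s \<le> T x then f (x, s) else 0) \<partial>lborel)"
    if "x \<in> space M" for x
  proof -
    have m: "(\<lambda>s. f (x, s)) \<in> borel_measurable borel" using measurable_Pair2[OF assms(1) that] by simp
    show ?thesis
      unfolding integral_time_measure_eq[OF m, of "T x"]
      by (rule Bochner_Integration.integral_cong[OF refl]) (simp add: indicator_def)
  qed
  ultimately show ?thesis by (simp cong: measurable_cong)
qed

lemma running_integral_measurable:
  fixes f :: "real \<Rightarrow> real"
  assumes "f \<in> borel_measurable borel"
  shows "(\<lambda>t. \<integral>s. f s \<partial>time_measure t) \<in> borel_measurable borel"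
proof -
  have "(\<lambda>x :: real \<times> real. f (snd x)) \<in> borel_measurable (borel \<Otimes>\<^sub>M borel)"
    by (rule measurable_compose[OF measurable_snd assms])
  from time_integral_measurable[OF this measurable_ident] show ?thesis by (simp only: snd_conv id_def)
qed

text \<open>
  The derivative of \<open>(\<integral>\<^sub>0\<^sup>s f)\<^sup>2 / 2\<close> is \<open>f s
  * \<integral>\<^sub>0\<^sup>s f\<close>.
\<close>

lemma time_integral_half_square:
  fixes f :: "real \<Rightarrow> real"
  assumes [measurable]: "f \<in> borel_measurable borel" and cont: "continuous_on {0..t} f" and "0 \<le> t"
  shows "(\<integral>s. f s * (\<integral>r. f r \<partial>time_measure s) \<partial>time_measure t) = (\<integral>s. f s \<partial>time_measure t)\<^sup>2 / 2"
proof -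
  define A where "A s = (\<integral>r. f r \<partial>time_measure s)" for s
  define G where "G s = integral {0..s} f" for s
  have AG: "A s = G s" if "s \<in> {0..t}" for s
    unfolding A_def G_def using that
    by (intro integral_time_measure_eq_integral continuous_on_subset[OF cont]) auto
  have [measurable]: "A \<in> borel_measurable borel"
    unfolding A_def by (rule running_integral_measurable[OF assms(1)])
  have G_deriv: "(G has_real_derivative f s) (at s within {0..t})" if "s \<in> {0..t}" for s
    unfolding G_def by (rule integral_has_real_derivative[OF cont that])
  have G_cont: "continuous_on {0..t} G"
    using G_deriv by (intro DERIV_continuous_on) auto
  have deriv: "((\<lambda>s. (G s)\<^sup>2 / 2) has_vector_derivative f s * G s) (at s within {0..t})"
    if "0 \<le> s" "s \<le> t" for s
    unfolding has_real_derivative_iff_has_vector_derivative[symmetric]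
    by (rule derivative_eq_intros G_deriv | use that in simp)+
  have "(\<integral>s. f s * A s \<partial>time_measure t) = (\<integral>s. indicator {0..t} s *\<^sub>R (f s * A s) \<partial>lborel)"
    by (rule integral_time_measure_eq) measurable
  also have "\<dots> = (\<integral>s. indicator {0..t} s *\<^sub>R (f s * G s) \<partial>lborel)"
    by (intro Bochner_Integration.integral_cong refl) (auto simp: indicator_def AG)
  also have "\<dots> = (G t)\<^sup>2 / 2 - (G 0)\<^sup>2 / 2"
    by (rule integral_FTC_Icc[OF \<open>0 \<le> t\<close> deriv], assumption, assumption)
      (intro continuous_on_mult cont G_cont)
  also have "\<dots> = (A t)\<^sup>2 / 2" using AG[of t] \<open>0 \<le> t\<close> by (simp add: G_def)
  finally show ?thesis unfolding A_def .
qed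

text \<open>
  By continuity \<open>D\<close> is the limit of its values at the grid points
  \<open>\<lfloor>(k + 1) t\<rfloor> / (k + 1)\<close>.
\<close>

lemma jointly_measurable_of_continuous:
  fixes D :: "real \<Rightarrow> 'a \<Rightarrow> 'b :: metric_space"
  assumes meas: "\<And>t. D t \<in> borel_measurable M"
    and cont: "\<And>\<omega>. \<omega> \<in> space M \<Longrightarrow> continuous_on UNIV (\<lambda>t. D t \<omega>)"
  shows "(\<lambda>x. D (snd x) (fst x)) \<in> borel_measurable (M \<Otimes>\<^sub>M borel)"
proof (rule borel_measurable_LIMSEQ_metric)
  define g where "g k t = real_of_int \<lfloor>real (Suc k) * t\<rfloor> / real (Suc k)" for k t
  fix k
  show "(\<lambda>x. D (g k (snd x)) (fst x)) \<in> borel_measurable (M \<Otimes>\<^sub>M borel)"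
    unfolding g_def
  proof (rule measurable_compose_countable[where f = "\<lambda>i x. D (real_of_int i / real (Suc k)) (fst x)"])
    show "(\<lambda>x. D (real_of_int i / real (Suc k)) (fst x)) \<in> borel_measurable (M \<Otimes>\<^sub>M borel)" for i
      by (rule measurable_compose[OF measurable_fst meas])
    show "(\<lambda>x. \<lfloor>real (Suc k) * snd x\<rfloor>) \<in> measurable (M \<Otimes>\<^sub>M borel) (count_space UNIV)"
      by (rule measurable_compose[OF _ measurable_real_floor]) measurable
  qed
next
  fix x assume "x \<in> space (M \<Otimes>\<^sub>M (borel :: real measure))"
  then have \<omega>: "fst x \<in> space M" by (auto simp: space_pair_measure)
  let ?g = "\<lambda>k. real_of_int \<lfloor>real (Suc k) * snd x\<rfloor> / real (Suc k)"
  have lim: "?g \<longlonglongrightarrow> snd x"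
  proof (rule LIM_zero_cancel, rule Lim_null_comparison[OF always_eventually LIMSEQ_inverse_real_of_nat], rule allI)
    fix k
    have "\<bar>real_of_int \<lfloor>real (Suc k) * snd x\<rfloor> - real (Suc k) * snd x\<bar> \<le> 1" by linarith
    moreover have "(?g k - snd x) * real (Suc k) = real_of_int \<lfloor>real (Suc k) * snd x\<rfloor> - real (Suc k) * snd x"
    proof -
      have "(a / b - y) * b = a - b * y" if "b \<noteq> 0" for a b y :: real
        using that by (simp add: field_simps)
      then show ?thesis by (metis of_nat_eq_0_iff nat.distinct(1))
    qed
    ultimately have "\<bar>?g k - snd x\<bar> * real (Suc k) \<le> 1"
      by (metis abs_mult abs_of_nat)
    then show "norm (?g k - snd x) \<le> inverse (real (Suc k))"
      by (simp add: pos_le_divide_eq inverse_eq_divide del: of_nat_Suc)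
  qed
  have "isCont (\<lambda>t. D t (fst x)) (snd x)"
    using cont[OF \<omega>] by (simp add: continuous_on_eq_continuous_at)
  from isCont_tendsto_compose[OF this lim]
  show "(\<lambda>k. D (?g k) (fst x)) \<longlonglongrightarrow> D (snd x) (fst x)" .
qed

context orthogonal_increments
begin

lemma Fubini_time:
  assumes m: "f \<in> borel_measurable (M \<Otimes>\<^sub>M borel)" and b: "\<And>\<omega> s. \<omega> \<in> space M \<Longrightarrow> \<bar>f (\<omega>, s)\<bar> \<le> (C :: real)"
  shows "integral\<^sup>L (Q T) f = (\<integral>s. expectation (\<lambda>\<omega>. f (\<omega>, s)) \<partial>time_measure T)"
    and "expectation (\<lambda>\<omega>. \<integral>s. f (\<omega>, s) \<partial>time_measure T) = (\<integral>s. expectation (\<lambda>\<omega>. f (\<omega>, s)) \<partial>time_measure T)"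
    and "integrable M (\<lambda>\<omega>. \<integral>s. f (\<omega>, s) \<partial>time_measure T)"
proof -
  interpret pair_sigma_finite M "time_measure T" by (rule pair_sigma_finite_Q)
  have "integrable (Q T) f" by (rule integrable_Q_bounded[OF m b])
  then have i: "integrable (Q T) (case_prod (\<lambda>\<omega> s. f (\<omega>, s)))" by simp
  show "expectation (\<lambda>\<omega>. \<integral>s. f (\<omega>, s) \<partial>time_measure T) = (\<integral>s. expectation (\<lambda>\<omega>. f (\<omega>, s)) \<partial>time_measure T)"
    by (rule Fubini_integral[OF i, symmetric])
  show "integral\<^sup>L (Q T) f = (\<integral>s. expectation (\<lambda>\<omega>. f (\<omega>, s)) \<partial>time_measure T)"
    using integral_snd[OF i] by simp
  show "integrable M (\<lambda>\<omega>. \<integral>s. f (\<omega>, s) \<partial>time_measure T)"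
    using integrable_fst[OF i] by simp
qed

text \<open>
  This is the expectation of Ito's formula for the square. Write \<open>N t = D t + c *
  \<integral>\<^sub>0\<^sup>t D\<close>. Expanding \<open>N t\<^sup>2\<close> and using
  \<open>time_integral_half_square\<close> for \<open>(\<integral>\<^sub>0\<^sup>t
  D)\<^sup>2\<close> gives \<open>N t\<^sup>2 = D t\<^sup>2 + 2 c
  \<integral>\<^sub>0\<^sup>t D s\<^sup>2 ds + 2 c \<integral>\<^sub>0\<^sup>t D s * (N t -
  N s) ds\<close>. By the martingale property the last integrand has mean \<open>0\<close>
  at every \<open>s\<close>, and the isometry evaluates the left-hand side.
\<close>

lemma mean_square_identity:
  fixes D :: "real \<Rightarrow> 'a \<Rightarrow> real"
  assumes D_F: "\<And>t. 0 \<le> t \<Longrightarrow> D t \<in> borel_measurable (F t)"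
    and D_M: "\<And>t. D t \<in> borel_measurable M"
    and cont: "\<And>\<omega>. \<omega> \<in> space M \<Longrightarrow> continuous_on UNIV (\<lambda>t. D t \<omega>)"
    and bnd: "\<And>t \<omega>. \<omega> \<in> space M \<Longrightarrow> \<bar>D t \<omega>\<bar> \<le> C"
    and ito: "\<And>t. 0 \<le> t \<Longrightarrow> L2_ito_integral \<Phi> t (\<lambda>\<omega>. D t \<omega> + c * (\<integral>s. D s \<omega> \<partial>time_measure t))"
    and t: "0 \<le> t"
  shows "expectation (\<lambda>\<omega>. (D t \<omega>)\<^sup>2) =
    (\<Sum>\<kappa>\<in>K. \<integral>x. (path \<Phi> \<kappa> x)\<^sup>2 \<partial>Q t) - 2 * c * (\<integral>s. expectation (\<lambda>\<omega>. (D s \<omega>)\<^sup>2) \<partial>time_measure t)"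
proof -
  define A where "A s \<omega> = (\<integral>r. D r \<omega> \<partial>time_measure s)" for s \<omega>
  define N where "N s \<omega> = D s \<omega> + c * A s \<omega>" for s \<omega>
  \<comment> \<open>Clamping times to \<open>[0, t]\<close> makes the integrand \<open>H\<close> below bounded
    on the whole line.\<close>
  define cl where "cl s = max 0 (min t s)" for s :: real
  have cl: "0 \<le> cl s" "cl s \<le> t" "s \<in> {0..t} \<Longrightarrow> cl s = s" for s using t by (auto simp: cl_def)
  have cl_meas [measurable]: "cl \<in> borel_measurable borel" unfolding cl_def by measurable
  have C: "0 \<le> C" using bnd not_empty by (metis abs_ge_zero all_not_in_conv order_trans)
  have DM: "(\<lambda>x. D (snd x) (fst x)) \<in> borel_measurable (M \<Otimes>\<^sub>M borel)"
    by (rule jointly_measurable_of_continuous[OF D_M cont])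
  have AM: "(\<lambda>x. A (snd x) (fst x)) \<in> borel_measurable (M \<Otimes>\<^sub>M borel)"
    unfolding A_def
  proof (rule time_integral_measurable[of "\<lambda>y. D (snd y) (fst (fst y))", simplified])
    show "(\<lambda>y. D (snd y) (fst (fst y))) \<in> borel_measurable ((M \<Otimes>\<^sub>M borel) \<Otimes>\<^sub>M borel)"
      using measurable_compose[of "\<lambda>y. (fst (fst y), snd y)" "(M \<Otimes>\<^sub>M borel) \<Otimes>\<^sub>M borel" "M \<Otimes>\<^sub>M borel", OF _ DM]
      by simp
  qed measurable
  have NM: "(\<lambda>x. N (snd x) (fst x)) \<in> borel_measurable (M \<Otimes>\<^sub>M borel)"
    unfolding N_def by (intro borel_measurable_add borel_measurable_times borel_measurable_const DM AM)
  have D_sec: "(\<lambda>s. D s \<omega>) \<in> borel_measurable borel" if "\<omega> \<in> space M" for \<omega>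
    using measurable_Pair2[OF DM that] by simp
  have A_sec: "(\<lambda>s. A s \<omega>) \<in> borel_measurable borel" if "\<omega> \<in> space M" for \<omega>
    using measurable_Pair2[OF AM that] by simp
  have A_bnd: "\<bar>A s \<omega>\<bar> \<le> C * t" if \<omega>: "\<omega> \<in> space M" and s: "0 \<le> s" "s \<le> t" for s \<omega>
  proof -
    have i: "integrable (time_measure s) (\<lambda>r. D r \<omega>)"
      by (rule integrable_time_measure_bounded[OF D_sec[OF \<omega>] bnd[OF \<omega>]])
    have "\<bar>A s \<omega>\<bar> \<le> (\<integral>r. \<bar>D r \<omega>\<bar> \<partial>time_measure s)"
      unfolding A_def using integral_norm_bound[of "time_measure s" "\<lambda>r. D r \<omega>"] by simp
    also have "\<dots> \<le> (\<integral>r. C \<partial>time_measure s)"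
      by (rule integral_mono[OF integrable_abs[OF i] finite_measure.integrable_const[OF finite_time_measure] bnd[OF \<omega>]])
    also have "\<dots> = C * s" using measure_time_measure[OF s(1)] by simp
    also have "\<dots> \<le> C * t" using s C by (intro mult_left_mono)
    finally show ?thesis .
  qed
  define Cn where "Cn = C + \<bar>c\<bar> * (C * t)"
  have N_bnd: "\<bar>N s \<omega>\<bar> \<le> Cn" if \<omega>: "\<omega> \<in> space M" and s: "0 \<le> s" "s \<le> t" for s \<omega>
  proof -
    have "\<bar>N s \<omega>\<bar> \<le> \<bar>D s \<omega>\<bar> + \<bar>c\<bar> * \<bar>A s \<omega>\<bar>"
      unfolding N_def using abs_triangle_ineq[of "D s \<omega>" "c * A s \<omega>"] by (simp add: abs_mult)
    also have "\<dots> \<le> Cn" unfolding Cn_def by (intro add_mono mult_left_mono bnd A_bnd \<omega> s) simp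
    finally show ?thesis .
  qed
  have NM_t: "N s \<in> borel_measurable M" if "0 \<le> s" for s
    unfolding N_def[abs_def] A_def by (rule L2_ito_integralD(1)[OF ito[OF that]])
  \<comment> \<open>The mixed term of the expanded square.\<close>
  define H where "H \<omega> s = D (cl s) \<omega> * (N t \<omega> - N (cl s) \<omega>)" for \<omega> s
  have HM: "(\<lambda>x. H (fst x) (snd x)) \<in> borel_measurable (M \<Otimes>\<^sub>M borel)"
  proof -
    have clx: "(\<lambda>x. (fst x, cl (snd x))) \<in> measurable (M \<Otimes>\<^sub>M borel) (M \<Otimes>\<^sub>M borel)" by measurable
    have 1: "(\<lambda>x. D (cl (snd x)) (fst x)) \<in> borel_measurable (M \<Otimes>\<^sub>M borel)"
      using measurable_compose[OF clx DM] by simp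
    have 2: "(\<lambda>x. N (cl (snd x)) (fst x)) \<in> borel_measurable (M \<Otimes>\<^sub>M borel)"
      using measurable_compose[OF clx NM] by simp
    have 3: "(\<lambda>x. N t (fst x)) \<in> borel_measurable (M \<Otimes>\<^sub>M (borel :: real measure))"
      by (rule measurable_compose[OF measurable_fst NM_t[OF t]])
    show ?thesis unfolding H_def by (intro borel_measurable_times borel_measurable_diff 1 2 3)
  qed
  have H_bnd: "\<bar>H \<omega> s\<bar> \<le> C * (2 * Cn)" if "\<omega> \<in> space M" for \<omega> s
  proof -
    have "\<bar>N t \<omega> - N (cl s) \<omega>\<bar> \<le> 2 * Cn"
      using N_bnd[OF that t order_refl] N_bnd[OF that cl(1,2), of s] by linarith
    then show ?thesis unfolding H_def abs_mult by (intro mult_mono bnd that C) auto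
  qed
  have H_mean: "expectation (\<lambda>\<omega>. H \<omega> s) = 0" for s
  proof -
    have i1: "integrable M (\<lambda>\<omega>. N u \<omega> * D (cl s) \<omega>)" if "0 \<le> u" "u \<le> t" for u
    proof (rule integrable_const_bound[where B = "Cn * C"])
      show "AE \<omega> in M. norm (N u \<omega> * D (cl s) \<omega>) \<le> Cn * C"
      proof (rule AE_I2)
        fix \<omega> assume \<omega>: "\<omega> \<in> space M"
        show "norm (N u \<omega> * D (cl s) \<omega>) \<le> Cn * C"
          unfolding real_norm_def abs_mult
          by (intro mult_mono N_bnd bnd \<omega> that abs_ge_zero order_trans[OF abs_ge_zero N_bnd[OF \<omega> that]])
      qed
      show "(\<lambda>\<omega>. N u \<omega> * D (cl s) \<omega>) \<in> borel_measurable M"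
        by (rule borel_measurable_times[OF NM_t[OF that(1)] D_M])
    qed
    have "expectation (\<lambda>\<omega>. N t \<omega> * D (cl s) \<omega>) = expectation (\<lambda>\<omega>. N (cl s) \<omega> * D (cl s) \<omega>)"
      unfolding N_def A_def
      by (rule L2_ito_integral_martingale[OF ito[OF t] ito[OF cl(1)] cl(1) cl(2) D_F[OF cl(1)] bnd])
    moreover have "expectation (\<lambda>\<omega>. H \<omega> s) =
        expectation (\<lambda>\<omega>. N t \<omega> * D (cl s) \<omega>) - expectation (\<lambda>\<omega>. N (cl s) \<omega> * D (cl s) \<omega>)"
      unfolding Bochner_Integration.integral_diff[OF i1[OF t order_refl] i1[OF cl(1,2)], symmetric]
      by (rule Bochner_Integration.integral_cong[OF refl]) (simp add: H_def algebra_simps)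
    ultimately show ?thesis by simp
  qed
  have pathwise: "(N t \<omega>)\<^sup>2 = (D t \<omega>)\<^sup>2 + 2 * c * (\<integral>s. (D s \<omega>)\<^sup>2 \<partial>time_measure t) + 2 * c * (\<integral>s. H \<omega> s \<partial>time_measure t)"
    if \<omega>: "\<omega> \<in> space M" for \<omega>
  proof -
    have Dm [measurable]: "(\<lambda>s. D s \<omega>) \<in> borel_measurable borel" by (rule D_sec[OF \<omega>])
    have Am [measurable]: "(\<lambda>s. A s \<omega>) \<in> borel_measurable borel" by (rule A_sec[OF \<omega>])
    have i1: "integrable (time_measure t) (\<lambda>s. D s \<omega>)"
      by (rule integrable_time_measure_bounded[OF Dm bnd[OF \<omega>]])
    have i2: "integrable (time_measure t) (\<lambda>s. (D s \<omega>)\<^sup>2)"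
    proof (rule integrable_time_measure_bounded[where C = "C\<^sup>2"])
      show "(\<lambda>s. (D s \<omega>)\<^sup>2) \<in> borel_measurable borel" by measurable
      show "\<bar>(D s \<omega>)\<^sup>2\<bar> \<le> C\<^sup>2" for s using power_mono[OF bnd[OF \<omega>, of s], of 2] by simp
    qed
    have i3: "integrable (time_measure t) (\<lambda>s. D s \<omega> * A s \<omega>)"
    proof (rule finite_measure.integrable_const_bound[OF finite_time_measure, where B = "C * (C * t)"])
      show "AE s in time_measure t. norm (D s \<omega> * A s \<omega>) \<le> C * (C * t)"
      proof (rule AE_mp[OF AE_time_measure], intro AE_I2 impI)
        fix s assume "s \<in> {0..t}"
        then show "norm (D s \<omega> * A s \<omega>) \<le> C * (C * t)"
          unfolding real_norm_def abs_mult using C by (intro mult_mono bnd A_bnd \<omega>) auto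
      qed
      show "(\<lambda>s. D s \<omega> * A s \<omega>) \<in> borel_measurable (time_measure t)" by simp
    qed
    have half: "(\<integral>s. D s \<omega> * A s \<omega> \<partial>time_measure t) = (A t \<omega>)\<^sup>2 / 2"
      unfolding A_def by (rule time_integral_half_square[OF Dm continuous_on_subset[OF cont[OF \<omega>]] t]) simp
    have "(\<integral>s. H \<omega> s \<partial>time_measure t) = (\<integral>s. N t \<omega> * D s \<omega> - (D s \<omega>)\<^sup>2 - c * (D s \<omega> * A s \<omega>) \<partial>time_measure t)"
    proof (rule integral_time_measure_cong)
      show "H \<omega> \<in> borel_measurable borel" using measurable_Pair2[OF HM \<omega>] by simp
      show "(\<lambda>s. N t \<omega> * D s \<omega> - (D s \<omega>)\<^sup>2 - c * (D s \<omega> * A s \<omega>)) \<in> borel_measurable borel" by measurable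
      show "H \<omega> s = N t \<omega> * D s \<omega> - (D s \<omega>)\<^sup>2 - c * (D s \<omega> * A s \<omega>)" if "0 \<le> s" "s \<le> t" for s
        using cl(3)[of s] that by (simp add: H_def N_def[of s] algebra_simps power2_eq_square)
    qed
    also have "\<dots> = N t \<omega> * A t \<omega> - (\<integral>s. (D s \<omega>)\<^sup>2 \<partial>time_measure t) - c * ((A t \<omega>)\<^sup>2 / 2)"
    proof -
      have j1: "integrable (time_measure t) (\<lambda>s. N t \<omega> * D s \<omega>)" by (rule integrable_mult_right[OF i1])
      have j3: "integrable (time_measure t) (\<lambda>s. c * (D s \<omega> * A s \<omega>))" by (rule integrable_mult_right[OF i3])
      show ?thesis
        unfolding Bochner_Integration.integral_diff[OF Bochner_Integration.integrable_diff[OF j1 i2] j3]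
          Bochner_Integration.integral_diff[OF j1 i2] integral_mult_right_zero half
        unfolding A_def ..
    qed
    finally have E: "(\<integral>s. H \<omega> s \<partial>time_measure t) = N t \<omega> * A t \<omega> - (\<integral>s. (D s \<omega>)\<^sup>2 \<partial>time_measure t) - c * ((A t \<omega>)\<^sup>2 / 2)" .
    have alg: "(x + c * y)\<^sup>2 = x\<^sup>2 + 2 * c * z + 2 * c * ((x + c * y) * y - z - c * (y\<^sup>2 / 2))" for x y z :: real
      by (simp add: power2_eq_square field_simps)
    show ?thesis unfolding E N_def[of t] by (rule alg)
  qed
  have D2M: "(\<lambda>x. (D (snd x) (fst x))\<^sup>2) \<in> borel_measurable (M \<Otimes>\<^sub>M borel)"
    by (rule borel_measurable_power[OF DM])
  have D2_bnd: "\<bar>(D s \<omega>)\<^sup>2\<bar> \<le> C\<^sup>2" if "\<omega> \<in> space M" for s \<omega>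
    using power_mono[OF bnd[OF that, of s], of 2] by simp
  note D2_Fubini = Fubini_time[of "\<lambda>x. (D (snd x) (fst x))\<^sup>2" "C\<^sup>2" t, OF D2M, simplified]
  note H_Fubini = Fubini_time[of "\<lambda>x. H (fst x) (snd x)" "C * (2 * Cn)" t, OF HM, unfolded fst_conv snd_conv, OF H_bnd]
  have I0: "integrable M (\<lambda>\<omega>. (D t \<omega>)\<^sup>2)"
    by (rule integrable_const_bound[where B = "C\<^sup>2"])
      (use D2_bnd in \<open>auto intro!: AE_I2\<close>, rule borel_measurable_power[OF D_M])
  have I1: "integrable M (\<lambda>\<omega>. 2 * c * (\<integral>s. (D s \<omega>)\<^sup>2 \<partial>time_measure t))"
    using D2_bnd by (intro integrable_mult_right D2_Fubini(3)) simp
  have I2: "integrable M (\<lambda>\<omega>. 2 * c * (\<integral>s. H \<omega> s \<partial>time_measure t))"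
    by (intro integrable_mult_right H_Fubini(3))
  have "expectation (\<lambda>\<omega>. (N t \<omega>)\<^sup>2) = expectation (\<lambda>\<omega>. (D t \<omega>)\<^sup>2 + 2 * c * (\<integral>s. (D s \<omega>)\<^sup>2 \<partial>time_measure t) + 2 * c * (\<integral>s. H \<omega> s \<partial>time_measure t))"
    by (rule Bochner_Integration.integral_cong[OF refl]) (rule pathwise)
  also have "\<dots> = expectation (\<lambda>\<omega>. (D t \<omega>)\<^sup>2) + 2 * c * expectation (\<lambda>\<omega>. \<integral>s. (D s \<omega>)\<^sup>2 \<partial>time_measure t)
      + 2 * c * expectation (\<lambda>\<omega>. \<integral>s. H \<omega> s \<partial>time_measure t)"
    unfolding Bochner_Integration.integral_add[OF Bochner_Integration.integrable_add[OF I0 I1] I2]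
      Bochner_Integration.integral_add[OF I0 I1] integral_mult_right_zero ..
  also have "expectation (\<lambda>\<omega>. \<integral>s. (D s \<omega>)\<^sup>2 \<partial>time_measure t) = (\<integral>s. expectation (\<lambda>\<omega>. (D s \<omega>)\<^sup>2) \<partial>time_measure t)"
    using D2_bnd by (intro D2_Fubini(2)) simp
  also have "expectation (\<lambda>\<omega>. \<integral>s. H \<omega> s \<partial>time_measure t) = 0"
    using H_Fubini(2) unfolding H_mean by simp
  finally have "expectation (\<lambda>\<omega>. (N t \<omega>)\<^sup>2) = expectation (\<lambda>\<omega>. (D t \<omega>)\<^sup>2) + 2 * c * (\<integral>s. expectation (\<lambda>\<omega>. (D s \<omega>)\<^sup>2) \<partial>time_measure t)"
    by simp
  moreover have "expectation (\<lambda>\<omega>. (N t \<omega>)\<^sup>2) = (\<Sum>\<kappa>\<in>K. \<integral>x. (path \<Phi> \<kappa> x)\<^sup>2 \<partial>Q t)"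
    unfolding N_def A_def by (rule L2_ito_integral_isometry[OF ito[OF t] t])
  ultimately show ?thesis by linarith
qed

end

text \<open>
  A maximum principle. Let \<open>V n t = \<integral>\<^sub>0\<^sup>t u n\<close> and
  \<open>W n = \<integral>\<^sub>0\<^sup>T V n\<close>; integrating the system once gives
  \<open>V n T = \<Sum>\<^sub>i q i n * (W (n + r i) - W n)\<close>. Since \<open>W\<close>
  is nonnegative and summable, a positive value of \<open>W\<close> would imply that
  \<open>W\<close> attains its maximum at some \<open>n\<close>. There the right-hand side
  is not positive, so \<open>V n T \<le> 0\<close>; as \<open>V n\<close> increases from
  \<open>0\<close>, it vanishes on \<open>[0, T]\<close> and \<open>W n = 0\<close>, a
  contradiction. So \<open>W\<close> vanishes, then \<open>V\<close> by the integrated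
  system, and then \<open>u\<close> by the system itself.
\<close>

lemma summable_system_vanishes:
  fixes u :: "int \<Rightarrow> real \<Rightarrow> real" and q :: "'i \<Rightarrow> int \<Rightarrow> real" and r :: "'i \<Rightarrow> int"
  assumes I: "finite I" and q: "\<And>i n. i \<in> I \<Longrightarrow> 0 \<le> q i n"
    and meas: "\<And>n. u n \<in> borel_measurable borel"
    and nonneg: "\<And>n t. 0 \<le> u n t" and zero: "\<And>n t. n \<le> 0 \<Longrightarrow> u n t = 0"
    and sum: "\<And>m t. (\<Sum>n=1..m. u n t) \<le> C"
    and eq: "\<And>n t. 1 \<le> n \<Longrightarrow> 0 \<le> t \<Longrightarrow> u n t =
      (\<Sum>i\<in>I. q i n * ((\<integral>s. u (n + r i) s \<partial>time_measure t) - (\<integral>s. u n s \<partial>time_measure t)))"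
    and n: "1 \<le> n" and t: "0 \<le> t"
  shows "u n t = 0"
proof -
  define V where "V n t = (\<integral>s. u n s \<partial>time_measure t)" for n t
  have C: "0 \<le> C" using sum[of 0 0] by simp
  have u_le: "u n t \<le> C" for n t
  proof (cases "1 \<le> n")
    case True
    then have "u n t \<le> (\<Sum>n=1..n. u n t)" by (intro member_le_sum nonneg) auto
    then show ?thesis using sum[where m = n and t = t] by linarith
  next
    case False
    then show ?thesis using zero[of n t] C by simp
  qed
  have u_int: "integrable (time_measure t) (u n)" for n t
    by (rule integrable_time_measure_bounded[OF meas, where C = C]) (use nonneg u_le in simp)
  have V_meas: "V n \<in> borel_measurable borel" for n
    unfolding V_def by (rule running_integral_measurable[OF meas])
  have V_nonneg: "0 \<le> V n t" for n t unfolding V_def by (rule Bochner_Integration.integral_nonneg) (rule nonneg)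
  have V_sum: "(\<Sum>n=1..m. V n t) \<le> C * t" if "0 \<le> t" for m t
  proof -
    have "(\<Sum>n=1..m. V n t) = (\<integral>s. (\<Sum>n=1..m. u n s) \<partial>time_measure t)"
      unfolding V_def by (rule Bochner_Integration.integral_sum[symmetric]) (rule u_int)
    also have "\<dots> \<le> (\<integral>s. C \<partial>time_measure t)"
      by (rule integral_mono[OF _ finite_measure.integrable_const[OF finite_time_measure] sum])
        (intro Bochner_Integration.integrable_sum u_int)
    also have "\<dots> = C * t" using measure_time_measure[OF that] by simp
    finally show ?thesis .
  qed
  have V_zero: "V n t = 0" if "n \<le> 0" for n t
  proof -
    have "u n = (\<lambda>s. 0)" using zero[OF that] by (intro ext) simp
    then show ?thesis unfolding V_def by simp
  qed
  have V_le: "V n t \<le> C * t" if "0 \<le> t" for n t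
  proof (cases "1 \<le> n")
    case True
    then have "V n t \<le> (\<Sum>n=1..n. V n t)" by (intro member_le_sum V_nonneg) auto
    then show ?thesis using V_sum[OF that, of n] by linarith
  next
    case False
    then show ?thesis using V_zero[of n t] C that by simp
  qed
  have V_mono: "V n s \<le> V n t" if "s \<le> t" for n s t
  proof -
    have "(\<integral>r. indicator {0..s} r *\<^sub>R u n r \<partial>lborel) \<le> (\<integral>r. indicator {0..t} r *\<^sub>R u n r \<partial>lborel)"
    proof (rule integral_mono)
      have i: "integrable lborel (\<lambda>r. indicator {0..t} r *\<^sub>R u n r)" for t
      proof (rule Bochner_Integration.integrable_bound[where f = "\<lambda>r. C * indicator {0..t} r"])
        show "integrable lborel (\<lambda>r. C * indicator {0..t} r)"
          by (intro integrable_mult_right integrable_real_indicator) (auto simp: emeasure_lborel_Icc_eq)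
        show "(\<lambda>r. indicator {0..t} r *\<^sub>R u n r) \<in> borel_measurable lborel" using meas[of n] by simp
        show "AE r in lborel. norm (indicator {0..t} r *\<^sub>R u n r) \<le> norm (C * indicator {0..t} r)"
          using u_le[of n] nonneg[of n] C by (intro AE_I2) (auto simp: indicator_def)
      qed
      show "integrable lborel (\<lambda>r. indicator {0..s} r *\<^sub>R u n r)" by (rule i)
      show "integrable lborel (\<lambda>r. indicator {0..t} r *\<^sub>R u n r)" by (rule i)
      show "indicator {0..s} r *\<^sub>R u n r \<le> indicator {0..t} r *\<^sub>R u n r" for r
        using that nonneg[of n r] by (auto simp: indicator_def)
    qed
    then show ?thesis unfolding V_def by (simp only: integral_time_measure_eq[OF meas])
  qed
  have V_T: "V n T = 0" if n: "1 \<le> n" and T: "0 \<le> T" for n T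
  proof -
    define W where "W n = (\<integral>s. V n s \<partial>time_measure T)" for n
    have V_int: "integrable (time_measure T) (V n)" for n
    proof (rule finite_measure.integrable_const_bound[OF finite_time_measure, where B = "C * T"])
      show "AE s in time_measure T. norm (V n s) \<le> C * T"
      proof (rule AE_mp[OF AE_time_measure], intro AE_I2 impI)
        fix s assume "s \<in> {0..T}"
        then have "V n s \<le> V n T" by (intro V_mono) simp
        then show "norm (V n s) \<le> C * T" using V_le[OF T, of n] V_nonneg[of n s] by simp
      qed
      show "V n \<in> borel_measurable (time_measure T)" using V_meas by simp
    qed
    have V_eq: "V n T = (\<Sum>i\<in>I. q i n * (W (n + r i) - W n))" if "1 \<le> n" for n
    proof -
      have "V n T = (\<integral>s. (\<Sum>i\<in>I. q i n * (V (n + r i) s - V n s)) \<partial>time_measure T)"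
        unfolding V_def[of n T]
      proof (rule integral_time_measure_cong[OF meas])
        show "(\<lambda>s. \<Sum>i\<in>I. q i n * (V (n + r i) s - V n s)) \<in> borel_measurable borel"
          by (intro borel_measurable_sum borel_measurable_times borel_measurable_const borel_measurable_diff V_meas)
        show "u n s = (\<Sum>i\<in>I. q i n * (V (n + r i) s - V n s))" if "0 \<le> s" for s
          unfolding V_def by (rule eq[OF \<open>1 \<le> n\<close> that])
      qed
      also have "\<dots> = (\<Sum>i\<in>I. \<integral>s. q i n * (V (n + r i) s - V n s) \<partial>time_measure T)"
        by (intro Bochner_Integration.integral_sum integrable_mult_right Bochner_Integration.integrable_diff V_int)
      also have "\<dots> = (\<Sum>i\<in>I. q i n * (W (n + r i) - W n))"
        unfolding W_def integral_mult_right_zero Bochner_Integration.integral_diff[OF V_int V_int] ..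
      finally show ?thesis .
    qed
    have W_nonneg: "0 \<le> W n" for n unfolding W_def by (rule Bochner_Integration.integral_nonneg) (rule V_nonneg)
    have W_zero: "W n = 0" if "n \<le> 0" for n
    proof -
      have "V n = (\<lambda>s. 0)" using V_zero[OF that] by (intro ext) simp
      then show ?thesis unfolding W_def by simp
    qed
    have W_sum: "(\<Sum>n=1..m. W n) \<le> C * T * T" for m
    proof -
      have "(\<Sum>n=1..m. W n) = (\<integral>s. (\<Sum>n=1..m. V n s) \<partial>time_measure T)"
        unfolding W_def by (rule Bochner_Integration.integral_sum[symmetric]) (rule V_int)
      also have "\<dots> \<le> (\<integral>s. C * T \<partial>time_measure T)"
      proof (rule integral_mono_AE)
        show "integrable (time_measure T) (\<lambda>s. \<Sum>n=1..m. V n s)"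
          by (intro Bochner_Integration.integrable_sum V_int)
        show "integrable (time_measure T) (\<lambda>s. C * T)"
          by (rule finite_measure.integrable_const[OF finite_time_measure])
        show "AE s in time_measure T. (\<Sum>n=1..m. V n s) \<le> C * T"
        proof (rule AE_mp[OF AE_time_measure], intro AE_I2 impI)
          fix s assume s: "s \<in> {0..T}"
          then have "(\<Sum>n=1..m. V n s) \<le> C * s" by (intro V_sum) simp
          also have "\<dots> \<le> C * T" using s C by (intro mult_left_mono) auto
          finally show "(\<Sum>n=1..m. V n s) \<le> C * T" .
        qed
      qed
      also have "\<dots> = C * T * T" using measure_time_measure[OF T] by simp
      finally show ?thesis .
    qed
    have W_vanishes: "W n0 = 0" for n0
    proof (rule ccontr)
      assume "W n0 \<noteq> 0"
      then have pos: "0 < W n0" using W_nonneg[of n0] by simp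
      \<comment> \<open>Summability makes this set finite, so \<open>W\<close> attains its maximum on it.\<close>
      define A where "A = {n. W n0 \<le> W n}"
      have A1: "1 \<le> n" if "n \<in> A" for n
        using that W_zero[of n] pos by (cases "1 \<le> n") (auto simp: A_def)
      have "finite A"
      proof (rule ccontr)
        assume inf: "infinite A"
        obtain k where k: "C * T * T < real k * W n0"
          using reals_Archimedean3[OF pos] by blast
        obtain S where S: "S \<subseteq> A" "finite S" "card S = k"
          using infinite_arbitrarily_large[OF inf] by blast
        define m where "m = Max (insert 0 S)"
        have sub: "S \<subseteq> {1..m}" using S A1 by (auto simp: m_def)
        have "real k * W n0 = (\<Sum>n\<in>S. W n0)" using S by simp
        also have "\<dots> \<le> (\<Sum>n\<in>S. W n)" using S(1) by (intro sum_mono) (auto simp: A_def)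
        also have "\<dots> \<le> (\<Sum>n=1..m. W n)" using sub W_nonneg by (intro sum_mono2) auto
        also have "\<dots> \<le> C * T * T" by (rule W_sum)
        finally show False using k by simp
      qed
      moreover have "n0 \<in> A" by (simp add: A_def)
      ultimately obtain n1 where n1: "n1 \<in> A" "Max (W ` A) = W n1"
        using Max_in[of "W ` A"] by blast
      have n1_max: "W n \<le> W n1" if "n \<in> A" for n
        unfolding n1(2)[symmetric] using \<open>finite A\<close> that by (intro Max_ge) auto
      have max: "W n \<le> W n1" for n
      proof (cases "n \<in> A")
        case False
        then have "W n \<le> W n0" by (simp add: A_def)
        also have "\<dots> \<le> W n1" using n1(1) by (simp add: A_def)
        finally show ?thesis .
      qed (rule n1_max)
      have "V n1 T \<le> 0"
        unfolding V_eq[OF A1[OF n1(1)]]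
        using q max by (intro sum_nonpos mult_nonneg_nonpos) auto
      have "W n1 \<le> (\<integral>s. 0 \<partial>time_measure T)"
        unfolding W_def
      proof (rule integral_mono_AE[OF V_int])
        show "AE s in time_measure T. V n1 s \<le> 0"
        proof (rule AE_mp[OF AE_time_measure], intro AE_I2 impI)
          fix s assume "s \<in> {0..T}"
          then have "V n1 s \<le> V n1 T" by (intro V_mono) simp
          then show "V n1 s \<le> 0" using \<open>V n1 T \<le> 0\<close> by simp
        qed
      qed simp
      then show False using max[of n0] pos by simp
    qed
    show ?thesis unfolding V_eq[OF n] W_vanishes by simp
  qed
  have V0: "V m t = 0" for m
  proof (cases "1 \<le> m")
    case True
    then show ?thesis by (rule V_T[OF _ t])
  next
    case False
    then have "m \<le> 0" by simp
    then show ?thesis by (rule V_zero)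
  qed
  have "u n t = (\<Sum>i\<in>I. q i n * (V (n + r i) t - V n t))" unfolding V_def by (rule eq[OF n t])
  then show ?thesis by (simp only: V0 diff_self mult_zero_right sum.neutral_const)
qed

section \<open>The noise of the system\<close>

text \<open>
  The motions \<open>Y i n\<close> and \<open>Y (\<tau> i) n\<close> coincide. Each motion
  is therefore replaced by the representative with first index in \<open>Istar\<close>; as
  \<open>m (\<tau> i) \<noteq> m i\<close>, different \<open>i\<close> lead to different,
  hence independent, representatives.
\<close>

lemma symmetric_family_orthogonal_increments:
  fixes Y :: "'i \<Rightarrow> int \<Rightarrow> real \<Rightarrow> 'a \<Rightarrow> real ^ 'd"
  assumes filt: "filtered_prob_space M F"
    and I: "finite I" "\<And>i. i \<in> I \<Longrightarrow> \<tau> (\<tau> i) = i" "Istar \<subseteq> I" "I = Istar \<union> \<tau> ` Istar"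
    and bm: "\<And>i n. i \<in> I \<Longrightarrow> brownian_motion M F (Y i n)"
    and sym: "symmetric_family M I \<tau> Istar Y"
    and r: "\<And>i. i \<in> I \<Longrightarrow> m (\<tau> i) \<noteq> m i"
  shows "orthogonal_increments M F (I \<times> UNIV) (\<lambda>\<kappa> t \<omega>. Y (fst \<kappa>) (m (fst \<kappa>)) t \<omega> $ snd \<kappa>)"
proof -
  interpret filtered_prob_space M F by (rule filt)
  define rep where "rep i = (if i \<in> Istar then i else \<tau> i)" for i
  have rep: "rep i \<in> Istar" if i: "i \<in> I" for i
  proof (cases "i \<in> Istar")
    case False
    then obtain j where "j \<in> Istar" "i = \<tau> j" using i I(4) by blast
    then have "\<tau> i = j" using I(2,3) by auto
    then show ?thesis using False \<open>j \<in> Istar\<close> by (simp add: rep_def)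
  qed (simp add: rep_def)
  have rep_I: "rep i \<in> I" if "i \<in> I" for i using rep[OF that] I(3) by blast
  have Y_rep: "AE \<omega> in M. \<forall>t\<ge>0. Y (rep i) n t \<omega> = Y i n t \<omega>" if "i \<in> I" for i n
    using sym that by (auto simp: symmetric_family_def rep_def)
  have ne: "(rep i, m i) \<noteq> (rep j, m j)" if ij: "i \<in> I" "j \<in> I" "i \<noteq> j" for i j
  proof
    assume eq: "(rep i, m i) = (rep j, m j)"
    then have "j = \<tau> i \<or> i = \<tau> j \<or> \<tau> i = \<tau> j" using ij by (auto simp: rep_def split: if_splits)
    moreover have "\<tau> i \<noteq> \<tau> j" using I(2)[OF ij(1)] I(2)[OF ij(2)] ij(3) by metis
    ultimately show False using r ij eq by (metis prod.inject)
  qed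
  let ?PM = "PiM {0..} (\<lambda>_. borel :: (real ^ 'd) measure)"
  have ind: "indep_var ?PM (\<lambda>\<omega>. restrict (\<lambda>t. Y (rep i) (m i) t \<omega>) {0..})
      ?PM (\<lambda>\<omega>. restrict (\<lambda>t. Y (rep j) (m j) t \<omega>) {0..})" if ij: "i \<in> I" "j \<in> I" "i \<noteq> j" for i j
  proof -
    have "indep_vars (\<lambda>_. ?PM) (\<lambda>(i, n) \<omega>. restrict (\<lambda>t. Y i n t \<omega>) {0..}) (Istar \<times> UNIV)"
      using sym unfolding symmetric_family_def by blast
    from indep_var_of_indep_vars[OF this _ _ ne[OF ij]] show ?thesis
      using rep[OF ij(1)] rep[OF ij(2)] by simp
  qed
  let ?W = "\<lambda>\<kappa> t \<omega>. Y (fst \<kappa>) (m (fst \<kappa>)) t \<omega> $ snd \<kappa>"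
  show ?thesis
  proof
    show "finite (I \<times> (UNIV :: 'd set))" using I(1) by simp
  next
    fix \<kappa> and t :: real assume "\<kappa> \<in> I \<times> (UNIV :: 'd set)" "0 \<le> t"
    then show "?W \<kappa> t \<in> borel_measurable (F t)"
      by (intro brownian_measurable_F bm) auto
  next
    fix \<kappa> and s t :: real assume "\<kappa> \<in> I \<times> (UNIV :: 'd set)" "0 \<le> s" "s \<le> t"
    then show "integrable M (\<lambda>\<omega>. (?W \<kappa> t \<omega> - ?W \<kappa> s \<omega>)\<^sup>2)"
      by (intro brownian_increment_square_integrable bm) auto
  next
    fix \<kappa> and s t C :: real and \<eta> :: "'a \<Rightarrow> real"
    assume \<kappa>: "\<kappa> \<in> I \<times> (UNIV :: 'd set)" and st: "0 \<le> s" "s \<le> t"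
      and \<eta>: "\<eta> \<in> borel_measurable (F s)" "\<And>\<omega>. \<omega> \<in> space M \<Longrightarrow> \<bar>\<eta> \<omega>\<bar> \<le> C"
    have "integrable M \<eta>"
      by (rule integrable_const_bound[where B = C])
        (use \<eta>(2) in \<open>auto intro!: AE_I2\<close>, rule measurable_F_M[OF \<eta>(1) st(1)])
    then show "expectation (\<lambda>\<omega>. \<eta> \<omega> * (?W \<kappa> t \<omega> - ?W \<kappa> s \<omega>)) = 0"
      using \<kappa> by (intro brownian_increment_centred(2)[OF bm st \<eta>(1)]) auto
  next
    fix \<kappa> \<kappa>' and u v s t C :: real and \<eta> :: "'a \<Rightarrow> real"
    assume \<kappa>: "\<kappa> \<in> I \<times> (UNIV :: 'd set)" "\<kappa>' \<in> I \<times> (UNIV :: 'd set)"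
      and t: "0 \<le> u" "u \<le> v" "v \<le> s" "s \<le> t"
      and \<eta>: "\<eta> \<in> borel_measurable (F s)" "\<And>\<omega>. \<omega> \<in> space M \<Longrightarrow> \<bar>\<eta> \<omega>\<bar> \<le> C"
    have "fst \<kappa> \<in> I" "fst \<kappa>' \<in> I" using \<kappa> by auto
    then show "expectation (\<lambda>\<omega>. \<eta> \<omega> * ((?W \<kappa> v \<omega> - ?W \<kappa> u \<omega>) * (?W \<kappa>' t \<omega> - ?W \<kappa>' s \<omega>))) = 0"
      by (intro brownian_disjoint_increments(2)[OF bm bm t \<eta>])
  next
    fix \<kappa> \<kappa>' and s t C :: real and \<eta> :: "'a \<Rightarrow> real"
    assume \<kappa>: "\<kappa> \<in> I \<times> (UNIV :: 'd set)" "\<kappa>' \<in> I \<times> (UNIV :: 'd set)"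
      and st: "0 \<le> s" "s \<le> t"
      and \<eta>: "\<eta> \<in> borel_measurable (F s)" "\<And>\<omega>. \<omega> \<in> space M \<Longrightarrow> \<bar>\<eta> \<omega>\<bar> \<le> C"
    obtain i a j b where k: "\<kappa> = (i, a)" "\<kappa>' = (j, b)" by (cases \<kappa>, cases \<kappa>') blast
    have i: "i \<in> I" and j: "j \<in> I" using \<kappa> k by auto
    have t: "0 \<le> t" using st by linarith
    have \<eta>M: "\<eta> \<in> borel_measurable M" by (rule measurable_F_M[OF \<eta>(1) st(1)])
    have \<eta>_int: "integrable M \<eta>"
      by (rule integrable_const_bound[where B = C]) (use \<eta>(2) in \<open>auto intro!: AE_I2\<close>, rule \<eta>M)
    show "expectation (\<lambda>\<omega>. \<eta> \<omega> * ((?W \<kappa> t \<omega> - ?W \<kappa> s \<omega>) * (?W \<kappa>' t \<omega> - ?W \<kappa>' s \<omega>))) =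
        (if \<kappa> = \<kappa>' then (t - s) * expectation \<eta> else 0)"
    proof (cases "i = j")
      case True
      then show ?thesis
        using brownian_increment_covariation[OF bm[OF j] st \<eta>(1) \<eta>_int, of "m j" a b] by (simp only: k fst_conv snd_conv prod.inject simp_thms)
    next
      case False
      have "expectation (\<lambda>\<omega>. \<eta> \<omega> * ((Y i (m i) t \<omega> $ a - Y i (m i) s \<omega> $ a) * (Y j (m j) t \<omega> $ b - Y j (m j) s \<omega> $ b))) =
          expectation (\<lambda>\<omega>. \<eta> \<omega> * ((Y (rep i) (m i) t \<omega> $ a - Y (rep i) (m i) s \<omega> $ a) *
            (Y (rep j) (m j) t \<omega> $ b - Y (rep j) (m j) s \<omega> $ b)))"
      proof (rule Bochner_Integration.integral_cong_AE)
        show "(\<lambda>\<omega>. \<eta> \<omega> * ((Y i (m i) t \<omega> $ a - Y i (m i) s \<omega> $ a) * (Y j (m j) t \<omega> $ b - Y j (m j) s \<omega> $ b))) \<in> borel_measurable M"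
          by (intro borel_measurable_times borel_measurable_diff \<eta>M brownian_measurable bm i j st t)
        show "(\<lambda>\<omega>. \<eta> \<omega> * ((Y (rep i) (m i) t \<omega> $ a - Y (rep i) (m i) s \<omega> $ a) *
            (Y (rep j) (m j) t \<omega> $ b - Y (rep j) (m j) s \<omega> $ b))) \<in> borel_measurable M"
          by (intro borel_measurable_times borel_measurable_diff \<eta>M brownian_measurable bm rep_I i j st t)
        show "AE \<omega> in M. \<eta> \<omega> * ((Y i (m i) t \<omega> $ a - Y i (m i) s \<omega> $ a) * (Y j (m j) t \<omega> $ b - Y j (m j) s \<omega> $ b)) =
          \<eta> \<omega> * ((Y (rep i) (m i) t \<omega> $ a - Y (rep i) (m i) s \<omega> $ a) *
            (Y (rep j) (m j) t \<omega> $ b - Y (rep j) (m j) s \<omega> $ b))"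
          using Y_rep[OF i, of "m i"] Y_rep[OF j, of "m j"]
        proof eventually_elim
          case (elim \<omega>)
          then show ?case using st t by simp
        qed
      qed
      also have "\<dots> = 0"
        by (rule independent_brownian_covariation[OF bm[OF rep_I[OF i]] bm[OF rep_I[OF j]] ind[OF i j False] st \<eta>])
      finally show ?thesis using False by (simp only: k fst_conv snd_conv prod.inject simp_thms if_False)
    qed
  qed
qed

section \<open>Solutions of the system\<close>

text \<open>
  Almost surely the bound holds for almost every time, hence for a dense set of times. Each
  partial sum is continuous in time and so obeys the bound at every time.
\<close>

lemma in_L_infinity_imp_energy_bound:
  fixes X :: "real \<Rightarrow> 'a \<Rightarrow> int \<Rightarrow> real ^ 'd"
  assumes "prob_space M" and X: "in_L_infinity M X"
    and cont: "\<And>n. 1 \<le> n \<Longrightarrow> AE \<omega> in M. continuous_on {0..} (\<lambda>t. X t \<omega> n)"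
  obtains C where "AE \<omega> in M. \<forall>t\<ge>0. \<forall>m. (\<Sum>n=1..m. (norm (X t \<omega> n))\<^sup>2) \<le> C"
proof -
  interpret prob_space M by fact
  let ?L = "restrict_space lborel {0::real..}"
  have "sigma_finite_measure ?L"
    by (rule sigma_finite_measure_restrict_space[OF sigma_finite_lborel]) simp
  then interpret pair_sigma_finite M ?L
    by (intro pair_sigma_finite.intro sigma_finite_measure_axioms)
  obtain C0 where "AE x in completion (M \<Otimes>\<^sub>M ?L). case x of (\<omega>, t) \<Rightarrow> X t \<omega> \<in> ell2 \<and> ell2_norm (X t \<omega>) \<le> C0"
    using X unfolding in_L_infinity_def Let_def by blast
  then have "AE x in M \<Otimes>\<^sub>M ?L. case x of (\<omega>, t) \<Rightarrow> X t \<omega> \<in> ell2 \<and> ell2_norm (X t \<omega>) \<le> C0"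
    by (simp only: AE_completion_iff)
  from AE_pair[OF this] have ae: "AE \<omega> in M. AE t in ?L. X t \<omega> \<in> ell2 \<and> ell2_norm (X t \<omega>) \<le> C0"
    by simp
  have cont': "AE \<omega> in M. \<forall>n. 1 \<le> n \<longrightarrow> continuous_on {0..} (\<lambda>t. X t \<omega> n)"
    by (subst AE_all_countable) (use cont in auto)
  have "AE \<omega> in M. \<forall>t\<ge>0. \<forall>m. (\<Sum>n=1..m. (norm (X t \<omega> n))\<^sup>2) \<le> C0\<^sup>2"
    using ae cont'
  proof eventually_elim
    case (elim \<omega>)
    show ?case
    proof (intro allI impI)
      fix t :: real and m :: int assume t: "0 \<le> t"
      let ?f = "\<lambda>t. \<Sum>n=1..m. (norm (X t \<omega> n))\<^sup>2"
      let ?S = "{0..} \<inter> ?f -` {..C0\<^sup>2}"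
      have "continuous_on {0..} ?f"
        by (intro continuous_on_sum continuous_on_power continuous_on_norm) (use elim(2) in auto)
      then have closed: "closed ?S"
        by (rule continuous_closed_preimage) auto
      have bound: "?f s \<le> C0\<^sup>2" if s: "X s \<omega> \<in> ell2" "ell2_norm (X s \<omega>) \<le> C0" for s
      proof -
        have sm: "(\<lambda>n. (norm (X s \<omega> n))\<^sup>2) summable_on {1..}" using s(1) by (simp add: ell2_def)
        have nn: "0 \<le> (\<Sum>\<^sub>\<infinity>n\<in>{1..}. (norm (X s \<omega> n))\<^sup>2)" by (rule infsum_nonneg) simp
        have "?f s \<le> (\<Sum>\<^sub>\<infinity>n\<in>{1..}. (norm (X s \<omega> n))\<^sup>2)"
          by (rule finite_sum_le_infsum[OF sm]) auto
        also have "\<dots> = (ell2_norm (X s \<omega>))\<^sup>2" using nn by (simp add: ell2_norm_def)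
        also have "\<dots> \<le> C0\<^sup>2" using s(2) nn by (intro power_mono) (auto simp: ell2_norm_def)
        finally show ?thesis .
      qed
      have "AE s in lborel. s \<in> {0..} \<longrightarrow> X s \<omega> \<in> ell2 \<and> ell2_norm (X s \<omega>) \<le> C0"
        using elim(1) by (subst (asm) AE_restrict_space_iff) auto
      then have "AE s in lborel. s \<in> {0<..} \<longrightarrow> s \<in> ?S"
        by eventually_elim (use bound in auto)
      then have leb: "AE s\<in>{0<..} in lebesgue. s \<in> ?S" by (rule AE_completion)
      have "s \<in> ?S" if "s \<in> {0<..}" for s
        by (rule mem_closed_if_AE_lebesgue_open[OF open_greaterThan closed leb that])
      then have "closure {0<..} \<subseteq> ?S" using closed by (intro closure_minimal) auto
      then have "t \<in> ?S" using t by (auto simp: closure_greaterThan)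
      then show "?f t \<le> C0\<^sup>2" by simp
    qed
  qed
  then show ?thesis by (rule that)
qed

lemma complete_filtered_prob_spaceD:
  assumes "complete_filtered_prob_space M F"
  shows "filtered_prob_space M F" and "\<And>t. 0 \<le> t \<Longrightarrow> null_sets M \<subseteq> sets (F t)"
proof -
  have "filtration (space M) (\<lambda>t. F (max 0 t))"
    using assms unfolding complete_filtered_prob_space_def by blast
  from filtration.sets_F_mono[OF this] have mono: "sets (F s) \<subseteq> sets (F t)" if "0 \<le> s" "s \<le> t" for s t
    using that by (metis max.absorb2 order_trans)
  show "filtered_prob_space M F"
    using assms mono unfolding complete_filtered_prob_space_def
    by (intro filtered_prob_space.intro filtered_prob_space_axioms.intro) auto
  show "\<And>t. 0 \<le> t \<Longrightarrow> null_sets M \<subseteq> sets (F t)"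
    using assms unfolding complete_filtered_prob_space_def by blast
qed

text \<open>
  A version of the components \<open>X t \<omega> n\<close> that is continuous and bounded
  for every \<open>\<omega>\<close> and all real times, not only almost surely for
  nonnegative times. Such components are jointly measurable in \<open>(\<omega>, t)\<close>.
\<close>

definition regular_version ::
  "'a measure \<Rightarrow> (real \<Rightarrow> 'a measure) \<Rightarrow> (real \<Rightarrow> 'a \<Rightarrow> int \<Rightarrow> real ^ 'd) \<Rightarrow> real \<Rightarrow>
   (int \<Rightarrow> real \<Rightarrow> 'a \<Rightarrow> real ^ 'd) \<Rightarrow> bool" where
  "regular_version M F X C U \<longleftrightarrow>
     (AE \<omega> in M. \<forall>t\<ge>0. \<forall>n. U n t \<omega> = X t \<omega> n) \<and>
     (\<forall>n. \<forall>t\<ge>0. U n t \<in> borel_measurable (F t)) \<and>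
     (\<forall>n t. U n t \<in> borel_measurable M) \<and>
     (\<forall>n. \<forall>\<omega>\<in>space M. continuous_on UNIV (\<lambda>t. U n t \<omega>)) \<and>
     (\<forall>m t. \<forall>\<omega>\<in>space M. (\<Sum>n=1..m. (norm (U n t \<omega>))\<^sup>2) \<le> C) \<and>
     (\<forall>n\<le>0. \<forall>t. \<forall>\<omega>\<in>space M. U n t \<omega> = 0)"

text \<open>
  The components are set to \<open>0\<close> on a null set that contains all paths that are
  discontinuous or violate the energy bound, and are constant before time \<open>0\<close>.
  Completeness of the filtration keeps them adapted.
\<close>

lemma energy_controlled_solution_regular_version:
  fixes X :: "real \<Rightarrow> 'a \<Rightarrow> int \<Rightarrow> real ^ 'd"
  assumes "energy_controlled_solution I \<tau> Istar l \<sigma> k r h B x M F Y X"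
  obtains C U where "regular_version M F X C U"
proof -
  have weak: "weak_solution I \<tau> Istar l \<sigma> k r h B x M F Y X" and Linf: "in_L_infinity M X"
    using assms unfolding energy_controlled_solution_def by auto
  have complete: "complete_filtered_prob_space M F"
    and ell2: "\<And>t \<omega>. 0 \<le> t \<Longrightarrow> \<omega> \<in> space M \<Longrightarrow> X t \<omega> \<in> ell2"
    and adapted: "\<And>n t. 1 \<le> n \<Longrightarrow> 0 \<le> t \<Longrightarrow> (\<lambda>\<omega>. X t \<omega> n) \<in> borel_measurable (F t)"
    and cont: "\<And>n. 1 \<le> n \<Longrightarrow> AE \<omega> in M. continuous_on {0..} (\<lambda>t. X t \<omega> n)"
    using weak unfolding weak_solution_def by auto
  interpret filtered_prob_space M F by (rule complete_filtered_prob_spaceD(1)[OF complete])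
  obtain C where C: "AE \<omega> in M. \<forall>t\<ge>0. \<forall>m. (\<Sum>n=1..m. (norm (X t \<omega> n))\<^sup>2) \<le> C"
    using in_L_infinity_imp_energy_bound[OF prob_space_axioms Linf cont] by blast
  have cont': "AE \<omega> in M. \<forall>n. 1 \<le> n \<longrightarrow> continuous_on {0..} (\<lambda>t. X t \<omega> n)"
    by (subst AE_all_countable) (use cont in auto)
  from C cont' have "AE \<omega> in M. (\<forall>n. 1 \<le> n \<longrightarrow> continuous_on {0..} (\<lambda>t. X t \<omega> n)) \<and>
      (\<forall>t\<ge>0. \<forall>m. (\<Sum>n=1..m. (norm (X t \<omega> n))\<^sup>2) \<le> C)"
    by eventually_elim blast
  then obtain N where N: "N \<in> null_sets M"
    and good: "\<And>\<omega>. \<omega> \<in> space M - N \<Longrightarrow> (\<forall>n. 1 \<le> n \<longrightarrow> continuous_on {0..} (\<lambda>t. X t \<omega> n)) \<and>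
      (\<forall>t\<ge>0. \<forall>m. (\<Sum>n=1..m. (norm (X t \<omega> n))\<^sup>2) \<le> C)"
    unfolding eventually_ae_filter by blast
  define U where "U n t \<omega> = (if \<omega> \<in> N then 0 else X (max 0 t) \<omega> n)" for n t \<omega>
  have X0: "X t \<omega> n = 0" if "n \<le> 0" "0 \<le> t" "\<omega> \<in> space M" for t \<omega> n
    using ell2[OF that(2,3)] that(1) by (simp add: ell2_def)
  have "0 \<le> C"
  proof -
    have "space M - N \<noteq> {}"
      using N emeasure_space_1 by (metis Diff_eq_empty_iff emeasure_eq_0 null_setsD1 null_setsD2 zero_neq_one)
    then obtain \<omega> where "\<omega> \<in> space M - N" by blast
    from good[OF this] have "(\<Sum>n=1..0. (norm (X 0 \<omega> n))\<^sup>2) \<le> C" by blast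
    then show ?thesis by simp
  qed
  have adapted': "U n t \<in> borel_measurable (F t)" if t: "0 \<le> t" for n t
  proof -
    have sp: "space (F t) = space M" by (rule space_F[OF t])
    have NF: "N \<in> sets (F t)" using complete_filtered_prob_spaceD(2)[OF complete t] N by blast
    have "(\<lambda>\<omega>. X t \<omega> n) \<in> borel_measurable (F t)"
    proof (cases "1 \<le> n")
      case False
      then have "X t \<omega> n = 0" if "\<omega> \<in> space (F t)" for \<omega> using X0[OF _ t] that sp by simp
      then show ?thesis by (simp cong: measurable_cong)
    qed (rule adapted[OF _ t])
    moreover have "{\<omega> \<in> space (F t). \<omega> \<in> N} \<in> sets (F t)"
    proof -
      have "{\<omega> \<in> space (F t). \<omega> \<in> N} = N" using sets.sets_into_space[OF NF] by blast
      then show ?thesis using NF by simp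
    qed
    ultimately have "(\<lambda>\<omega>. if \<omega> \<in> N then 0 else X t \<omega> n) \<in> borel_measurable (F t)"
      by (intro measurable_If borel_measurable_const)
    then show ?thesis unfolding U_def[abs_def] using t by (simp only: max_absorb2)
  qed
  have "regular_version M F X C U"
    unfolding regular_version_def
  proof (intro conjI allI ballI impI)
    show "AE \<omega> in M. \<forall>t\<ge>0. \<forall>n. U n t \<omega> = X t \<omega> n"
      using AE_not_in[OF N] by eventually_elim (simp add: U_def)
    show "U n t \<in> borel_measurable (F t)" if "0 \<le> t" for n t by (rule adapted'[OF that])
    show "U n t \<in> borel_measurable M" for n t
    proof -
      have "U n t = U n (max 0 t)" by (simp add: U_def fun_eq_iff)
      moreover have "U n (max 0 t) \<in> borel_measurable M"
        by (rule measurable_F_M[OF adapted']) simp_all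
      ultimately show ?thesis by simp
    qed
    show "continuous_on UNIV (\<lambda>t. U n t \<omega>)" if \<omega>: "\<omega> \<in> space M" for n \<omega>
    proof (cases "\<omega> \<in> N \<or> n \<le> 0")
      case True
      then have "U n t \<omega> = 0" for t using X0[OF _ _ \<omega>, of n "max 0 t"] by (auto simp: U_def)
      then show ?thesis by simp
    next
      case False
      then have "continuous_on {0..} (\<lambda>t. X t \<omega> n)" using good[of \<omega>] \<omega> by auto
      then have "continuous_on UNIV (\<lambda>t. X (max 0 t) \<omega> n)"
        by (rule continuous_on_compose2) (auto intro!: continuous_intros)
      then show ?thesis using False by (simp add: U_def)
    qed
    show "(\<Sum>n=1..m. (norm (U n t \<omega>))\<^sup>2) \<le> C" if \<omega>: "\<omega> \<in> space M" for m t \<omega>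
    proof (cases "\<omega> \<in> N")
      case True
      then show ?thesis using \<open>0 \<le> C\<close> by (simp add: U_def)
    next
      case False
      then show ?thesis using good[of \<omega>] \<omega> by (simp add: U_def)
    qed
    show "U n t \<omega> = 0" if "n \<le> 0" "\<omega> \<in> space M" for n t \<omega>
      using X0[OF that(1) _ that(2), of "max 0 t"] by (simp add: U_def)
  qed
  then show ?thesis by (rule that)
qed

lemma linear_matrix_of_bilinear:
  assumes "bilinear b"
  shows "linear (\<lambda>x. matrix (\<lambda>v. a *\<^sub>R b x v) :: real ^ 'd ^ 'd)"
proof (rule linearI)
  show "matrix (\<lambda>v. a *\<^sub>R b (x + y) v) = matrix (\<lambda>v. a *\<^sub>R b x v) + (matrix (\<lambda>v. a *\<^sub>R b y v) :: real ^ 'd ^ 'd)" for x y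
    by (simp add: matrix_def vec_eq_iff bilinear_ladd[OF assms] distrib_left)
  show "matrix (\<lambda>v. a *\<^sub>R b (c *\<^sub>R x) v) = c *\<^sub>R (matrix (\<lambda>v. a *\<^sub>R b x v) :: real ^ 'd ^ 'd)" for c x
    by (simp add: matrix_def vec_eq_iff bilinear_lmul[OF assms] mult.left_commute)
qed

lemma bilinear_sum_axis_left:
  fixes b :: "real ^ 'd \<Rightarrow> real ^ 'd \<Rightarrow> real ^ 'd"
  assumes "bilinear b"
  shows "b x v = (\<Sum>\<beta>\<in>UNIV. (x $ \<beta>) *\<^sub>R b (axis \<beta> 1) v)"
proof -
  have lin: "linear (\<lambda>x. b x v)" using assms by (simp add: bilinear_def)
  have "b x v = b (\<Sum>\<beta>\<in>UNIV. (x $ \<beta>) *\<^sub>R axis \<beta> 1) v"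
    using basis_expansion[of x] by (simp add: scalar_mult_eq_scaleR)
  also have "\<dots> = (\<Sum>\<beta>\<in>UNIV. (x $ \<beta>) *\<^sub>R b (axis \<beta> 1) v)"
    by (simp add: linear_sum[OF lin] linear_scale[OF lin])
  finally show ?thesis .
qed

text \<open>
  Adjointness exchanges the first two indices of the coefficients. Summing over the output
  and noise indices of \<open>b\<close> is therefore summing over the last two indices of
  \<open>b'\<close>, which gives the matrix \<open>L\<close> of \<open>b'\<close>.
\<close>

lemma frobenius_norm_of_adjoint_pair:
  fixes b b' :: "real ^ 'd \<Rightarrow> real ^ 'd \<Rightarrow> real ^ 'd"
  assumes bil: "bilinear b" and adj: "\<And>u v w. u \<bullet> b' v w = v \<bullet> b u w" and L: "L_matrix b' = mat 1"
  shows "(\<Sum>e\<in>UNIV. \<Sum>d\<in>UNIV. (matrix (\<lambda>v. a *\<^sub>R b x v) $ e $ d)\<^sup>2) = a\<^sup>2 * (norm x)\<^sup>2"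
proof -
  have coeff: "b (axis \<beta> 1) (axis d 1) $ e = B_coeff b' \<beta> e d" for \<beta> d e
    using adj[of "axis \<beta> 1" "axis e 1" "axis d 1"]
    by (simp add: B_coeff_def inner_axis inner_commute[of "axis _ _"])
  have entry: "matrix (\<lambda>v. a *\<^sub>R b x v) $ e $ d = a * (\<Sum>\<beta>\<in>UNIV. x $ \<beta> * B_coeff b' \<beta> e d)" for e d
    by (simp add: matrix_def bilinear_sum_axis_left[OF bil, of x] coeff)
  have orth: "(\<Sum>e\<in>UNIV. \<Sum>d\<in>UNIV. B_coeff b' \<beta> e d * B_coeff b' \<gamma> e d) = (if \<beta> = \<gamma> then 1 else 0)" for \<beta> \<gamma>
  proof -
    have "L_matrix b' $ \<beta> $ \<gamma> = (mat 1 :: real ^ 'd ^ 'd) $ \<beta> $ \<gamma>" by (simp only: L)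
    then show ?thesis by (simp add: L_matrix_def mat_def)
  qed
  have "(\<Sum>e\<in>UNIV. \<Sum>d\<in>UNIV. (\<Sum>\<beta>\<in>UNIV. x $ \<beta> * B_coeff b' \<beta> e d)\<^sup>2) =
      (\<Sum>e\<in>UNIV. \<Sum>d\<in>UNIV. \<Sum>\<beta>\<in>UNIV. \<Sum>\<gamma>\<in>UNIV. (x $ \<beta> * x $ \<gamma>) * (B_coeff b' \<beta> e d * B_coeff b' \<gamma> e d))"
    by (simp only: power2_eq_square sum_product ac_simps)
  also have "\<dots> = (\<Sum>e\<in>UNIV. \<Sum>\<beta>\<in>UNIV. \<Sum>\<gamma>\<in>UNIV. \<Sum>d\<in>UNIV. (x $ \<beta> * x $ \<gamma>) * (B_coeff b' \<beta> e d * B_coeff b' \<gamma> e d))"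
    by (rule sum.cong[OF refl], rule trans[OF sum.swap], rule sum.cong[OF refl], rule sum.swap)
  also have "\<dots> = (\<Sum>\<beta>\<in>UNIV. \<Sum>\<gamma>\<in>UNIV. \<Sum>e\<in>UNIV. \<Sum>d\<in>UNIV. (x $ \<beta> * x $ \<gamma>) * (B_coeff b' \<beta> e d * B_coeff b' \<gamma> e d))"
    by (rule trans[OF sum.swap], rule sum.cong[OF refl], rule sum.swap)
  also have "\<dots> = (\<Sum>\<beta>\<in>UNIV. \<Sum>\<gamma>\<in>UNIV. (x $ \<beta> * x $ \<gamma>) * (if \<beta> = \<gamma> then 1 else 0))"
    by (simp only: sum_distrib_left[symmetric] orth)
  also have "\<dots> = (norm x)\<^sup>2"
    by (simp add: power2_norm_eq_inner inner_vec_def if_distrib cong: if_cong)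
  finally show ?thesis
    unfolding entry power_mult_distrib sum_distrib_left[symmetric] by simp
qed

section \<open>Uniqueness\<close>

lemma regular_versionD:
  assumes "regular_version M F X C U"
  shows "AE \<omega> in M. \<forall>t\<ge>0. \<forall>n. U n t \<omega> = X t \<omega> n"
    and "\<And>n t. 0 \<le> t \<Longrightarrow> U n t \<in> borel_measurable (F t)"
    and "\<And>n t. U n t \<in> borel_measurable M"
    and "\<And>n \<omega>. \<omega> \<in> space M \<Longrightarrow> continuous_on UNIV (\<lambda>t. U n t \<omega>)"
    and "\<And>m t \<omega>. \<omega> \<in> space M \<Longrightarrow> (\<Sum>n=1..m. (norm (U n t \<omega>))\<^sup>2) \<le> C"
    and "\<And>n t \<omega>. n \<le> 0 \<Longrightarrow> \<omega> \<in> space M \<Longrightarrow> U n t \<omega> = 0"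
  using assms unfolding regular_version_def by blast+

lemma regular_version_norm_le:
  assumes "regular_version M F X C U" "\<omega> \<in> space M"
  shows "norm (U n t \<omega>) \<le> sqrt C"
proof -
  note U = regular_versionD[OF assms(1)]
  have "(norm (U n t \<omega>))\<^sup>2 \<le> C"
  proof (cases "1 \<le> n")
    case True
    then have "(norm (U n t \<omega>))\<^sup>2 \<le> (\<Sum>n=1..n. (norm (U n t \<omega>))\<^sup>2)" by (intro member_le_sum) auto
    also have "\<dots> \<le> C" by (rule U(5)[OF assms(2)])
    finally show ?thesis .
  next
    case False
    then show ?thesis using U(5)[OF assms(2), where m = 0] U(6)[OF _ assms(2), of n t] by simp
  qed
  then show ?thesis by (rule real_le_rsqrt)
qed

lemma regular_version_diff:
  assumes "regular_version M F X1 C1 U1" "regular_version M F X2 C2 U2"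
  shows "(\<lambda>\<omega>. U1 m s \<omega> - U2 m s \<omega>) \<in> borel_measurable M"
    and "\<And>\<omega>. \<omega> \<in> space M \<Longrightarrow> continuous_on UNIV (\<lambda>s. U1 m s \<omega> - U2 m s \<omega>)"
    and "(\<lambda>x. U1 m (snd x) (fst x) - U2 m (snd x) (fst x)) \<in> borel_measurable (M \<Otimes>\<^sub>M borel)"
    and "\<And>\<omega>. \<omega> \<in> space M \<Longrightarrow> norm (U1 m s \<omega> - U2 m s \<omega>) \<le> sqrt C1 + sqrt C2"
proof -
  note U1 = regular_versionD[OF assms(1)] and U2 = regular_versionD[OF assms(2)]
  show meas: "(\<lambda>\<omega>. U1 m s \<omega> - U2 m s \<omega>) \<in> borel_measurable M" for s
    by (rule borel_measurable_diff[OF U1(3) U2(3)])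
  show cont: "continuous_on UNIV (\<lambda>s. U1 m s \<omega> - U2 m s \<omega>)" if "\<omega> \<in> space M" for \<omega>
    by (intro continuous_on_diff U1(4) U2(4) that)
  show "(\<lambda>x. U1 m (snd x) (fst x) - U2 m (snd x) (fst x)) \<in> borel_measurable (M \<Otimes>\<^sub>M borel)"
    by (rule jointly_measurable_of_continuous[OF meas cont])
  show "norm (U1 m s \<omega> - U2 m s \<omega>) \<le> sqrt C1 + sqrt C2" if "\<omega> \<in> space M" for \<omega>
    by (rule order_trans[OF norm_triangle_ineq4
          add_mono[OF regular_version_norm_le[OF assms(1) that] regular_version_norm_le[OF assms(2) that]]])
qed

text \<open>
  As the matrices \<open>L\<^sub>i\<close> are the identity, the drift of component
  \<open>n\<close> is a multiple of the component itself. Moving it to the left-hand side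
  leaves the sum of the stochastic integrals, as \<open>mean_square_identity\<close>
  requires.
\<close>

lemma weak_solution_L2_ito_integral:
  fixes B :: "'i \<Rightarrow> real ^ 'd \<Rightarrow> real ^ 'd \<Rightarrow> real ^ 'd" and U :: "int \<Rightarrow> real \<Rightarrow> 'a \<Rightarrow> real ^ 'd"
    and Y :: "'i \<Rightarrow> int \<Rightarrow> real \<Rightarrow> 'a \<Rightarrow> real ^ 'd" and h :: "'i \<Rightarrow> int" and n :: int and M :: "'a measure"
  defines "W \<equiv> \<lambda>\<kappa> t \<omega>. Y (fst \<kappa>) (n + h (fst \<kappa>)) t \<omega> $ snd \<kappa>"
  assumes orth: "orthogonal_increments M F (I \<times> UNIV) W"
    and weak: "weak_solution I \<tau> Istar l \<sigma> k r h B x M F Y X"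
    and reg: "regular_version M F X C U"
    and I: "finite I" and bil: "\<And>i. i \<in> I \<Longrightarrow> bilinear (B i)"
    and L: "\<And>i. i \<in> I \<Longrightarrow> L_matrix (B i) = mat 1"
    and n: "1 \<le> n" and t: "0 \<le> t"
  shows "orthogonal_increments.L2_ito_integral M F (I \<times> UNIV) W
    (\<lambda>\<kappa> s \<omega>. \<Sum>i\<in>I. \<Sum>d\<in>UNIV. if \<kappa> = (i, d)
       then matrix (\<lambda>v. (\<sigma> * k_coeff l k r h i n) *\<^sub>R B i (U (n + r i) s \<omega>) v) $ e $ d else 0) t
    (\<lambda>\<omega>. U n t \<omega> $ e - x n $ e +
       (\<Sum>i\<in>I. \<sigma>\<^sup>2 / 2 * (k_coeff l k r h i n)\<^sup>2) * (\<integral>s. U n s \<omega> $ e \<partial>time_measure t))"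
proof -
  interpret O: orthogonal_increments M F "I \<times> UNIV" W by (rule orth)
  note U = regular_versionD[OF reg]
  obtain Z where Z: "\<And>i. i \<in> I \<Longrightarrow> has_ito_integral M F (Y i (n + h i))
        (\<lambda>s \<omega>. matrix (\<lambda>v. (\<sigma> * k_coeff l k r h i n) *\<^sub>R B i (X s \<omega> (n + r i)) v)) t (Z i)"
    and X_eq: "AE \<omega> in M. X t \<omega> n = x n +
       (\<Sum>i\<in>I. Z i \<omega> - integral {0..t} (\<lambda>s. (\<sigma>\<^sup>2 / 2 * (k_coeff l k r h i n)\<^sup>2) *\<^sub>R (L_matrix (B i) *v X s \<omega> n)))"
    using weak n t unfolding weak_solution_def by meson
  have meas: "(\<lambda>x. U m (snd x) (fst x)) \<in> borel_measurable (M \<Otimes>\<^sub>M borel)" for m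
    by (rule jointly_measurable_of_continuous[OF U(3) U(4)])
  have ito_i: "O.L2_ito_integral (\<lambda>\<kappa> s \<omega>. \<Sum>d\<in>UNIV. if \<kappa> = (i, d)
       then matrix (\<lambda>v. (\<sigma> * k_coeff l k r h i n) *\<^sub>R B i (U (n + r i) s \<omega>) v) $ e $ d else 0) t (\<lambda>\<omega>. Z i \<omega> $ e)"
    if i: "i \<in> I" for i
  proof -
    let ?A = "\<lambda>y. matrix (\<lambda>v. (\<sigma> * k_coeff l k r h i n) *\<^sub>R B i y v) :: real ^ 'd ^ 'd"
    have "linear ?A" by (rule linear_matrix_of_bilinear[OF bil[OF i]])
    then have A: "bounded_linear ?A" by (rule linear_conv_bounded_linear[THEN iffD1])
    then obtain c where c: "0 < c" "\<And>y. norm (?A y) \<le> norm y * c"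
      using bounded_linear.pos_bounded by blast
    show ?thesis
    proof (rule O.L2_ito_integral_of_has_ito_integral[where c = "\<lambda>d. (i, d)" and C = "sqrt C * c", OF _ _ _ Z[OF i] t])
      show "inj (\<lambda>d :: 'd. (i, d))" by (rule injI) simp
      show "range (\<lambda>d :: 'd. (i, d)) \<subseteq> I \<times> UNIV" using i by auto
      show "W (i, d) t = (\<lambda>\<omega>. Y i (n + h i) t \<omega> $ d)" for d t by (simp add: W_def)
      show "(\<lambda>x. ?A (U (n + r i) (snd x) (fst x))) \<in> borel_measurable (M \<Otimes>\<^sub>M borel)"
        by (rule borel_measurable_continuous_on[OF linear_continuous_on[OF A] meas])
      show "norm (?A (U (n + r i) s \<omega>)) \<le> sqrt C * c" if "\<omega> \<in> space M" for s \<omega>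
        using c(2)[of "U (n + r i) s \<omega>"] mult_right_mono[OF regular_version_norm_le[OF reg that, of "n + r i" s], of c] c(1)
        by linarith
      \<comment> \<open>The integrands of the given solution and of its regular version agree outside a null
        set.\<close>
      show "AE \<omega> in M. \<forall>s\<in>{0..t}. ?A (X s \<omega> (n + r i)) = ?A (U (n + r i) s \<omega>)"
        using U(1) by eventually_elim auto
    qed
  qed
  have "O.L2_ito_integral (\<lambda>\<kappa> s \<omega>. \<Sum>i\<in>I. \<Sum>d\<in>UNIV. if \<kappa> = (i, d)
       then matrix (\<lambda>v. (\<sigma> * k_coeff l k r h i n) *\<^sub>R B i (U (n + r i) s \<omega>) v) $ e $ d else 0) t (\<lambda>\<omega>. \<Sum>i\<in>I. Z i \<omega> $ e)"
    by (rule O.L2_ito_integral_sum[OF I ito_i t])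
  moreover have "AE \<omega> in M. (\<Sum>i\<in>I. Z i \<omega> $ e) = U n t \<omega> $ e - x n $ e +
       (\<Sum>i\<in>I. \<sigma>\<^sup>2 / 2 * (k_coeff l k r h i n)\<^sup>2) * (\<integral>s. U n s \<omega> $ e \<partial>time_measure t)"
    using X_eq U(1) AE_space
  proof eventually_elim
    case (elim \<omega>)
    have cont: "continuous_on {0..t} (\<lambda>s. U n s \<omega>)" by (rule continuous_on_subset[OF U(4)[OF elim(3)]]) simp
    have int_on: "(\<lambda>s. U n s \<omega>) integrable_on {0..t}" by (rule integrable_continuous_real[OF cont])
    have sec: "(\<lambda>s. U n s \<omega> $ e) \<in> borel_measurable borel"
    proof -
      have "(\<lambda>s. U n s \<omega>) \<in> borel_measurable borel" by (rule borel_measurable_continuous_onI[OF U(4)[OF elim(3)]])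
      then show ?thesis by (rule borel_measurable_vec_nth)
    qed
    have cont_e: "continuous_on {0..t} (\<lambda>s. U n s \<omega> $ e)" by (intro continuous_on_component cont)
    have I_eq: "integral {0..t} (\<lambda>s. (\<sigma>\<^sup>2 / 2 * (k_coeff l k r h i n)\<^sup>2) *\<^sub>R (L_matrix (B i) *v X s \<omega> n)) $ e =
        (\<sigma>\<^sup>2 / 2 * (k_coeff l k r h i n)\<^sup>2) * (\<integral>s. U n s \<omega> $ e \<partial>time_measure t)" if i: "i \<in> I" for i
    proof -
      have "integral {0..t} (\<lambda>s. (\<sigma>\<^sup>2 / 2 * (k_coeff l k r h i n)\<^sup>2) *\<^sub>R (L_matrix (B i) *v X s \<omega> n)) =
          integral {0..t} (\<lambda>s. (\<sigma>\<^sup>2 / 2 * (k_coeff l k r h i n)\<^sup>2) *\<^sub>R U n s \<omega>)"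
        by (rule integral_cong) (use elim(2) in \<open>simp add: L[OF i]\<close>)
      also have "\<dots> = (\<sigma>\<^sup>2 / 2 * (k_coeff l k r h i n)\<^sup>2) *\<^sub>R integral {0..t} (\<lambda>s. U n s \<omega>)"
        by (rule integral_cmul)
      finally have "integral {0..t} (\<lambda>s. (\<sigma>\<^sup>2 / 2 * (k_coeff l k r h i n)\<^sup>2) *\<^sub>R (L_matrix (B i) *v X s \<omega> n)) =
          (\<sigma>\<^sup>2 / 2 * (k_coeff l k r h i n)\<^sup>2) *\<^sub>R integral {0..t} (\<lambda>s. U n s \<omega>)" .
      then show ?thesis
        by (simp only: vector_scaleR_component integral_component_eq_cart[OF int_on, of e]
            integral_time_measure_eq_integral[OF sec cont_e] real_scaleR_def)
    qed
    have "U n t \<omega> = X t \<omega> n" using elim(2) t by simp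
    then have "U n t \<omega> $ e = x n $ e + (\<Sum>i\<in>I. Z i \<omega> $ e -
        integral {0..t} (\<lambda>s. (\<sigma>\<^sup>2 / 2 * (k_coeff l k r h i n)\<^sup>2) *\<^sub>R (L_matrix (B i) *v X s \<omega> n)) $ e)"
      using elim(1) by (simp only: vector_add_component sum_component vector_minus_component)
    moreover have "(\<Sum>i\<in>I. Z i \<omega> $ e -
        integral {0..t} (\<lambda>s. (\<sigma>\<^sup>2 / 2 * (k_coeff l k r h i n)\<^sup>2) *\<^sub>R (L_matrix (B i) *v X s \<omega> n)) $ e) =
        (\<Sum>i\<in>I. Z i \<omega> $ e) - (\<Sum>i\<in>I. \<sigma>\<^sup>2 / 2 * (k_coeff l k r h i n)\<^sup>2) * (\<integral>s. U n s \<omega> $ e \<partial>time_measure t)"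
      unfolding sum_distrib_right sum_subtractf[symmetric] by (rule sum.cong[OF refl]) (simp only: I_eq)
    ultimately show ?case by linarith
  qed
  moreover have "(\<lambda>\<omega>. U n t \<omega> $ e - x n $ e +
       (\<Sum>i\<in>I. \<sigma>\<^sup>2 / 2 * (k_coeff l k r h i n)\<^sup>2) * (\<integral>s. U n s \<omega> $ e \<partial>time_measure t)) \<in> borel_measurable M"
  proof -
    have "(\<lambda>\<omega>. \<integral>s. U n s \<omega> $ e \<partial>time_measure t) \<in> borel_measurable M"
      using time_integral_measurable[of "\<lambda>x. U n (snd x) (fst x) $ e" M "\<lambda>_. t", OF borel_measurable_vec_nth[OF meas]]
      by (simp only: fst_conv snd_conv borel_measurable_const)
    then show ?thesis
      by (intro borel_measurable_add borel_measurable_diff borel_measurable_times borel_measurable_const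
          borel_measurable_vec_nth U(3))
  qed
  ultimately show ?thesis by (rule O.L2_ito_integral_cong_AE[OF _ _ _ t])
qed

text \<open>
  Summing \<open>mean_square_identity\<close> over the coordinates, the isometry term
  becomes the gain from the components \<open>n + r i\<close> by
  \<open>frobenius_norm_of_adjoint_pair\<close>, and the drift term becomes the loss. Both
  rates are \<open>(\<sigma> * k_coeff l k r h i n)\<^sup>2\<close>.
\<close>

lemma second_moment_equation:
  fixes B :: "'i \<Rightarrow> real ^ 'd \<Rightarrow> real ^ 'd \<Rightarrow> real ^ 'd" and U1 U2 :: "int \<Rightarrow> real \<Rightarrow> 'a \<Rightarrow> real ^ 'd"
    and Y :: "'i \<Rightarrow> int \<Rightarrow> real \<Rightarrow> 'a \<Rightarrow> real ^ 'd" and h :: "'i \<Rightarrow> int" and n :: int and M :: "'a measure"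
  defines "W \<equiv> \<lambda>\<kappa> t \<omega>. Y (fst \<kappa>) (n + h (fst \<kappa>)) t \<omega> $ snd \<kappa>"
    and "u \<equiv> \<lambda>m s. \<integral>\<omega>. (norm (U1 m s \<omega> - U2 m s \<omega>))\<^sup>2 \<partial>M"
  assumes orth: "orthogonal_increments M F (I \<times> UNIV) W"
    and weak: "weak_solution I \<tau> Istar l \<sigma> k r h B x M F Y X1" "weak_solution I \<tau> Istar l \<sigma> k r h B x M F Y X2"
    and reg: "regular_version M F X1 C1 U1" "regular_version M F X2 C2 U2"
    and I: "finite I" and \<tau>: "\<And>i. i \<in> I \<Longrightarrow> \<tau> i \<in> I"
    and bil: "\<And>i. i \<in> I \<Longrightarrow> bilinear (B i)"
    and adj: "\<And>i u v w. i \<in> I \<Longrightarrow> u \<bullet> B (\<tau> i) v w = v \<bullet> B i u w"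
    and L: "\<And>i. i \<in> I \<Longrightarrow> L_matrix (B i) = mat 1"
    and n: "1 \<le> n" and t: "0 \<le> t"
  shows "u n t = (\<Sum>i\<in>I. (\<sigma> * k_coeff l k r h i n)\<^sup>2 *
    ((\<integral>s. u (n + r i) s \<partial>time_measure t) - (\<integral>s. u n s \<partial>time_measure t)))"
proof -
  interpret O: orthogonal_increments M F "I \<times> UNIV" W by (rule orth)
  note U1 = regular_versionD[OF reg(1)] and U2 = regular_versionD[OF reg(2)]
  define D where "D m s \<omega> = U1 m s \<omega> - U2 m s \<omega>" for m s \<omega>
  define a where "a i = \<sigma> * k_coeff l k r h i n" for i
  define A where "A i y = (matrix (\<lambda>v. a i *\<^sub>R B i y v) :: real ^ 'd ^ 'd)" for i y
  define c where "c = (\<Sum>i\<in>I. \<sigma>\<^sup>2 / 2 * (k_coeff l k r h i n)\<^sup>2)"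
  have c: "2 * c = (\<Sum>i\<in>I. (a i)\<^sup>2)"
    by (simp add: c_def a_def sum_distrib_left power_mult_distrib)
  define E where "E = sqrt C1 + sqrt C2"
  note D_meas = regular_version_diff(1)[OF reg, folded D_def]
    and D_cont = regular_version_diff(2)[OF reg, folded D_def]
    and D_joint = regular_version_diff(3)[OF reg, folded D_def]
    and D_bnd = regular_version_diff(4)[OF reg, folded D_def E_def]
  have De_sq: "\<bar>(D m s \<omega> $ e)\<^sup>2\<bar> \<le> E\<^sup>2" if "\<omega> \<in> space M" for m s \<omega> e
  proof -
    have "\<bar>D m s \<omega> $ e\<bar> \<le> E" using component_le_norm_cart[of "D m s \<omega>" e] D_bnd[OF that, of m s] by linarith
    from power_mono[OF this abs_ge_zero, of 2] show ?thesis by simp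
  qed
  have norm_sq: "(norm v)\<^sup>2 = (\<Sum>e\<in>UNIV. (v $ e)\<^sup>2)" for v :: "real ^ 'd"
    by (simp add: power2_norm_eq_inner[of v] inner_vec_def power2_eq_square[of "v $ _"])
  have joint_sq: "(\<lambda>x. (D m (snd x) (fst x) $ e)\<^sup>2) \<in> borel_measurable (M \<Otimes>\<^sub>M borel)" for m e
    by (rule borel_measurable_power[OF borel_measurable_vec_nth[OF D_joint]])
  have joint_norm: "(\<lambda>x. (norm (D m (snd x) (fst x)))\<^sup>2) \<in> borel_measurable (M \<Otimes>\<^sub>M borel)" for m
    unfolding norm_sq by (rule borel_measurable_sum[OF joint_sq])
  have De_int: "integrable M (\<lambda>\<omega>. (D m s \<omega> $ e)\<^sup>2)" for m s e
    by (rule O.integrable_const_bound[where B = "E\<^sup>2"])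
      (use De_sq in \<open>auto intro!: AE_I2\<close>, rule borel_measurable_power[OF borel_measurable_vec_nth[OF D_meas]])
  have De_Q: "integrable (O.Q t) (\<lambda>x. (D m (snd x) (fst x) $ e)\<^sup>2)" for m e
    by (rule O.integrable_Q_bounded[OF joint_sq, where C = "E\<^sup>2"]) (use De_sq in simp)
  have u_eq: "u m s = (\<Sum>e\<in>UNIV. \<integral>\<omega>. (D m s \<omega> $ e)\<^sup>2 \<partial>M)" for m s
    unfolding u_def D_def[symmetric] norm_sq by (rule Bochner_Integration.integral_sum[OF De_int])
  have u_Q: "(\<integral>s. u m s \<partial>time_measure t) = (\<integral>x. (norm (D m (snd x) (fst x)))\<^sup>2 \<partial>O.Q t)" for m
  proof -
    have "(\<integral>x. (norm (D m (snd x) (fst x)))\<^sup>2 \<partial>O.Q t) =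
        (\<integral>s. (\<integral>\<omega>. (norm (D m (snd (\<omega>, s)) (fst (\<omega>, s))))\<^sup>2 \<partial>M) \<partial>time_measure t)"
    proof (rule O.Fubini_time(1)[OF joint_norm, where C = "E\<^sup>2"])
      fix \<omega> s assume "\<omega> \<in> space M"
      from power_mono[OF D_bnd[OF this, of m s] norm_ge_zero, of 2]
      show "\<bar>(norm (D m (snd (\<omega>, s)) (fst (\<omega>, s))))\<^sup>2\<bar> \<le> E\<^sup>2" by simp
    qed
    then show ?thesis by (simp only: u_def D_def fst_conv snd_conv)
  qed
  define \<Phi> where "\<Phi> e \<kappa> s \<omega> = (\<Sum>i\<in>I. \<Sum>d\<in>UNIV. if \<kappa> = (i, d) then A i (U1 (n + r i) s \<omega>) $ e $ d else 0) +
      - (\<Sum>i\<in>I. \<Sum>d\<in>UNIV. if \<kappa> = (i, d) then A i (U2 (n + r i) s \<omega>) $ e $ d else 0)" for e \<kappa> s \<omega>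
  have sec: "integrable (time_measure s') (\<lambda>s. V s $ e)"
    if "continuous_on UNIV V" "\<And>s. norm (V s) \<le> E'" for V :: "real \<Rightarrow> real ^ 'd" and e s' E'
  proof (rule integrable_time_measure_bounded)
    show "(\<lambda>s. V s $ e) \<in> borel_measurable borel"
      by (rule borel_measurable_vec_nth[OF borel_measurable_continuous_onI[OF that(1)]])
    show "\<bar>V s $ e\<bar> \<le> E'" for s using component_le_norm_cart[of "V s" e] that(2)[of s] by linarith
  qed
  have ito: "O.L2_ito_integral (\<Phi> e) s (\<lambda>\<omega>. D n s \<omega> $ e + c * (\<integral>r. D n r \<omega> $ e \<partial>time_measure s))"
    if s: "0 \<le> s" for s e
  proof -
    note i1 = weak_solution_L2_ito_integral[OF orth[unfolded W_def] weak(1) reg(1) I bil L n s, of e, folded W_def a_def c_def, folded A_def]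
    note i2 = weak_solution_L2_ito_integral[OF orth[unfolded W_def] weak(2) reg(2) I bil L n s, of e, folded W_def a_def c_def, folded A_def]
    have N: "O.L2_ito_integral (\<Phi> e) s (\<lambda>\<omega>.
        (U1 n s \<omega> $ e - x n $ e + c * (\<integral>r. U1 n r \<omega> $ e \<partial>time_measure s)) +
        - (U2 n s \<omega> $ e - x n $ e + c * (\<integral>r. U2 n r \<omega> $ e \<partial>time_measure s)))" (is "O.L2_ito_integral _ _ ?N")
      unfolding \<Phi>_def by (rule O.L2_ito_integral_add[OF i1 O.L2_ito_integral_uminus[OF i2] s])
    have eq: "?N \<omega> = D n s \<omega> $ e + c * (\<integral>r. D n r \<omega> $ e \<partial>time_measure s)" if \<omega>: "\<omega> \<in> space M" for \<omega>
    proof -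
      have j1: "integrable (time_measure s) (\<lambda>r. U1 n r \<omega> $ e)"
        by (rule sec[of "\<lambda>r. U1 n r \<omega>" "sqrt C1", OF U1(4)[OF \<omega>] regular_version_norm_le[OF reg(1) \<omega>]])
      have j2: "integrable (time_measure s) (\<lambda>r. U2 n r \<omega> $ e)"
        by (rule sec[of "\<lambda>r. U2 n r \<omega>" "sqrt C2", OF U2(4)[OF \<omega>] regular_version_norm_le[OF reg(2) \<omega>]])
      have int_eq: "(\<integral>r. D n r \<omega> $ e \<partial>time_measure s) = (\<integral>r. U1 n r \<omega> $ e \<partial>time_measure s) - (\<integral>r. U2 n r \<omega> $ e \<partial>time_measure s)"
        unfolding D_def vector_minus_component by (rule Bochner_Integration.integral_diff[OF j1 j2])
      show ?thesis unfolding int_eq by (simp add: D_def[of n s] algebra_simps)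
    qed
    have meas: "(\<lambda>\<omega>. D n s \<omega> $ e + c * (\<integral>r. D n r \<omega> $ e \<partial>time_measure s)) \<in> borel_measurable M"
    proof -
      have "(\<lambda>\<omega>. \<integral>r. D n r \<omega> $ e \<partial>time_measure s) \<in> borel_measurable M"
        using time_integral_measurable[of "\<lambda>x. D n (snd x) (fst x) $ e" M "\<lambda>_. s", OF borel_measurable_vec_nth[OF D_joint]]
        by (simp only: fst_conv snd_conv borel_measurable_const)
      then show ?thesis
        by (intro borel_measurable_add borel_measurable_times borel_measurable_const borel_measurable_vec_nth D_meas)
    qed
    show ?thesis
      by (rule O.L2_ito_integral_cong_AE[OF N _ meas s]) (rule AE_I2, rule eq)
  qed
  have \<Phi>_path: "O.path (\<Phi> e) (i, d) y = A i (D (n + r i) (snd y) (fst y)) $ e $ d" if i: "i \<in> I" for e i d y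
  proof -
    have pick: "(\<Sum>j\<in>I. \<Sum>d'\<in>UNIV. if (i, d) = (j, d') then f j d' else 0) = f i d" for f :: "'i \<Rightarrow> 'd \<Rightarrow> real"
    proof -
      have "(\<Sum>j\<in>I. \<Sum>d'\<in>UNIV. if (i, d) = (j, d') then f j d' else 0) =
          (\<Sum>j\<in>I. if i = j then (\<Sum>d'\<in>UNIV. if d = d' then f j d' else 0) else 0)"
        by (intro sum.cong refl) auto
      also have "\<dots> = f i d" using i I by simp
      finally show ?thesis .
    qed
    have "linear (A i)" unfolding A_def by (rule linear_matrix_of_bilinear[OF bil[OF i]])
    from linear_diff[OF this] show ?thesis
      unfolding O.path_def \<Phi>_def pick by (simp add: D_def)
  qed
  have mean: "(\<integral>\<omega>. (D n t \<omega> $ e)\<^sup>2 \<partial>M) =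
      (\<Sum>\<kappa>\<in>I \<times> UNIV. \<integral>y. (O.path (\<Phi> e) \<kappa> y)\<^sup>2 \<partial>O.Q t) - 2 * c * (\<integral>y. (D n (snd y) (fst y) $ e)\<^sup>2 \<partial>O.Q t)" for e
  proof -
    have "(\<integral>\<omega>. (D n t \<omega> $ e)\<^sup>2 \<partial>M) =
        (\<Sum>\<kappa>\<in>I \<times> UNIV. \<integral>y. (O.path (\<Phi> e) \<kappa> y)\<^sup>2 \<partial>O.Q t) -
        2 * c * (\<integral>s. (\<integral>\<omega>. (D n s \<omega> $ e)\<^sup>2 \<partial>M) \<partial>time_measure t)"
    proof (rule O.mean_square_identity[where C = E, OF _ _ _ _ ito t])
      show "(\<lambda>\<omega>. D n s \<omega> $ e) \<in> borel_measurable (F s)" if "0 \<le> s" for s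
        unfolding D_def by (intro borel_measurable_vec_nth borel_measurable_diff U1(2) U2(2) that)
      show "(\<lambda>\<omega>. D n s \<omega> $ e) \<in> borel_measurable M" for s by (rule borel_measurable_vec_nth[OF D_meas])
      show "continuous_on UNIV (\<lambda>s. D n s \<omega> $ e)" if "\<omega> \<in> space M" for \<omega>
        by (intro continuous_on_component D_cont that)
      show "\<bar>D n s \<omega> $ e\<bar> \<le> E" if "\<omega> \<in> space M" for s \<omega>
        using component_le_norm_cart[of "D n s \<omega>" e] D_bnd[OF that, of n s] by linarith
    qed
    also have "(\<integral>s. (\<integral>\<omega>. (D n s \<omega> $ e)\<^sup>2 \<partial>M) \<partial>time_measure t) = (\<integral>y. (D n (snd y) (fst y) $ e)\<^sup>2 \<partial>O.Q t)"
      using O.Fubini_time(1)[OF joint_sq, where C = "E\<^sup>2" and T = t, of n e] De_sq by simp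
    finally show ?thesis .
  qed
  have A_int: "integrable (O.Q t) (\<lambda>y. (A i (D (n + r i) (snd y) (fst y)) $ e $ d)\<^sup>2)" if i: "i \<in> I" for i e d
  proof -
    from O.L2_integrandD(3)[OF O.L2_ito_integralD(3)[OF ito[OF t]], of "(i, d)" e] i show ?thesis by (simp add: \<Phi>_path[OF i])
  qed
  have "(\<Sum>e\<in>UNIV. \<Sum>\<kappa>\<in>I \<times> UNIV. \<integral>y. (O.path (\<Phi> e) \<kappa> y)\<^sup>2 \<partial>O.Q t) =
      (\<Sum>e\<in>UNIV. \<Sum>i\<in>I. \<Sum>d\<in>UNIV. \<integral>y. (A i (D (n + r i) (snd y) (fst y)) $ e $ d)\<^sup>2 \<partial>O.Q t)"
  proof (rule sum.cong[OF refl])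
    fix e :: 'd
    have "(\<Sum>\<kappa>\<in>I \<times> UNIV. \<integral>y. (O.path (\<Phi> e) \<kappa> y)\<^sup>2 \<partial>O.Q t) = (\<Sum>i\<in>I. \<Sum>d\<in>UNIV. \<integral>y. (O.path (\<Phi> e) (i, d) y)\<^sup>2 \<partial>O.Q t)"
      by (simp only: sum.cartesian_product case_prod_unfold prod.collapse)
    also have "\<dots> = (\<Sum>i\<in>I. \<Sum>d\<in>UNIV. \<integral>y. (A i (D (n + r i) (snd y) (fst y)) $ e $ d)\<^sup>2 \<partial>O.Q t)"
      by (intro sum.cong refl) (simp only: \<Phi>_path)
    finally show "(\<Sum>\<kappa>\<in>I \<times> UNIV. \<integral>y. (O.path (\<Phi> e) \<kappa> y)\<^sup>2 \<partial>O.Q t) =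
        (\<Sum>i\<in>I. \<Sum>d\<in>UNIV. \<integral>y. (A i (D (n + r i) (snd y) (fst y)) $ e $ d)\<^sup>2 \<partial>O.Q t)" .
  qed
  also have "\<dots> = (\<Sum>i\<in>I. \<Sum>e\<in>UNIV. \<Sum>d\<in>UNIV. \<integral>y. (A i (D (n + r i) (snd y) (fst y)) $ e $ d)\<^sup>2 \<partial>O.Q t)"
    by (rule sum.swap)
  also have "\<dots> = (\<Sum>i\<in>I. (a i)\<^sup>2 * (\<integral>s. u (n + r i) s \<partial>time_measure t))"
  proof (rule sum.cong[OF refl])
    fix i assume i: "i \<in> I"
    have "(\<Sum>e\<in>UNIV. \<Sum>d\<in>UNIV. \<integral>y. (A i (D (n + r i) (snd y) (fst y)) $ e $ d)\<^sup>2 \<partial>O.Q t) =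
        (\<integral>y. (\<Sum>e\<in>UNIV. \<Sum>d\<in>UNIV. (A i (D (n + r i) (snd y) (fst y)) $ e $ d)\<^sup>2) \<partial>O.Q t)"
      by (rule integral_double_sum[symmetric]) (rule A_int[OF i])
    also have "\<dots> = (\<integral>y. (a i)\<^sup>2 * (norm (D (n + r i) (snd y) (fst y)))\<^sup>2 \<partial>O.Q t)"
      unfolding A_def by (simp only: frobenius_norm_of_adjoint_pair[OF bil[OF i] adj[OF i] L[OF \<tau>[OF i]]])
    also have "\<dots> = (a i)\<^sup>2 * (\<integral>s. u (n + r i) s \<partial>time_measure t)" unfolding u_Q by simp
    finally show "(\<Sum>e\<in>UNIV. \<Sum>d\<in>UNIV. \<integral>y. (A i (D (n + r i) (snd y) (fst y)) $ e $ d)\<^sup>2 \<partial>O.Q t) =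
        (a i)\<^sup>2 * (\<integral>s. u (n + r i) s \<partial>time_measure t)" .
  qed
  finally have gain: "(\<Sum>e\<in>UNIV. \<Sum>\<kappa>\<in>I \<times> UNIV. \<integral>y. (O.path (\<Phi> e) \<kappa> y)\<^sup>2 \<partial>O.Q t) =
      (\<Sum>i\<in>I. (a i)\<^sup>2 * (\<integral>s. u (n + r i) s \<partial>time_measure t))" .
  have loss: "(\<Sum>e\<in>UNIV. \<integral>y. (D n (snd y) (fst y) $ e)\<^sup>2 \<partial>O.Q t) = (\<integral>s. u n s \<partial>time_measure t)"
    unfolding u_Q norm_sq by (rule Bochner_Integration.integral_sum[OF De_Q, symmetric])
  have "u n t = (\<Sum>i\<in>I. (a i)\<^sup>2 * (\<integral>s. u (n + r i) s \<partial>time_measure t)) - 2 * c * (\<integral>s. u n s \<partial>time_measure t)"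
    unfolding u_eq[of n t] mean sum_subtractf gain sum_distrib_left[symmetric] loss ..
  also have "\<dots> = (\<Sum>i\<in>I. (a i)\<^sup>2 * ((\<integral>s. u (n + r i) s \<partial>time_measure t) - (\<integral>s. u n s \<partial>time_measure t)))"
    unfolding c by (simp only: right_diff_distrib sum_subtractf sum_distrib_right)
  finally show ?thesis unfolding a_def .
qed

theorem theorem2:
  fixes I Istar :: "'i set"
    and \<tau> :: "'i \<Rightarrow> 'i"
    and l \<sigma> :: real
    and k :: "'i \<Rightarrow> real"
    and r h :: "'i \<Rightarrow> int"
    and B :: "'i \<Rightarrow> real ^ 'd \<Rightarrow> real ^ 'd \<Rightarrow> real ^ 'd"
    and x :: "int \<Rightarrow> real ^ 'd"
    and M :: "'a measure"
    and F :: "real \<Rightarrow> 'a measure"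
    and Y :: "'i \<Rightarrow> int \<Rightarrow> real \<Rightarrow> 'a \<Rightarrow> real ^ 'd"
    and X1 X2 :: "real \<Rightarrow> 'a \<Rightarrow> int \<Rightarrow> real ^ 'd"
  assumes "l > 1"
    and "finite I" and "I \<noteq> {}"
    and "bij_betw \<tau> I I"
    and "\<And>i. i \<in> I \<Longrightarrow> \<tau> i \<noteq> i"
    and "\<And>i. i \<in> I \<Longrightarrow> \<tau> (\<tau> i) = i"
    and "\<And>i. i \<in> I \<Longrightarrow> bilinear (B i)"
    and "\<And>i. i \<in> I \<Longrightarrow> r i \<noteq> 0"
    and "\<And>i. i \<in> I \<Longrightarrow> k (\<tau> i) = - k i * l powi (- r i)"
    and "\<And>i u v w. i \<in> I \<Longrightarrow> u \<bullet> B (\<tau> i) v w = v \<bullet> B i u w"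
    and "\<And>i. i \<in> I \<Longrightarrow> r (\<tau> i) = - r i"
    and "\<And>i. i \<in> I \<Longrightarrow> h (\<tau> i) = h i - r i"
    and "Max (h ` I) \<ge> 0"
    and "Istar \<subseteq> I" and "Istar \<inter> \<tau> ` Istar = {}" and "I = Istar \<union> \<tau> ` Istar"
    and "\<And>i. i \<in> I \<Longrightarrow> L_matrix (B i) = mat 1"
    and "x \<in> ell2"
    and "energy_controlled_solution I \<tau> Istar l \<sigma> k r h B x M F Y X1"
    and "energy_controlled_solution I \<tau> Istar l \<sigma> k r h B x M F Y X2"
  shows "AE \<omega> in M. \<forall>t\<ge>0. X1 t \<omega> = X2 t \<omega>"
proof -
  note finI = assms(2) and invol = assms(6) and bil = assms(7) and r0 = assms(8) and adj = assms(10)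
    and h\<tau> = assms(12) and Istar = assms(14) and I_eq = assms(16) and L = assms(17)
  have \<tau>_I: "\<tau> i \<in> I" if "i \<in> I" for i using bij_betwE[OF assms(4)] that by blast
  have weak: "weak_solution I \<tau> Istar l \<sigma> k r h B x M F Y X1" "weak_solution I \<tau> Istar l \<sigma> k r h B x M F Y X2"
    using assms(19,20) unfolding energy_controlled_solution_def by auto
  obtain C1 U1 where reg1: "regular_version M F X1 C1 U1"
    by (rule energy_controlled_solution_regular_version[OF assms(19)])
  obtain C2 U2 where reg2: "regular_version M F X2 C2 U2"
    by (rule energy_controlled_solution_regular_version[OF assms(20)])
  note U1 = regular_versionD[OF reg1] and U2 = regular_versionD[OF reg2]
  have complete: "complete_filtered_prob_space M F"
    and bm: "\<And>i n. i \<in> I \<Longrightarrow> brownian_motion M F (Y i n)" and sym: "symmetric_family M I \<tau> Istar Y"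
    using weak(1) unfolding weak_solution_def by auto
  have filt: "filtered_prob_space M F" by (rule complete_filtered_prob_spaceD(1)[OF complete])
  interpret filtered_prob_space M F by (rule filt)
  \<comment> \<open>The motions in the \<open>n\<close>-th equation: \<open>h (\<tau> i) = h i - r i\<close>
    differs from \<open>h i\<close>.\<close>
  have orth: "orthogonal_increments M F (I \<times> UNIV) (\<lambda>\<kappa> t \<omega>. Y (fst \<kappa>) (n + h (fst \<kappa>)) t \<omega> $ snd \<kappa>)" for n
    by (rule symmetric_family_orthogonal_increments[where \<tau> = \<tau>, OF filt finI invol Istar I_eq bm sym])
      (use h\<tau> r0 in simp_all)
  define u where "u = (\<lambda>m s. expectation (\<lambda>\<omega>. (norm (U1 m s \<omega> - U2 m s \<omega>))\<^sup>2))"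
  define E where "E = sqrt C1 + sqrt C2"
  have sq_int: "integrable M (\<lambda>\<omega>. (norm (U1 m s \<omega> - U2 m s \<omega>))\<^sup>2)" for m s
  proof (rule integrable_const_bound[where B = "E\<^sup>2"])
    show "AE \<omega> in M. norm ((norm (U1 m s \<omega> - U2 m s \<omega>))\<^sup>2) \<le> E\<^sup>2"
    proof (rule AE_I2)
      fix \<omega> assume \<omega>: "\<omega> \<in> space M"
      from power_mono[OF regular_version_diff(4)[OF reg1 reg2 \<omega>] norm_ge_zero, where n = 2]
      show "norm ((norm (U1 m s \<omega> - U2 m s \<omega>))\<^sup>2) \<le> E\<^sup>2" by (simp add: E_def)
    qed
    show "(\<lambda>\<omega>. (norm (U1 m s \<omega> - U2 m s \<omega>))\<^sup>2) \<in> borel_measurable M"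
      using regular_version_diff(1)[OF reg1 reg2, of m s] by measurable
  qed
  have u_zero: "u n t = 0" if "1 \<le> n" "0 \<le> t" for n t
  proof (rule summable_system_vanishes[where u = u and I = I and q = "\<lambda>i n. (\<sigma> * k_coeff l k r h i n)\<^sup>2" and r = r
        and C = "2 * C1 + 2 * C2", OF finI])
    show "u m \<in> borel_measurable borel" for m
    proof -
      have "(\<lambda>x. (norm (U1 m (snd x) (fst x) - U2 m (snd x) (fst x)))\<^sup>2) \<in> borel_measurable (M \<Otimes>\<^sub>M borel)"
        using regular_version_diff(3)[OF reg1 reg2, of m] by measurable
      from measurable_compose[OF measurable_pair_swap' this]
      have "(\<lambda>(s, \<omega>). (norm (U1 m s \<omega> - U2 m s \<omega>))\<^sup>2) \<in> borel_measurable (borel \<Otimes>\<^sub>M M)"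
        by (simp add: case_prod_unfold)
      then show ?thesis unfolding u_def by (rule borel_measurable_lebesgue_integral)
    qed
    show "0 \<le> u m s" for m s unfolding u_def by (rule Bochner_Integration.integral_nonneg) simp
    show "u m s = 0" if "m \<le> 0" for m s
    proof -
      have "u m s = expectation (\<lambda>\<omega>. 0)"
        unfolding u_def by (rule Bochner_Integration.integral_cong[OF refl]) (use U1(6) U2(6) that in simp)
      then show ?thesis by simp
    qed
    show "(\<Sum>n=1..m. u n s) \<le> 2 * C1 + 2 * C2" for m s
    proof -
      have "(\<Sum>n=1..m. u n s) = expectation (\<lambda>\<omega>. \<Sum>n=1..m. (norm (U1 n s \<omega> - U2 n s \<omega>))\<^sup>2)"
        unfolding u_def by (rule Bochner_Integration.integral_sum[OF sq_int, symmetric])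
      also have "\<dots> \<le> 2 * C1 + 2 * C2"
      proof (rule integral_le_const)
        show "integrable M (\<lambda>\<omega>. \<Sum>n=1..m. (norm (U1 n s \<omega> - U2 n s \<omega>))\<^sup>2)"
          by (rule Bochner_Integration.integrable_sum[OF sq_int])
        show "AE \<omega> in M. (\<Sum>n=1..m. (norm (U1 n s \<omega> - U2 n s \<omega>))\<^sup>2) \<le> 2 * C1 + 2 * C2"
        proof (rule AE_I2)
          fix \<omega> assume \<omega>: "\<omega> \<in> space M"
          have "(\<Sum>n=1..m. (norm (U1 n s \<omega> - U2 n s \<omega>))\<^sup>2) \<le>
              (\<Sum>n=1..m. 2 * (norm (U1 n s \<omega>))\<^sup>2 + 2 * (norm (U2 n s \<omega>))\<^sup>2)"
          proof (rule sum_mono)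
            fix n
            show "(norm (U1 n s \<omega> - U2 n s \<omega>))\<^sup>2 \<le> 2 * (norm (U1 n s \<omega>))\<^sup>2 + 2 * (norm (U2 n s \<omega>))\<^sup>2"
              using norm_square_le_double[of "U1 n s \<omega> - U2 n s \<omega>" "- U2 n s \<omega>"] by simp
          qed
          also have "\<dots> = 2 * (\<Sum>n=1..m. (norm (U1 n s \<omega>))\<^sup>2) + 2 * (\<Sum>n=1..m. (norm (U2 n s \<omega>))\<^sup>2)"
            by (simp add: sum.distrib sum_distrib_left)
          also have "\<dots> \<le> 2 * C1 + 2 * C2" using U1(5)[OF \<omega>, of s m] U2(5)[OF \<omega>, of s m] by linarith
          finally show "(\<Sum>n=1..m. (norm (U1 n s \<omega> - U2 n s \<omega>))\<^sup>2) \<le> 2 * C1 + 2 * C2" .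
        qed
      qed
      finally show ?thesis .
    qed
    show "u m s = (\<Sum>i\<in>I. (\<sigma> * k_coeff l k r h i m)\<^sup>2 *
        ((\<integral>s'. u (m + r i) s' \<partial>time_measure s) - (\<integral>s'. u m s' \<partial>time_measure s)))" if "1 \<le> m" "0 \<le> s" for m s
      unfolding u_def by (rule second_moment_equation[OF orth weak reg1 reg2 finI \<tau>_I bil adj L that])
  qed (use that in simp_all)
  have "AE \<omega> in M. U1 n (of_rat p) \<omega> = U2 n (of_rat p) \<omega>" if n: "1 \<le> n" and p: "0 \<le> p" for n p
  proof -
    have "expectation (\<lambda>\<omega>. (norm (U1 n (of_rat p) \<omega> - U2 n (of_rat p) \<omega>))\<^sup>2) = 0"
      using u_zero[OF n, of "of_rat p"] p by (simp add: u_def)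
    then have "AE \<omega> in M. (norm (U1 n (of_rat p) \<omega> - U2 n (of_rat p) \<omega>))\<^sup>2 = 0"
      by (subst (asm) integral_nonneg_eq_0_iff_AE[OF sq_int]) simp_all
    then show ?thesis by eventually_elim simp
  qed
  then have rational: "AE \<omega> in M. \<forall>n p. 1 \<le> n \<longrightarrow> 0 \<le> p \<longrightarrow> U1 n (of_rat p) \<omega> = U2 n (of_rat p) \<omega>"
    unfolding AE_all_countable by auto
  show ?thesis
    using rational U1(1) U2(1) AE_space
  proof eventually_elim
    case (elim \<omega>)
    have eq: "U1 n t \<omega> = U2 n t \<omega>" if n: "1 \<le> n" and t: "0 \<le> t" for n t
    proof -
      \<comment> \<open>The absolute value turns equality at nonnegative rational times into equality on a
        dense subset of the line.\<close>
      let ?f = "\<lambda>t. U1 n \<bar>t\<bar> \<omega> - U2 n \<bar>t\<bar> \<omega>"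
      have "?f t = 0"
      proof (rule continuous_constant_on_closure[of "\<rat>" ?f])
        show "continuous_on (closure \<rat>) ?f"
          by (rule continuous_on_compose2[OF regular_version_diff(2)[OF reg1 reg2 elim(4)]]) (auto intro!: continuous_intros)
        show "?f s = 0" if "s \<in> \<rat>" for s
        proof -
          from that obtain p where "\<bar>s\<bar> = of_rat p" by (metis Rats_abs_iff Rats_cases)
          moreover from this have "0 \<le> p" by (metis abs_ge_zero zero_le_of_rat_iff)
          ultimately show ?thesis using elim(1) n by simp
        qed
        show "t \<in> closure \<rat>" by (simp add: Rats_closure_real)
      qed
      then show ?thesis using t by simp
    qed
    show ?case
    proof (intro allI impI ext)
      fix t :: real and n :: int assume t: "0 \<le> t"
      have "U1 n t \<omega> = U2 n t \<omega>"
        using eq[of n t] t U1(6)[OF _ elim(4), of n t] U2(6)[OF _ elim(4), of n t] by (cases "1 \<le> n") simp_all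
      then show "X1 t \<omega> n = X2 t \<omega> n" using elim(2,3) t by simp
    qed
  qed
qed

end
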